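(* (1) For $G_n=O_n$ with Haar measure, as $n\to\infty$ the family $(\mathrm{Tr}(u^k))_{k\ge1}$ converges in joint moments to a family $(u_k)_{k\ge1}$ of independent real Gaussian random variables, where $u_k$ has variance $k$ and mean $0$ if $k$ is odd and $1$ if $k$ is even. (2) For $G_n=O_n^+$ with Haar state, as $n\to\infty$ the family $(\mathrm{Tr}(u^k))_{k\ge1}$ converges in joint $*$-distribution to a $*$-free family $(u_k)_{k\ge1}$ in which $u_1$ is semicircular with mean $0$ and variance $1$, $u_2$ is semicircular with mean $1$ and variance $1$, and for $k\ge3$, $u_k$ is circular with mean $0$ and covariance $1$.
   Context: $u=(u_{ij})$ is the fundamental representation: for $O_n$ the coordinate functions; $C(O_n^+)$ is the universal unital $C^*$-algebra generated by self-adjoint $u_{ij}$ ($1\le i,j\le n$) such that $u$ is orthogonal, a compact quantum group with $\Delta(u_{ij})=\sum_k u_{ik}\otimes u_{kj}$ and Haar state $h$. $\mathrm{Tr}(u^k)=\sum_{i_1,\dots,i_k}u_{i_1i_2}\cdots u_{i_ki_1}$. Convergence in joint $*$-distribution to $(u_k)$ in a noncommutative probability space $(A,\varphi)$ means $h(\mathrm{Tr}(u^{k_1})^{e_1}\cdots\mathrm{Tr}(u^{k_s})^{e_s})\to\varphi(u_{k_1}^{e_1}\cdots u_{k_s}^{e_s})$ for all $k_i$ and $e_i\in\{1,*\}$. A semicircular element of mean $m$ and variance $\sigma^2$ is a self-adjoint element with distribution the semicircle law on $[m-2\sigma,m+2\sigma]$. A circular element of mean $0$ and covariance $1$ is $c=(s_1+is_2)/\sqrt2$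 with $s_1,s_2$ free standard (mean $0$, variance $1$) semicircular elements. *)

theory Defs
  imports "HOL-Probability.Probability"
begin

text \<open>n x n real matrices are functions on nat x nat, vanishing outside {..<n} x {..<n}.\<close>

type_synonym rmat = "nat \<times> nat \<Rightarrow> real"

definition mat_mult :: "nat \<Rightarrow> rmat \<Rightarrow> rmat \<Rightarrow> rmat" where
  "mat_mult n A B = (\<lambda>(i,j). if i < n \<and> j < n then (\<Sum>k<n. A (i,k) * B (k,j)) else 0)"

definition mat_id :: "nat \<Rightarrow> rmat" where
  "mat_id n = (\<lambda>(i,j). if i < n \<and> i = j then 1 else 0)"

definition mat_transpose :: "rmat \<Rightarrow> rmat" where
  "mat_transpose A = (\<lambda>(i,j). A (j,i))"

definition orth_group :: "nat \<Rightarrow> rmat set" where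
  "orth_group n = {A. (\<forall>i j. \<not> (i < n \<and> j < n) \<longrightarrow> A (i,j) = 0)
      \<and> mat_mult n A (mat_transpose A) = mat_id n
      \<and> mat_mult n (mat_transpose A) A = mat_id n}"

definition haar_On :: "nat \<Rightarrow> rmat measure \<Rightarrow> bool" where
  "haar_On n \<mu> \<longleftrightarrow> prob_space \<mu> \<and> space \<mu> = orth_group n
     \<and> sets \<mu> = sets (restrict_space borel (orth_group n))
     \<and> (\<forall>g\<in>orth_group n. distr \<mu> \<mu> (mat_mult n g) = \<mu>)"

fun mat_pow :: "nat \<Rightarrow> rmat \<Rightarrow> nat \<Rightarrow> rmat" where
  "mat_pow n A 0 = mat_id n"
| "mat_pow n A (Suc k) = mat_mult n A (mat_pow n A k)"

definition tr_pow :: "nat \<Rightarrow> nat \<Rightarrow> rmat \<Rightarrow> real" where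
  "tr_pow n k A = (\<Sum>i<n. mat_pow n A k (i,i))"

text \<open>Noncommutative polynomials over generators of type 'g: finitely supported
  complex coefficient functions on words.  For O_n^+ the generators are the pairs
  (i,j) with i,j < n (standing for u_ij); all generators are self-adjoint.\<close>

type_synonym 'g ncpoly = "'g list \<Rightarrow> complex"

definition ncp_mono :: "'g list \<Rightarrow> 'g ncpoly" where
  "ncp_mono w = (\<lambda>v. if v = w then 1 else 0)"

definition ncp_mult :: "'g ncpoly \<Rightarrow> 'g ncpoly \<Rightarrow> 'g ncpoly" where
  "ncp_mult p q = (\<lambda>w. \<Sum>i\<le>length w. p (take i w) * q (drop i w))"

definition ncp_star :: "'g ncpoly \<Rightarrow> 'g ncpoly" where
  "ncp_star p = (\<lambda>w. cnj (p (rev w)))"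

definition ncp_supp :: "'g ncpoly \<Rightarrow> 'g list set" where
  "ncp_supp p = {w. p w \<noteq> 0}"

definition ncp_eval :: "('g list \<Rightarrow> complex) \<Rightarrow> 'g ncpoly \<Rightarrow> complex" where
  "ncp_eval h p = (\<Sum>w\<in>ncp_supp p. p w * h w)"

definition gens :: "nat \<Rightarrow> (nat \<times> nat) set" where
  "gens n = {..<n} \<times> {..<n}"

definition free_pol :: "nat \<Rightarrow> (nat \<times> nat) ncpoly set" where
  "free_pol n = {p. finite (ncp_supp p) \<and> (\<forall>w\<in>ncp_supp p. set w \<subseteq> gens n)}"

text \<open>Orthogonality relations u u^t = 1 and u^t u = 1 (entrywise).\<close>

definition orth_rels :: "nat \<Rightarrow> (nat \<times> nat) ncpoly set" where
  "orth_rels n =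
     {(\<lambda>w. (if \<exists>k<n. w = [(i,k),(j,k)] then 1 else 0) - (if i = j \<and> w = [] then 1 else 0))
        | i j. i < n \<and> j < n}
   \<union> {(\<lambda>w. (if \<exists>k<n. w = [(k,i),(k,j)] then 1 else 0) - (if i = j \<and> w = [] then 1 else 0))
        | i j. i < n \<and> j < n}"

text \<open>The two-sided ideal of the free *-algebra generated by the relations;
  Pol(O_n^+) is the quotient, a dense *-subalgebra of C(O_n^+).\<close>

inductive_set orth_ideal :: "nat \<Rightarrow> (nat \<times> nat) ncpoly set" for n where
  zero: "(\<lambda>_. 0) \<in> orth_ideal n"
| gen: "r \<in> orth_rels n \<Longrightarrow> set a \<subseteq> gens n \<Longrightarrow> set b \<subseteq> gens n \<Longrightarrow>
        ncp_mult (ncp_mult (ncp_mono a) r) (ncp_mono b) \<in> orth_ideal n"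
| add: "p \<in> orth_ideal n \<Longrightarrow> q \<in> orth_ideal n \<Longrightarrow> (\<lambda>w. p w + q w) \<in> orth_ideal n"
| smul: "p \<in> orth_ideal n \<Longrightarrow> (\<lambda>w. c * p w) \<in> orth_ideal n"

definition idx_lists :: "nat \<Rightarrow> nat \<Rightarrow> nat list set" where
  "idx_lists n p = {ks. length ks = p \<and> set ks \<subseteq> {..<n}}"

text \<open>The Haar state of O_n^+, given by its values h w on the monomials w:
  a unital positive linear functional on Pol(O_n^+) (vanishing on the ideal of
  relations) which is left and right invariant with respect to the
  comultiplication Delta(u_ij) = sum_k u_ik (x) u_kj, i.e.
  (id (x) h) Delta(x) = h(x) 1 = (h (x) id) Delta(x) in Pol(O_n^+).\<close>

definition haar_Onplus :: "nat \<Rightarrow> ((nat \<times> nat) list \<Rightarrow> complex) \<Rightarrow> bool" where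
  "haar_Onplus n h \<longleftrightarrow>
     h [] = 1
   \<and> (\<forall>p\<in>orth_ideal n. ncp_eval h p = 0)
   \<and> (\<forall>p\<in>free_pol n. Im (ncp_eval h (ncp_mult (ncp_star p) p)) = 0
                      \<and> Re (ncp_eval h (ncp_mult (ncp_star p) p)) \<ge> 0)
   \<and> (\<forall>w. set w \<subseteq> gens n \<longrightarrow>
        (\<lambda>v. (\<Sum>ks\<in>idx_lists n (length w).
                 h (zip ks (map snd w)) * ncp_mono (zip (map fst w) ks) v)
             - h w * ncp_mono [] v) \<in> orth_ideal n)
   \<and> (\<forall>w. set w \<subseteq> gens n \<longrightarrow>
        (\<lambda>v. (\<Sum>ks\<in>idx_lists n (length w).
                 h (zip (map fst w) ks) * ncp_mono (zip ks (map snd w)) v)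
             - h w * ncp_mono [] v) \<in> orth_ideal n)"

text \<open>Tr(u^k) = sum_{i_1..i_k} u_{i_1 i_2} ... u_{i_k i_1} as a polynomial.\<close>

definition tr_poly :: "nat \<Rightarrow> nat \<Rightarrow> (nat \<times> nat) ncpoly" where
  "tr_poly n k = (\<lambda>w. \<Sum>is\<in>idx_lists n k. ncp_mono (zip is (rotate1 is)) w)"

fun tr_moment :: "nat \<Rightarrow> (nat \<times> bool) list \<Rightarrow> (nat \<times> nat) ncpoly" where
  "tr_moment n [] = ncp_mono []"
| "tr_moment n ((k,e) # ks) =
     ncp_mult (if e then ncp_star (tr_poly n k) else tr_poly n k) (tr_moment n ks)"

definition star_prob_space ::
  "(complex \<Rightarrow> 'a::ring_1 \<Rightarrow> 'a) \<Rightarrow> ('a \<Rightarrow> 'a) \<Rightarrow> ('a \<Rightarrow> complex) \<Rightarrow> bool" where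
  "star_prob_space sm st \<phi> \<longleftrightarrow>
     (\<forall>a x y. sm a (x + y) = sm a x + sm a y)
   \<and> (\<forall>a b x. sm (a + b) x = sm a x + sm b x)
   \<and> (\<forall>a b x. sm a (sm b x) = sm (a * b) x)
   \<and> (\<forall>x. sm 1 x = x)
   \<and> (\<forall>a x y. sm a (x * y) = sm a x * y \<and> sm a (x * y) = x * sm a y)
   \<and> (\<forall>x. st (st x) = x)
   \<and> (\<forall>x y. st (x + y) = st x + st y)
   \<and> (\<forall>x y. st (x * y) = st y * st x)
   \<and> (\<forall>a x. st (sm a x) = sm (cnj a) (st x))
   \<and> st 1 = 1
   \<and> (\<forall>x y. \<phi> (x + y) = \<phi> x + \<phi> y)
   \<and> (\<forall>a x. \<phi> (sm a x) = a * \<phi> x)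
   \<and> \<phi> 1 = 1
   \<and> (\<forall>x. Im (\<phi> (st x * x)) = 0 \<and> Re (\<phi> (st x * x)) \<ge> 0)"

inductive_set star_alg :: "(complex \<Rightarrow> 'a::ring_1 \<Rightarrow> 'a) \<Rightarrow> ('a \<Rightarrow> 'a) \<Rightarrow> 'a \<Rightarrow> 'a set"
  for sm st x where
  one: "1 \<in> star_alg sm st x"
| gen: "x \<in> star_alg sm st x"
| gen_star: "st x \<in> star_alg sm st x"
| add: "a \<in> star_alg sm st x \<Longrightarrow> b \<in> star_alg sm st x \<Longrightarrow> a + b \<in> star_alg sm st x"
| mult: "a \<in> star_alg sm st x \<Longrightarrow> b \<in> star_alg sm st x \<Longrightarrow> a * b \<in> star_alg sm st x"
| smul: "a \<in> star_alg sm st x \<Longrightarrow> sm c a \<in> star_alg sm st x"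

definition star_free ::
  "(complex \<Rightarrow> 'a::ring_1 \<Rightarrow> 'a) \<Rightarrow> ('a \<Rightarrow> 'a) \<Rightarrow> ('a \<Rightarrow> complex) \<Rightarrow> 'i set \<Rightarrow> ('i \<Rightarrow> 'a) \<Rightarrow> bool" where
  "star_free sm st \<phi> I x \<longleftrightarrow>
     (\<forall>ps :: ('i \<times> 'a) list.
        ps \<noteq> []
      \<and> (\<forall>(i,a)\<in>set ps. i \<in> I \<and> a \<in> star_alg sm st (x i) \<and> \<phi> a = 0)
      \<and> (\<forall>j. Suc j < length ps \<longrightarrow> fst (ps ! j) \<noteq> fst (ps ! Suc j))
      \<longrightarrow> \<phi> (prod_list (map snd ps)) = 0)"

definition semicircle_density :: "real \<Rightarrow> real \<Rightarrow> real \<Rightarrow> real" where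
  "semicircle_density m v t =
     (if \<bar>t - m\<bar> \<le> 2 * sqrt v then sqrt (4 * v - (t - m)\<^sup>2) / (2 * pi * v) else 0)"

definition semicircle_law :: "real \<Rightarrow> real \<Rightarrow> real measure" where
  "semicircle_law m v = density lborel (\<lambda>t. ennreal (semicircle_density m v t))"

definition semicircular ::
  "(complex \<Rightarrow> 'a::ring_1 \<Rightarrow> 'a) \<Rightarrow> ('a \<Rightarrow> 'a) \<Rightarrow> ('a \<Rightarrow> complex) \<Rightarrow> real \<Rightarrow> real \<Rightarrow> 'a \<Rightarrow> bool" where
  "semicircular sm st \<phi> m v x \<longleftrightarrow>
     st x = x \<and> (\<forall>p::nat. \<phi> (x ^ p) = complex_of_real (\<integral>t. t ^ p \<partial>semicircle_law m v))"

definition circular ::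
  "(complex \<Rightarrow> 'a::ring_1 \<Rightarrow> 'a) \<Rightarrow> ('a \<Rightarrow> 'a) \<Rightarrow> ('a \<Rightarrow> complex) \<Rightarrow> 'a \<Rightarrow> bool" where
  "circular sm st \<phi> c \<longleftrightarrow>
     (\<exists>s1 s2. semicircular sm st \<phi> 0 1 s1 \<and> semicircular sm st \<phi> 0 1 s2
        \<and> star_free sm st \<phi> {0::nat, 1} (\<lambda>i. if i = 0 then s1 else s2)
        \<and> c = sm (complex_of_real (1 / sqrt 2)) (s1 + sm \<i> s2))"

end

theory Submission
  imports Defs
begin

text \<open>
  Classical case. Differentiating the expectation of \<open>(u^k)\<^sub>a\<^sub>b G\<close>, with \<open>G\<close> a product of traces
  \<open>T\<^sub>l = Tr (u^l)\<close>, along the rotations of the \<open>(a,b)\<close>-plane and summing over \<open>a, b\<close> gives the loop equation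
  that \<open>(\<Sum>j<k. T\<^sub>j T\<^sub>k\<^sub>-\<^sub>j - T\<^bsub>|2j-k|\<^esub>) G + \<Sum>\<^sub>l l (T\<^sub>k\<^sub>+\<^sub>l - T\<^bsub>|k-l|\<^esub>) G\<^sub>l\<close> has expectation \<open>0\<close>, where \<open>T\<^sub>0 = n\<close>,
  \<open>l\<close> runs over the factors of \<open>G\<close>, and \<open>G\<^sub>l\<close> is \<open>G\<close> without that factor. After division by \<open>n\<close>,
  the moments of a given total degree are a small perturbation of moments of lower degree, and the limit
  satisfies the Gaussian integration by parts formula.

  Free case. The matrix \<open>h (u\<^sub>i\<^sub>1\<^sub>j\<^sub>1 \<dots> u\<^sub>i\<^sub>K\<^sub>j\<^sub>K)\<close> is the orthogonal projection onto the span of the noncrossing pairings: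
  these projections define an invariant functional on the free algebra that kills the ideal of relations, and
  there is only one such functional. Hence a moment of traces is the trace of this projection times a permutation
  of the tensor legs. As different pairings are asymptotically orthogonal, its limit is the number of
  noncrossing pairings invariant under the block rotation. Such a pairing matches whole blocks, which yields
  the recursion \<open>nc_mom\<close>. Freeness propagates the Schwinger--Dyson equation of the single variables to the whole
  family, and this equation is the same recursion for the limiting moments.
\<close>

text \<open>In the loop equation a trace \<open>T_0 = n\<close> makes up for the division by
  \<open>n\<close>: |2j - k| = 0 only for j = k/2, which gives the mean 1 for even k, and |k - l| =
  0 only for l = k, whose weight l is the variance. In the free case an invariant pairing maps a
  block to another one by reversing it, and a reversal intertwines rotations of opposite directions.
  The two directions agree for lengths at most 2 only, whence semicircular limits for k = 1, 2 and
  circular ones for k >= 3; a block can be matched within itself only for k = 2, whence the mean 1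
  there. The obstacle is that neither a bound on the moments nor the invertibility of the Gram
  matrix of the pairings is known beforehand (for n = 1 and four points it is singular). Both
  unknowns solve a system up to an error of order 1/n times their own size, which alone forces
  convergence (\<open>perturbation_limit\<close>). Freeness speaks of centred elements only, so the
  Schwinger--Dyson defect is extended to partly centred products; undoing the centring costs only
  shorter words.\<close>

text \<open>The error is measured by the unknown \<open>x\<close> itself. Summed over
  \<open>I\<close>, the hypothesis bounds the total size of \<open>x\<close> by that of
  \<open>y\<close> plus \<open>card I * \<epsilon> n\<close> times itself; once this factor is below
  1/2 the size is absorbed, and then the error tends to 0. It serves for the trace moments of a
  fixed degree and for the Weingarten matrix.\<close>

lemma perturbation_limit:
  fixes x y :: "nat \<Rightarrow> 'i \<Rightarrow> real"
  assumes fin: "finite I"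
    and near: "\<forall>\<^sub>F n in sequentially. \<forall>i\<in>I. \<bar>x n i - y n i\<bar> \<le> \<epsilon> n * (\<Sum>j\<in>I. \<bar>x n j\<bar>)"
    and eps: "\<epsilon> \<longlonglongrightarrow> 0"
    and lim: "\<And>i. i \<in> I \<Longrightarrow> (\<lambda>n. y n i) \<longlonglongrightarrow> l i"
    and i: "i \<in> I"
  shows "(\<lambda>n. x n i) \<longlonglongrightarrow> l i"
proof -
  define S where "S n = (\<Sum>j\<in>I. \<bar>x n j\<bar>)" for n
  define Y where "Y n = (\<Sum>j\<in>I. \<bar>y n j\<bar>)" for n
  have Y: "Y \<longlonglongrightarrow> (\<Sum>j\<in>I. \<bar>l j\<bar>)"
    unfolding Y_def by (intro tendsto_sum tendsto_rabs lim)
  have S0: "S n \<ge> 0" for n by (simp add: S_def sum_nonneg)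
  have "(\<lambda>n. real (card I) * \<epsilon> n) \<longlonglongrightarrow> real (card I) * 0"
    by (intro tendsto_intros eps)
  then have half: "\<forall>\<^sub>F n in sequentially. real (card I) * \<epsilon> n < 1/2"
    by (intro order_tendstoD(2)[of _ 0]) auto
  have bd: "\<forall>\<^sub>F n in sequentially. S n \<le> 2 * Y n"
    using near half
  proof eventually_elim
    case (elim n)
    have "S n \<le> (\<Sum>j\<in>I. \<bar>y n j\<bar> + \<epsilon> n * S n)"
      unfolding S_def
    proof (rule sum_mono)
      fix j assume "j \<in> I"
      then show "\<bar>x n j\<bar> \<le> \<bar>y n j\<bar> + \<epsilon> n * (\<Sum>j\<in>I. \<bar>x n j\<bar>)"
        using elim(1) by force
    qed
    also have "\<dots> = Y n + (real (card I) * \<epsilon> n) * S n"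
      by (simp add: sum.distrib Y_def)
    also have "\<dots> \<le> Y n + 1/2 * S n"
      using elim(2) S0[of n] by (intro add_left_mono mult_right_mono) auto
    finally show ?case by simp
  qed
  have "(\<lambda>n. x n i - y n i) \<longlonglongrightarrow> 0"
  proof (rule Lim_null_comparison)
    show "\<forall>\<^sub>F n in sequentially. norm (x n i - y n i) \<le> \<bar>\<epsilon> n\<bar> * (2 * Y n)"
      using near bd
    proof eventually_elim
      case (elim n)
      have "\<bar>x n i - y n i\<bar> \<le> \<epsilon> n * S n" using elim(1) i by (simp add: S_def)
      also have "\<dots> \<le> \<bar>\<epsilon> n\<bar> * S n" using S0[of n] by (intro mult_right_mono) auto
      also have "\<dots> \<le> \<bar>\<epsilon> n\<bar> * (2 * Y n)" using elim(2) by (intro mult_left_mono) auto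
      finally show ?case by simp
    qed
    have "(\<lambda>n. \<bar>\<epsilon> n\<bar> * (2 * Y n)) \<longlonglongrightarrow> \<bar>0\<bar> * (2 * (\<Sum>j\<in>I. \<bar>l j\<bar>))"
      by (intro tendsto_intros eps Y)
    then show "(\<lambda>n. \<bar>\<epsilon> n\<bar> * (2 * Y n)) \<longlonglongrightarrow> 0" by simp
  qed
  from tendsto_add[OF this lim[OF i]] show ?thesis by simp
qed

section \<open>Gaussian moments\<close>

lemma normal_centered_moment_integrable:
  assumes "\<sigma> > 0"
  shows "integrable lborel (\<lambda>x. normal_density m \<sigma> x * (x - m) ^ a)"
proof (cases "even a")
  case True
  then obtain k where "a = 2 * k" by blast
  then show ?thesis using integrable.intros[OF normal_moment_even[OF assms]] by simp
next
  case False
  then obtain k where "a = 2 * k + 1" by (metis oddE)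
  then show ?thesis using integrable.intros[OF normal_moment_odd[OF assms]] by simp
qed

text \<open>Read off from the closed forms: odd central moments vanish, and consecutive even ones
  have the ratio \<open>\<sigma>\<^sup>2 * a\<close>. For \<open>a = 0\<close> the truncated
  \<open>a - 1\<close> is harmless because of the factor \<open>real a\<close>.\<close>

lemma normal_centered_moment_Suc:
  assumes s: "\<sigma> > 0"
  shows "(\<integral>x. normal_density m \<sigma> x * (x - m) ^ Suc a \<partial>lborel)
       = \<sigma>\<^sup>2 * real a * (\<integral>x. normal_density m \<sigma> x * (x - m) ^ (a - 1) \<partial>lborel)"
proof (cases "even a")
  case True
  then obtain k where k: "a = 2 * k" by blast
  have "(\<integral>x. normal_density m \<sigma> x * (x - m) ^ Suc a \<partial>lborel) = 0"
    using has_bochner_integral_integral_eq[OF normal_moment_odd[OF s, of m k]] k by simp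
  moreover have "real a * (\<integral>x. normal_density m \<sigma> x * (x - m) ^ (a - 1) \<partial>lborel) = 0"
  proof (cases k)
    case (Suc k')
    then have "a - 1 = 2 * k' + 1" using k by simp
    then show ?thesis
      using has_bochner_integral_integral_eq[OF normal_moment_odd[OF s, of m k']] by simp
  qed (simp add: k)
  ultimately show ?thesis by simp
next
  case False
  then obtain k where k: "a = 2 * k + 1" by (metis oddE)
  have "(\<integral>x. normal_density m \<sigma> x * (x - m) ^ Suc a \<partial>lborel) =
      fact (2 * Suc k) / ((2 / \<sigma>\<^sup>2)^Suc k * fact (Suc k))"
    using has_bochner_integral_integral_eq[OF normal_moment_even[OF s, of m "Suc k"]] k by simp
  moreover have "(\<integral>x. normal_density m \<sigma> x * (x - m) ^ (a - 1) \<partial>lborel) =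
      fact (2 * k) / ((2 / \<sigma>\<^sup>2)^k * fact k)"
    using has_bochner_integral_integral_eq[OF normal_moment_even[OF s, of m k]] k by simp
  moreover have "fact (2 * Suc k) / ((2 / \<sigma>\<^sup>2)^Suc k * fact (Suc k))
      = \<sigma>\<^sup>2 * real a * (fact (2 * k) / ((2 / \<sigma>\<^sup>2)^k * fact k))"
    using s k by (simp add: field_simps del: of_nat_Suc) (simp add: algebra_simps)
  ultimately show ?thesis by simp
qed

lemma normal_mixed_moment_integrable:
  assumes s: "\<sigma> > 0"
  shows "integrable lborel (\<lambda>x. normal_density m \<sigma> x * ((x - m) ^ a * x ^ b))"
proof (induction b arbitrary: a)
  case 0
  then show ?case using normal_centered_moment_integrable[OF s] by simp
next
  case (Suc b)
  have "(\<lambda>x. normal_density m \<sigma> x * ((x - m) ^ a * x ^ Suc b)) =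
     (\<lambda>x. normal_density m \<sigma> x * ((x - m) ^ Suc a * x ^ b) + m * (normal_density m \<sigma> x * ((x - m) ^ a * x ^ b)))"
    by (auto simp: algebra_simps)
  then show ?case using Suc[of "Suc a"] Suc[of a] by simp
qed

text \<open>Gaussian integration by parts; the mixed form is what makes the induction on \<open>b\<close> close.\<close>

lemma normal_mixed_moment_Suc:
  fixes m :: real
  assumes s: "\<sigma> > 0"
  defines "f \<equiv> \<lambda>a b. \<integral>x. normal_density m \<sigma> x * ((x - m) ^ a * x ^ b) \<partial>lborel"
  shows "f (Suc a) b = \<sigma>\<^sup>2 * (real a * f (a - 1) b + real b * f a (b - 1))"
proof -
  have step: "f a (Suc b) = f (Suc a) b + m * f a b" for a b
  proof -
    have "(\<lambda>x. normal_density m \<sigma> x * ((x - m) ^ a * x ^ Suc b)) =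
     (\<lambda>x. normal_density m \<sigma> x * ((x - m) ^ Suc a * x ^ b) + m * (normal_density m \<sigma> x * ((x - m) ^ a * x ^ b)))"
      by (auto simp: algebra_simps)
    then show ?thesis unfolding f_def
      using normal_mixed_moment_integrable[OF s, of m "Suc a" b] normal_mixed_moment_integrable[OF s, of m a b]
      by simp
  qed
  show ?thesis
  proof (induction b arbitrary: a)
    case 0
    then show ?case using normal_centered_moment_Suc[OF s, of m a] by (simp add: f_def)
  next
    case (Suc b)
    have 1: "real a * f (a - 1) (Suc b) = real a * f a b + m * (real a * f (a - 1) b)"
      using step[of "a - 1" b] by (cases a) (auto simp: algebra_simps)
    have 2: "real b * f a b = real b * f (Suc a) (b - 1) + m * (real b * f a (b - 1))"
      using step[of a "b - 1"] by (cases b) (auto simp: algebra_simps)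
    have "f (Suc a) (Suc b) = f (Suc (Suc a)) b + m * f (Suc a) b" by (rule step)
    also have "\<dots> = \<sigma>\<^sup>2 * (real (Suc a) * f a b + real b * f (Suc a) (b - 1))
        + m * (\<sigma>\<^sup>2 * (real a * f (a - 1) b + real b * f a (b - 1)))"
      using Suc[of "Suc a"] Suc[of a] by simp
    also have "\<dots> = \<sigma>\<^sup>2 * (f a b + (real a * f a b + m * (real a * f (a - 1) b))
                      + (real b * f (Suc a) (b - 1) + m * (real b * f a (b - 1))))"
      by (simp add: algebra_simps)
    also have "\<dots> = \<sigma>\<^sup>2 * (f a b + real a * f (a - 1) (Suc b) + real b * f a b)"
      using 1 2 by simp
    finally show ?case by (simp add: algebra_simps)
  qed
qed

text \<open>Writing one factor \<open>X\<close> as \<open>(X - m) + m\<close> separates the mean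
  term from the term that integration by parts lowers.\<close>

lemma (in prob_space) normal_moments:
  assumes D: "distributed M lborel X (normal_density m \<sigma>)" and s: "\<sigma> > 0"
  shows "integrable M (\<lambda>\<omega>. X \<omega> ^ b)"
    and "expectation (\<lambda>\<omega>. X \<omega> ^ Suc b) =
      m * expectation (\<lambda>\<omega>. X \<omega> ^ b) + \<sigma>\<^sup>2 * real b * expectation (\<lambda>\<omega>. X \<omega> ^ (b - 1))"
proof -
  have E: "expectation (\<lambda>\<omega>. X \<omega> ^ b) = (\<integral>x. normal_density m \<sigma> x * ((x - m) ^ 0 * x ^ b) \<partial>lborel)" for b
    using distributed_integral[OF D, of "\<lambda>x. x ^ b"] by simp
  show "integrable M (\<lambda>\<omega>. X \<omega> ^ b)"
    using distributed_integrable[OF D, of "\<lambda>x. x ^ b"] normal_mixed_moment_integrable[OF s, of m 0 b]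
    by simp
  have "expectation (\<lambda>\<omega>. X \<omega> ^ Suc b) =
     (\<integral>x. normal_density m \<sigma> x * ((x - m) ^ Suc 0 * x ^ b) + m * (normal_density m \<sigma> x * ((x - m) ^ 0 * x ^ b)) \<partial>lborel)"
    unfolding E by (intro Bochner_Integration.integral_cong) (auto simp: algebra_simps)
  also have "\<dots> = (\<integral>x. normal_density m \<sigma> x * ((x - m) ^ Suc 0 * x ^ b) \<partial>lborel) + m * expectation (\<lambda>\<omega>. X \<omega> ^ b)"
    unfolding E
    using normal_mixed_moment_integrable[OF s, of m "Suc 0" b] normal_mixed_moment_integrable[OF s, of m 0 b]
    by (subst Bochner_Integration.integral_add) auto
  finally show "expectation (\<lambda>\<omega>. X \<omega> ^ Suc b) =
      m * expectation (\<lambda>\<omega>. X \<omega> ^ b) + \<sigma>\<^sup>2 * real b * expectation (\<lambda>\<omega>. X \<omega> ^ (b - 1))"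
    using normal_mixed_moment_Suc[OF s, of m 0 b] unfolding E by simp
qed

section \<open>Mixed moments of independent Gaussian variables\<close>

lemma prod_list_eq_prod_count:
  fixes f :: "'a \<Rightarrow> 'b::comm_monoid_mult"
  assumes "finite S" "set ks \<subseteq> S"
  shows "(\<Prod>k\<leftarrow>ks. f k) = (\<Prod>j\<in>S. f j ^ count_list ks j)"
  using assms(2)
proof (induction ks)
  case (Cons k ks)
  have "(\<Prod>j\<in>S. f j ^ count_list (k # ks) j) = (\<Prod>j\<in>S. (if j = k then f j else 1) * f j ^ count_list ks j)"
    by (intro prod.cong) auto
  also have "\<dots> = (\<Prod>j\<in>S. if j = k then f j else 1) * (\<Prod>j\<in>S. f j ^ count_list ks j)"
    by (rule prod.distrib)
  also have "(\<Prod>j\<in>S. if j = k then f j else 1) = f k"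
    using Cons.prems assms(1) by simp
  finally show ?case using Cons by simp
qed simp

definition delete_nth :: "nat \<Rightarrow> 'a list \<Rightarrow> 'a list" where
  "delete_nth i xs = take i xs @ drop (Suc i) xs"

lemma delete_nth_simps [simp]:
  "delete_nth 0 (x # xs) = xs" "delete_nth (Suc i) (x # xs) = x # delete_nth i xs"
  by (auto simp: delete_nth_def)

lemma count_list_delete_nth:
  "i < length ks \<Longrightarrow> count_list (delete_nth i ks) j = count_list ks j - (if ks ! i = j then 1 else 0)"
proof (induction ks arbitrary: i)
  case (Cons k ks)
  show ?case
  proof (cases i)
    case (Suc i')
    have "count_list ks j > 0" if "ks ! i' = j"
      using that Suc Cons.prems by (metis Suc_less_eq count_list_0_iff gr0I length_Cons nth_mem)
    then show ?thesis using Suc Cons by auto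
  qed auto
qed simp

lemma set_delete_nth: "set (delete_nth i ks) \<subseteq> set ks"
  by (auto simp: delete_nth_def dest: in_set_takeD in_set_dropD)

lemma sum_list_delete_nth:
  "i < length ks \<Longrightarrow> sum_list (delete_nth i ks) + ks ! i = sum_list (ks :: nat list)"
proof (induction ks arbitrary: i)
  case (Cons k ks) then show ?case by (cases i) auto
qed simp

lemma count_list_eq_sum: "count_list ks j = (\<Sum>i<length ks. if ks ! i = j then 1 else 0)"
proof (induction ks)
  case (Cons k ks)
  then show ?case by (subst length_Cons, subst sum.lessThan_Suc_shift) auto
qed simp

context prob_space
begin

context
  fixes X :: "nat \<Rightarrow> 'a \<Rightarrow> real"
  assumes ind: "indep_vars (\<lambda>_. borel) X {1..}"
    and nd: "\<And>k. k \<ge> 1 \<Longrightarrow> distributed M lborel (X k)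
                 (normal_density (if even k then 1 else 0) (sqrt (real k)))"
begin

lemma expectation_prod_powers:
  assumes "finite S" "S \<subseteq> {1..}"
  shows "expectation (\<lambda>\<omega>. \<Prod>j\<in>S. X j \<omega> ^ c j) = (\<Prod>j\<in>S. expectation (\<lambda>\<omega>. X j \<omega> ^ c j))"
proof (rule indep_vars_lebesgue_integral[OF assms(1)])
  have "indep_vars (\<lambda>_. borel) X S" by (rule indep_vars_subset[OF ind assms(2)])
  then show "indep_vars (\<lambda>_. borel) (\<lambda>i \<omega>. X i \<omega> ^ c i) S"
    by (rule indep_vars_compose2) simp
  fix i assume "i \<in> S"
  with assms have "i \<ge> 1" by auto
  then show "integrable M (\<lambda>\<omega>. X i \<omega> ^ c i)" using normal_moments(1)[OF nd] by simp
qed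

text \<open>By independence only the multiplicity \<open>c\<close> of \<open>k\<close> in
  \<open>ks\<close> matters; the other variables form a common factor \<open>R\<close>. The
  recursion for one variable has the coefficient \<open>c\<close>, which counts the positions
  \<open>i\<close> with \<open>ks ! i = k\<close>. Spread over these positions, it can be compared
  with the loop equation term by term.\<close>

lemma gaussian_moment_recursion:
  assumes k: "k \<ge> 1" and ks: "\<forall>k\<in>set ks. k \<ge> 1"
  shows "expectation (\<lambda>\<omega>. \<Prod>k\<leftarrow>k # ks. X k \<omega>) =
      (if even k then 1 else 0) * expectation (\<lambda>\<omega>. \<Prod>k\<leftarrow>ks. X k \<omega>)
      + (\<Sum>i<length ks. if ks ! i = k then real k * expectation (\<lambda>\<omega>. \<Prod>k\<leftarrow>delete_nth i ks. X k \<omega>) else 0)"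
proof -
  define S where "S = insert k (set ks)"
  define R where "R = (\<Prod>j\<in>S - {k}. expectation (\<lambda>\<omega>. X j \<omega> ^ count_list ks j))"
  define c where "c = count_list ks k"
  have S: "finite S" "S \<subseteq> {1..}" "k \<in> S" using k ks by (auto simp: S_def)
  have L: "expectation (\<lambda>\<omega>. \<Prod>k\<leftarrow>l. X k \<omega>) = expectation (\<lambda>\<omega>. X k \<omega> ^ count_list l k) * R"
    if "set l \<subseteq> S" "\<And>j. j \<noteq> k \<Longrightarrow> count_list l j = count_list ks j" for l
  proof -
    have "expectation (\<lambda>\<omega>. \<Prod>k\<leftarrow>l. X k \<omega>) = (\<Prod>j\<in>S. expectation (\<lambda>\<omega>. X j \<omega> ^ count_list l j))"
      by (simp only: prod_list_eq_prod_count[OF S(1) that(1)] expectation_prod_powers[OF S(1,2)])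
    also have "\<dots> = expectation (\<lambda>\<omega>. X k \<omega> ^ count_list l k) * (\<Prod>j\<in>S-{k}. expectation (\<lambda>\<omega>. X j \<omega> ^ count_list l j))"
      using S by (simp add: prod.remove)
    also have "(\<Prod>j\<in>S-{k}. expectation (\<lambda>\<omega>. X j \<omega> ^ count_list l j)) = R"
      unfolding R_def using that(2) by (intro prod.cong) auto
    finally show ?thesis .
  qed
  have 1: "expectation (\<lambda>\<omega>. \<Prod>k\<leftarrow>k # ks. X k \<omega>) = expectation (\<lambda>\<omega>. X k \<omega> ^ Suc c) * R"
    by (subst L) (auto simp: S_def c_def)
  have 2: "expectation (\<lambda>\<omega>. \<Prod>k\<leftarrow>ks. X k \<omega>) = expectation (\<lambda>\<omega>. X k \<omega> ^ c) * R"
    by (subst L) (auto simp: S_def c_def)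
  have 3: "expectation (\<lambda>\<omega>. \<Prod>k\<leftarrow>delete_nth i ks. X k \<omega>) = expectation (\<lambda>\<omega>. X k \<omega> ^ (c - 1)) * R"
    if "i < length ks" "ks ! i = k" for i
    using set_delete_nth[of i ks] that
    by (subst L) (auto simp: S_def c_def count_list_delete_nth)
  have "(\<Sum>i<length ks. if ks ! i = k then real k * expectation (\<lambda>\<omega>. \<Prod>k\<leftarrow>delete_nth i ks. X k \<omega>) else 0)
      = (\<Sum>i<length ks. real k * (expectation (\<lambda>\<omega>. X k \<omega> ^ (c - 1)) * R) * real (if ks ! i = k then 1 else 0))"
    by (intro sum.cong refl) (auto simp: 3)
  also have "\<dots> = real k * (expectation (\<lambda>\<omega>. X k \<omega> ^ (c - 1)) * R) * real c"
    unfolding c_def count_list_eq_sum[of ks k] of_nat_sum by (rule sum_distrib_left[symmetric])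
  finally have 4: "(\<Sum>i<length ks. if ks ! i = k then real k * expectation (\<lambda>\<omega>. \<Prod>k\<leftarrow>delete_nth i ks. X k \<omega>) else 0)
      = real k * (expectation (\<lambda>\<omega>. X k \<omega> ^ (c - 1)) * R) * real c" .
  have "sqrt (real k) > 0" using k by simp
  from normal_moments(2)[OF nd[OF k] this, of c]
  show ?thesis unfolding 1 2 4 by (simp add: algebra_simps)
qed

end

end

section \<open>Loop equations for the orthogonal group\<close>

text \<open>At \<open>\<theta> = 0\<close> the derivative is the difference
  \<open>E_ab - E_ba\<close> of matrix units; these matrices span the Lie algebra of the orthogonal
  group.\<close>

definition plane_rot :: "nat \<Rightarrow> nat \<Rightarrow> nat \<Rightarrow> real \<Rightarrow> rmat" where
  "plane_rot n a b \<theta> = (\<lambda>(i,j). if i < n \<and> j < n then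
     (if i = j then (if i = a \<or> i = b then cos \<theta> else 1)
      else if i = a \<and> j = b then sin \<theta> else if i = b \<and> j = a then - sin \<theta> else 0) else 0)"

lemma plane_rot_mult:
  assumes "a < n" "b < n" "a \<noteq> b" "i < n" "j < n"
  shows "mat_mult n (plane_rot n a b \<theta>) v (i,j) =
    (if i = a then cos \<theta> * v (a,j) + sin \<theta> * v (b,j)
     else if i = b then cos \<theta> * v (b,j) - sin \<theta> * v (a,j) else v (i,j))"
proof -
  have "mat_mult n (plane_rot n a b \<theta>) v (i,j) = (\<Sum>k<n. plane_rot n a b \<theta> (i,k) * v (k,j))"
    using assms by (simp add: mat_mult_def)
  also have "\<dots> = (\<Sum>k<n. (if k = i then (if i = a \<or> i = b then cos \<theta> else 1) * v (k,j) else 0)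
     + (if k = b then (if i = a then sin \<theta> else 0) * v (k,j) else 0)
     - (if k = a then (if i = b then sin \<theta> else 0) * v (k,j) else 0))"
    using assms by (intro sum.cong) (auto simp: plane_rot_def)
  also have "\<dots> = (if i = a \<or> i = b then cos \<theta> else 1) * v (i,j)
     + (if i = a then sin \<theta> else 0) * v (b,j) - (if i = b then sin \<theta> else 0) * v (a,j)"
    using assms by (simp add: sum.distrib sum_subtractf)
  finally show ?thesis using assms by auto
qed

lemma plane_rot_mult_transpose:
  assumes "a < n" "b < n" "a \<noteq> b"
  shows "mat_mult n (plane_rot n a b \<theta>) (mat_transpose (plane_rot n a b \<theta>)) = mat_id n"
proof (rule ext, clarify)
  fix i j
  have sq: "cos \<theta> * cos \<theta> + sin \<theta> * sin \<theta> = 1" "sin \<theta> * sin \<theta> + cos \<theta> * cos \<theta> = 1"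
    using sin_cos_squared_add3[of \<theta>] by (simp_all add: add.commute)
  show "mat_mult n (plane_rot n a b \<theta>) (mat_transpose (plane_rot n a b \<theta>)) (i,j) = mat_id n (i,j)"
  proof (cases "i < n \<and> j < n")
    case True
    have ra: "plane_rot n a b \<theta> (j,a) = (if j = a then cos \<theta> else if j = b then - sin \<theta> else 0)"
      and rb: "plane_rot n a b \<theta> (j,b) = (if j = b then cos \<theta> else if j = a then sin \<theta> else 0)"
      and ri: "i \<noteq> a \<Longrightarrow> i \<noteq> b \<Longrightarrow> plane_rot n a b \<theta> (j,i) = (if j = i then 1 else 0)"
      using True assms unfolding plane_rot_def by simp_all
    have "mat_mult n (plane_rot n a b \<theta>) (mat_transpose (plane_rot n a b \<theta>)) (i,j) =
      (if i = a then cos \<theta> * plane_rot n a b \<theta> (j,a) + sin \<theta> * plane_rot n a b \<theta> (j,b)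
       else if i = b then cos \<theta> * plane_rot n a b \<theta> (j,b) - sin \<theta> * plane_rot n a b \<theta> (j,a)
       else plane_rot n a b \<theta> (j,i))"
      using True by (subst plane_rot_mult[OF assms]) (auto simp: mat_transpose_def)
    also have "\<dots> = (if i = j then 1 else 0)"
    proof (cases "i = a \<or> i = b")
      case True
      then show ?thesis using assms sq unfolding ra rb by auto
    next
      case False
      then show ?thesis using ri by auto
    qed
    finally show ?thesis using True by (simp add: mat_id_def)
  next
    case False
    then show ?thesis by (auto simp: mat_mult_def mat_id_def)
  qed
qed

lemma plane_rot_transpose:
  assumes "a \<noteq> b"
  shows "mat_transpose (plane_rot n a b \<theta>) = plane_rot n a b (-\<theta>)"
proof (rule ext, clarify)
  fix i j
  show "mat_transpose (plane_rot n a b \<theta>) (i,j) = plane_rot n a b (-\<theta>) (i,j)"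
    using assms unfolding mat_transpose_def plane_rot_def by (cases "i = j") simp_all
qed

lemma plane_rot_orth:
  assumes "a < n" "b < n" "a \<noteq> b"
  shows "plane_rot n a b \<theta> \<in> orth_group n"
proof -
  have 1: "mat_mult n (mat_transpose (plane_rot n a b \<theta>)) (plane_rot n a b \<theta>) = mat_id n"
    using plane_rot_mult_transpose[OF assms, of "-\<theta>"]
    unfolding plane_rot_transpose[OF assms(3)] minus_minus .
  have 2: "\<forall>i j. \<not> (i < n \<and> j < n) \<longrightarrow> plane_rot n a b \<theta> (i,j) = 0"
    unfolding plane_rot_def prod.case by (intro allI impI if_not_P)
  show ?thesis unfolding orth_group_def mem_Collect_eq
    by (intro conjI 1 2 plane_rot_mult_transpose assms)
qed

lemma mat_mult_assoc:
  "mat_mult n (mat_mult n A B) C = mat_mult n A (mat_mult n B C)"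
proof (rule ext, clarify)
  fix i j
  have "(\<Sum>k<n. (\<Sum>l<n. A (i,l) * B (l,k)) * C (k,j)) = (\<Sum>k<n. \<Sum>l<n. A (i,l) * (B (l,k) * C (k,j)))"
    by (simp add: sum_distrib_right mult.assoc)
  also have "\<dots> = (\<Sum>l<n. A (i,l) * (\<Sum>k<n. B (l,k) * C (k,j)))"
    by (subst sum.swap) (simp add: sum_distrib_left)
  finally show "mat_mult n (mat_mult n A B) C (i,j) = mat_mult n A (mat_mult n B C) (i,j)"
    by (simp add: mat_mult_def)
qed

lemma mat_mult_id_left: "u \<in> orth_group n \<Longrightarrow> mat_mult n (mat_id n) u = u"
  by (auto simp: mat_mult_def mat_id_def orth_group_def fun_eq_iff if_distrib[of "\<lambda>x. x * _"] cong: if_cong)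

lemma mat_mult_transpose: "mat_transpose (mat_mult n A B) = mat_mult n (mat_transpose B) (mat_transpose A)"
  by (auto simp: mat_transpose_def mat_mult_def fun_eq_iff mult.commute)

lemma orth_group_transpose: "u \<in> orth_group n \<Longrightarrow> mat_transpose u \<in> orth_group n"
proof -
  assume "u \<in> orth_group n"
  moreover have "mat_transpose (mat_transpose u) = u" by (auto simp: mat_transpose_def)
  ultimately show ?thesis
    by (simp add: orth_group_def) (auto simp: mat_transpose_def)
qed

lemma orth_group_mult:
  assumes "u \<in> orth_group n" "v \<in> orth_group n"
  shows "mat_mult n u v \<in> orth_group n"
proof -
  have u: "mat_mult n u (mat_transpose u) = mat_id n" "mat_mult n (mat_transpose u) u = mat_id n"
    and v: "mat_mult n v (mat_transpose v) = mat_id n" "mat_mult n (mat_transpose v) v = mat_id n"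
    using assms by (auto simp: orth_group_def)
  have "mat_mult n (mat_mult n u v) (mat_mult n (mat_transpose v) (mat_transpose u)) =
      mat_mult n u (mat_mult n (mat_mult n v (mat_transpose v)) (mat_transpose u))"
    by (simp only: mat_mult_assoc)
  then have 1: "mat_mult n (mat_mult n u v) (mat_transpose (mat_mult n u v)) = mat_id n"
    by (simp add: mat_mult_transpose u v mat_mult_id_left[OF orth_group_transpose[OF assms(1)]])
  have "mat_mult n (mat_mult n (mat_transpose v) (mat_transpose u)) (mat_mult n u v) =
      mat_mult n (mat_transpose v) (mat_mult n (mat_mult n (mat_transpose u) u) v)"
    by (simp only: mat_mult_assoc)
  then have 2: "mat_mult n (mat_transpose (mat_mult n u v)) (mat_mult n u v) = mat_id n"
    by (simp add: mat_mult_transpose u v mat_mult_id_left[OF assms(2)])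
  show ?thesis using 1 2 by (auto simp: orth_group_def mat_mult_def)
qed

lemma orth_group_column:
  assumes "u \<in> orth_group n" "i < n" "j < n"
  shows "(\<Sum>k<n. u (k,i) * u (k,j)) = (if i = j then 1 else 0)"
proof -
  have "mat_mult n (mat_transpose u) u (i,j) = mat_id n (i,j)"
    using assms by (auto simp: orth_group_def)
  then show ?thesis using assms by (auto simp: mat_mult_def mat_transpose_def mat_id_def)
qed

lemma orth_group_entry_bound:
  assumes "u \<in> orth_group n"
  shows "\<bar>u (i,j)\<bar> \<le> 1"
proof (cases "i < n \<and> j < n")
  case True
  have "u (i,j) * u (i,j) \<le> (\<Sum>k<n. u (k,j) * u (k,j))"
    using True by (intro member_le_sum) auto
  also have "\<dots> = 1" using orth_group_column[OF assms, of j j] True by simp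
  finally show ?thesis by (simp add: abs_le_square_iff[of _ 1, simplified] power2_eq_square)
next
  case False
  then show ?thesis using assms by (auto simp: orth_group_def)
qed

section \<open>Differentiation along plane rotations\<close>

abbreviation "orth_measurable n \<equiv> borel_measurable (restrict_space borel (orth_group n))"

text \<open>The quadratic error bound is uniform on the group, so that the expansion can be integrated.\<close>

definition rot_deriv :: "nat \<Rightarrow> nat \<Rightarrow> nat \<Rightarrow> (rmat \<Rightarrow> real) \<Rightarrow> (rmat \<Rightarrow> real) \<Rightarrow> bool" where
  "rot_deriv n a b F F' \<longleftrightarrow>
     F \<in> orth_measurable n
   \<and> F' \<in> orth_measurable n
   \<and> (\<exists>C. \<forall>u\<in>orth_group n. \<bar>F u\<bar> \<le> C \<and> \<bar>F' u\<bar> \<le> C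
        \<and> (\<forall>\<theta>. \<bar>\<theta>\<bar> \<le> 1 \<longrightarrow> \<bar>F (mat_mult n (plane_rot n a b \<theta>) u) - F u - \<theta> * F' u\<bar> \<le> C * \<theta>\<^sup>2))"

lemma rot_derivI:
  assumes "F \<in> orth_measurable n"
    and "F' \<in> orth_measurable n"
    and "\<And>u. u \<in> orth_group n \<Longrightarrow> \<bar>F u\<bar> \<le> C" "\<And>u. u \<in> orth_group n \<Longrightarrow> \<bar>F' u\<bar> \<le> C"
    and "\<And>u \<theta>. u \<in> orth_group n \<Longrightarrow> \<bar>\<theta>\<bar> \<le> 1 \<Longrightarrow>
      \<bar>F (mat_mult n (plane_rot n a b \<theta>) u) - F u - \<theta> * F' u\<bar> \<le> C * \<theta>\<^sup>2"
  shows "rot_deriv n a b F F'"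
  unfolding rot_deriv_def using assms by (intro conjI exI[of _ C] ballI allI impI)

lemma rot_derivE:
  assumes "rot_deriv n a b F F'"
  obtains C where "C \<ge> 0" "F \<in> orth_measurable n"
    "F' \<in> orth_measurable n"
    "\<And>u. u \<in> orth_group n \<Longrightarrow> \<bar>F u\<bar> \<le> C" "\<And>u. u \<in> orth_group n \<Longrightarrow> \<bar>F' u\<bar> \<le> C"
    "\<And>u \<theta>. u \<in> orth_group n \<Longrightarrow> \<bar>\<theta>\<bar> \<le> 1 \<Longrightarrow>
      \<bar>F (mat_mult n (plane_rot n a b \<theta>) u) - F u - \<theta> * F' u\<bar> \<le> C * \<theta>\<^sup>2"
proof -
  obtain C where C: "\<forall>u\<in>orth_group n. \<bar>F u\<bar> \<le> C \<and> \<bar>F' u\<bar> \<le> C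
        \<and> (\<forall>\<theta>. \<bar>\<theta>\<bar> \<le> 1 \<longrightarrow> \<bar>F (mat_mult n (plane_rot n a b \<theta>) u) - F u - \<theta> * F' u\<bar> \<le> C * \<theta>\<^sup>2)"
    using assms unfolding rot_deriv_def by blast
  show ?thesis
  proof (rule that[of "max C 0"])
    fix u and \<theta> :: real assume u: "u \<in> orth_group n" and t: "\<bar>\<theta>\<bar> \<le> 1"
    have "\<bar>F (mat_mult n (plane_rot n a b \<theta>) u) - F u - \<theta> * F' u\<bar> \<le> C * \<theta>\<^sup>2" using C u t by blast
    also have "\<dots> \<le> max C 0 * \<theta>\<^sup>2" by (intro mult_right_mono) auto
    finally show "\<bar>F (mat_mult n (plane_rot n a b \<theta>) u) - F u - \<theta> * F' u\<bar> \<le> max C 0 * \<theta>\<^sup>2" .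
  next
    fix u assume "u \<in> orth_group n"
    then show "\<bar>F u\<bar> \<le> max C 0" "\<bar>F' u\<bar> \<le> max C 0"
      using C by (auto intro: max.coboundedI1)
  qed (use assms in \<open>auto simp: rot_deriv_def\<close>)
qed

lemma rot_deriv_const: "rot_deriv n a b (\<lambda>_. c) (\<lambda>_. 0)"
  by (rule rot_derivI[where C = "\<bar>c\<bar>"]) auto

lemma rot_deriv_add:
  assumes "rot_deriv n a b F F'" "rot_deriv n a b G G'"
  shows "rot_deriv n a b (\<lambda>u. F u + G u) (\<lambda>u. F' u + G' u)"
proof -
  from assms(1) obtain C where C: "C \<ge> 0" "F \<in> orth_measurable n"
    "F' \<in> orth_measurable n"
    "\<And>u. u \<in> orth_group n \<Longrightarrow> \<bar>F u\<bar> \<le> C" "\<And>u. u \<in> orth_group n \<Longrightarrow> \<bar>F' u\<bar> \<le> C"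
    "\<And>u \<theta>. u \<in> orth_group n \<Longrightarrow> \<bar>\<theta>\<bar> \<le> 1 \<Longrightarrow>
      \<bar>F (mat_mult n (plane_rot n a b \<theta>) u) - F u - \<theta> * F' u\<bar> \<le> C * \<theta>\<^sup>2"
    by (elim rot_derivE) (rule that; blast)
  from assms(2) obtain D where D: "D \<ge> 0" "G \<in> orth_measurable n"
    "G' \<in> orth_measurable n"
    "\<And>u. u \<in> orth_group n \<Longrightarrow> \<bar>G u\<bar> \<le> D" "\<And>u. u \<in> orth_group n \<Longrightarrow> \<bar>G' u\<bar> \<le> D"
    "\<And>u \<theta>. u \<in> orth_group n \<Longrightarrow> \<bar>\<theta>\<bar> \<le> 1 \<Longrightarrow>
      \<bar>G (mat_mult n (plane_rot n a b \<theta>) u) - G u - \<theta> * G' u\<bar> \<le> D * \<theta>\<^sup>2"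
    by (elim rot_derivE) (rule that; blast)
  show ?thesis
  proof (rule rot_derivI[where C = "C + D"])
    fix u and \<theta> :: real assume u: "u \<in> orth_group n"
    show "\<bar>F u + G u\<bar> \<le> C + D" using C(4)[OF u] D(4)[OF u] by linarith
    show "\<bar>F' u + G' u\<bar> \<le> C + D" using C(5)[OF u] D(5)[OF u] by linarith
    assume t: "\<bar>\<theta>\<bar> \<le> 1"
    show "\<bar>F (mat_mult n (plane_rot n a b \<theta>) u) + G (mat_mult n (plane_rot n a b \<theta>) u)
        - (F u + G u) - \<theta> * (F' u + G' u)\<bar> \<le> (C + D) * \<theta>\<^sup>2"
      using C(6)[OF u t] D(6)[OF u t] unfolding distrib_left distrib_right by linarith
  qed (use C(2,3) D(2,3) in measurable)
qed

text \<open>The remainder of a product telescopes into the remainder of \<open>F\<close> times the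
  rotated \<open>G\<close>, the linear part of \<open>F\<close> times the remainder of
  \<open>G\<close>, and \<open>F' u * G' u * \<theta>\<^sup>2\<close>. These cost
  \<open>C * D\<close>, \<open>2 * C * D\<close> and \<open>C * D\<close>, whence the constant 4.
  The rotated \<open>G\<close> is bounded because rotations stay in the group.\<close>

lemma rot_deriv_mult:
  assumes ab: "a < n" "b < n" "a \<noteq> b"
    and "rot_deriv n a b F F'" "rot_deriv n a b G G'"
  shows "rot_deriv n a b (\<lambda>u. F u * G u) (\<lambda>u. F' u * G u + F u * G' u)"
proof -
  from assms(4) obtain C where C: "C \<ge> 0" "F \<in> orth_measurable n"
    "F' \<in> orth_measurable n"
    "\<And>u. u \<in> orth_group n \<Longrightarrow> \<bar>F u\<bar> \<le> C" "\<And>u. u \<in> orth_group n \<Longrightarrow> \<bar>F' u\<bar> \<le> C"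
    "\<And>u \<theta>. u \<in> orth_group n \<Longrightarrow> \<bar>\<theta>\<bar> \<le> 1 \<Longrightarrow>
      \<bar>F (mat_mult n (plane_rot n a b \<theta>) u) - F u - \<theta> * F' u\<bar> \<le> C * \<theta>\<^sup>2"
    by (elim rot_derivE) (rule that; blast)
  from assms(5) obtain D where D: "D \<ge> 0" "G \<in> orth_measurable n"
    "G' \<in> orth_measurable n"
    "\<And>u. u \<in> orth_group n \<Longrightarrow> \<bar>G u\<bar> \<le> D" "\<And>u. u \<in> orth_group n \<Longrightarrow> \<bar>G' u\<bar> \<le> D"
    "\<And>u \<theta>. u \<in> orth_group n \<Longrightarrow> \<bar>\<theta>\<bar> \<le> 1 \<Longrightarrow>
      \<bar>G (mat_mult n (plane_rot n a b \<theta>) u) - G u - \<theta> * G' u\<bar> \<le> D * \<theta>\<^sup>2"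
    by (elim rot_derivE) (rule that; blast)
  have m: "\<bar>x * y\<bar> \<le> p * q" if "\<bar>x\<bar> \<le> p" "\<bar>y\<bar> \<le> q" for x y p q :: real
    using that by (simp add: abs_mult mult_mono')
  have CD: "0 \<le> C * D" using C D by simp
  show ?thesis
  proof (rule rot_derivI[where C = "4 * (C * D)"])
    fix u and \<theta> :: real assume u: "u \<in> orth_group n"
    define f where "f = F (mat_mult n (plane_rot n a b \<theta>) u)"
    define g where "g = G (mat_mult n (plane_rot n a b \<theta>) u)"
    have ru: "mat_mult n (plane_rot n a b \<theta>) u \<in> orth_group n"
      by (intro orth_group_mult plane_rot_orth ab u)
    have g: "\<bar>g\<bar> \<le> D" unfolding g_def by (rule D(4)[OF ru])
    have f: "\<bar>f\<bar> \<le> C" unfolding f_def by (rule C(4)[OF ru])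
    show "\<bar>F u * G u\<bar> \<le> 4 * (C * D)"
      using m[OF C(4)[OF u] D(4)[OF u]] CD by linarith
    show "\<bar>F' u * G u + F u * G' u\<bar> \<le> 4 * (C * D)"
      using m[OF C(5)[OF u] D(4)[OF u]] m[OF C(4)[OF u] D(5)[OF u]] CD by linarith
    assume t: "\<bar>\<theta>\<bar> \<le> 1"
    have ft: "\<bar>F u + \<theta> * F' u\<bar> \<le> 2 * C"
      using m[OF t C(5)[OF u]] C(4)[OF u] by linarith
    have "f * g - F u * G u - \<theta> * (F' u * G u + F u * G' u)
      = (f - F u - \<theta> * F' u) * g + (F u + \<theta> * F' u) * (g - G u - \<theta> * G' u) + (F' u * G' u) * \<theta>\<^sup>2"
      by (simp add: algebra_simps power2_eq_square)
    also have "\<bar>\<dots>\<bar> \<le> (C * \<theta>\<^sup>2) * D + (2 * C) * (D * \<theta>\<^sup>2) + (C * D) * \<theta>\<^sup>2"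
    proof -
      have "\<bar>(f - F u - \<theta> * F' u) * g\<bar> \<le> (C * \<theta>\<^sup>2) * D"
        using C(6)[OF u t] g by (intro m) (auto simp: f_def)
      moreover have "\<bar>(F u + \<theta> * F' u) * (g - G u - \<theta> * G' u)\<bar> \<le> (2 * C) * (D * \<theta>\<^sup>2)"
        using D(6)[OF u t] ft by (intro m) (auto simp: g_def)
      moreover have "\<bar>(F' u * G' u) * \<theta>\<^sup>2\<bar> \<le> (C * D) * \<theta>\<^sup>2"
        using C(5)[OF u] D(5)[OF u] by (intro m) auto
      ultimately show ?thesis by linarith
    qed
    also have "\<dots> = 4 * (C * D) * \<theta>\<^sup>2" by (simp add: algebra_simps)
    finally show "\<bar>F (mat_mult n (plane_rot n a b \<theta>) u) * G (mat_mult n (plane_rot n a b \<theta>) u)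
        - F u * G u - \<theta> * (F' u * G u + F u * G' u)\<bar> \<le> 4 * (C * D) * \<theta>\<^sup>2"
      by (simp add: f_def g_def)
  qed (use C(2,3) D(2,3) in measurable)
qed

text \<open>Agreement on the group suffices because the rotated argument stays in it.\<close>

lemma rot_deriv_cong:
  assumes "rot_deriv n a b F F'" "a < n" "b < n" "a \<noteq> b"
    and "\<And>u. u \<in> orth_group n \<Longrightarrow> F u = G u" "\<And>u. u \<in> orth_group n \<Longrightarrow> F' u = G' u"
  shows "rot_deriv n a b G G'"
proof -
  have "F \<in> orth_measurable n \<longleftrightarrow> G \<in> orth_measurable n"
    "F' \<in> orth_measurable n \<longleftrightarrow> G' \<in> orth_measurable n"
    using assms by (auto intro!: measurable_cong simp: space_restrict_space)
  moreover have "mat_mult n (plane_rot n a b \<theta>) u \<in> orth_group n" if "u \<in> orth_group n" for u \<theta>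
    using assms that by (intro orth_group_mult plane_rot_orth)
  ultimately show ?thesis using assms unfolding rot_deriv_def by simp
qed

lemma rot_deriv_sum:
  assumes "finite S" "\<And>i. i \<in> S \<Longrightarrow> rot_deriv n a b (F i) (F' i)"
  shows "rot_deriv n a b (\<lambda>u. \<Sum>i\<in>S. F i u) (\<lambda>u. \<Sum>i\<in>S. F' i u)"
  using assms
proof (induction S rule: finite_induct)
  case empty then show ?case using rot_deriv_const[of n a b 0] by simp
next
  case (insert x S)
  then show ?case using rot_deriv_add[of n a b "F x" "F' x"] by simp
qed

lemma entry_measurable: "(\<lambda>u::rmat. u p) \<in> borel_measurable (restrict_space borel S)"
  by (intro measurable_restrict_space1 borel_measurable_continuous_onI continuous_on_product_coordinates)

lemma abs_cos_minus_1_le: "\<bar>cos \<theta> - 1\<bar> \<le> \<theta>\<^sup>2 / 2" for \<theta> :: real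
  using cos_double_sin[of "\<theta>/2"] abs_le_square_iff[THEN iffD1, OF abs_sin_x_le_abs_x[of "\<theta>/2"]]
  by (simp add: power_divide)

lemma abs_sin_minus_le:
  fixes \<theta> :: real assumes "\<bar>\<theta>\<bar> \<le> 1"
  shows "\<bar>sin \<theta> - \<theta>\<bar> \<le> \<theta>\<^sup>2"
proof -
  have "\<bar>sin \<theta> - (\<Sum>m<2. sin_coeff m * \<theta> ^ m)\<bar> \<le> inverse (fact 2) * \<bar>\<theta>\<bar> ^ 2"
    by (rule Maclaurin_sin_bound)
  then have "\<bar>sin \<theta> - \<theta>\<bar> \<le> \<theta>\<^sup>2 / 2"
    by (simp add: sin_coeff_def numeral_2_eq_2)
  then show ?thesis by (smt (verit) zero_le_power2 field_sum_of_halves)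
qed

text \<open>Beyond its linear part a rotated entry changes by
  \<open>(cos \<theta> - 1) * x + (sin \<theta> - \<theta>) * y\<close> with entries
  \<open>x\<close>, \<open>y\<close> of modulus at most 1; each summand is at most
  \<open>\<theta>\<^sup>2\<close>.\<close>

lemma rot_deriv_entry:
  assumes ab: "a < n" "b < n" "a \<noteq> b" and ij: "i < n" "j < n"
  shows "rot_deriv n a b (\<lambda>u. u (i,j))
    (\<lambda>u. (if i = a then u (b,j) else 0) - (if i = b then u (a,j) else 0))"
proof (rule rot_derivI[where C = 2])
  show "(\<lambda>u. (if i = a then u (b,j) else 0) - (if i = b then u (a,j) else 0))
      \<in> orth_measurable n"
    using entry_measurable by (cases "i = a"; cases "i = b") auto
  fix u and \<theta> :: real assume u: "u \<in> orth_group n"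
  note bd = orth_group_entry_bound[OF u]
  show "\<bar>u (i,j)\<bar> \<le> 2" using bd[of i j] by simp
  show "\<bar>(if i = a then u (b,j) else 0) - (if i = b then u (a,j) else 0)\<bar> \<le> 2"
    using bd[of a j] bd[of b j] ab by auto
  assume t: "\<bar>\<theta>\<bar> \<le> 1"
  have c: "\<bar>(cos \<theta> - 1) * x\<bar> \<le> \<theta>\<^sup>2" if "\<bar>x\<bar> \<le> 1" for x
  proof -
    have "\<bar>(cos \<theta> - 1) * x\<bar> \<le> (\<theta>\<^sup>2/2) * 1"
      unfolding abs_mult by (intro mult_mono abs_cos_minus_1_le that) auto
    then show ?thesis using zero_le_power2[of \<theta>] by linarith
  qed
  have s: "\<bar>(sin \<theta> - \<theta>) * x\<bar> \<le> \<theta>\<^sup>2" if "\<bar>x\<bar> \<le> 1" for x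
    using mult_mono[OF abs_sin_minus_le[OF t] that] by (simp add: abs_mult)
  show "\<bar>mat_mult n (plane_rot n a b \<theta>) u (i,j) - u (i,j)
       - \<theta> * ((if i = a then u (b,j) else 0) - (if i = b then u (a,j) else 0))\<bar> \<le> 2 * \<theta>\<^sup>2"
  proof -
    have "\<bar>(cos \<theta> * x + sin \<theta> * y) - x - \<theta> * y\<bar> \<le> 2 * \<theta>\<^sup>2" if "\<bar>x\<bar> \<le> 1" "\<bar>y\<bar> \<le> 1" for x y
    proof -
      have "(cos \<theta> * x + sin \<theta> * y) - x - \<theta> * y = (cos \<theta> - 1) * x + (sin \<theta> - \<theta>) * y"
        by (simp add: algebra_simps)
      then show ?thesis using c[OF that(1)] s[OF that(2)] by linarith
    qed
    \<comment> \<open>Row \<open>b\<close> is the same computation with \<open>y\<close> replaced by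
      \<open>- u (a,j)\<close>.\<close>
    from this[OF bd[of a j] bd[of b j]] this[OF bd[of b j], of "- u (a,j)"] bd[of a j]
    show ?thesis using ab by (subst plane_rot_mult[OF ab ij]) auto
  qed
qed (rule entry_measurable)

text \<open>Invariance gives \<open>F\<close> and its rotated copy the same integral. Integrating
  the expansion therefore leaves \<open>\<theta>\<close> times the integral of \<open>F'\<close>,
  bounded by \<open>C * \<theta>\<^sup>2\<close> for all small angles, and dividing by
  \<open>\<theta>\<close> forces the integral to be 0. This is how the Haar property enters the loop
  equation.\<close>

lemma integral_rot_deriv:
  assumes "haar_On n \<mu>" and ab: "a < n" "b < n" "a \<noteq> b" and "rot_deriv n a b F F'"
  shows "integrable \<mu> F" "integrable \<mu> F'" "(\<integral>u. F' u \<partial>\<mu>) = 0"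
proof -
  interpret prob_space \<mu> using assms by (simp add: haar_On_def)
  have sp: "space \<mu> = orth_group n" and st: "sets \<mu> = sets (restrict_space borel (orth_group n))"
    and inv: "\<And>g. g \<in> orth_group n \<Longrightarrow> distr \<mu> \<mu> (mat_mult n g) = \<mu>"
    using assms by (auto simp: haar_On_def)
  from assms(5) obtain C where C: "C \<ge> 0" "F \<in> orth_measurable n"
    "F' \<in> orth_measurable n"
    "\<And>u. u \<in> orth_group n \<Longrightarrow> \<bar>F u\<bar> \<le> C" "\<And>u. u \<in> orth_group n \<Longrightarrow> \<bar>F' u\<bar> \<le> C"
    "\<And>u \<theta>. u \<in> orth_group n \<Longrightarrow> \<bar>\<theta>\<bar> \<le> 1 \<Longrightarrow>
      \<bar>F (mat_mult n (plane_rot n a b \<theta>) u) - F u - \<theta> * F' u\<bar> \<le> C * \<theta>\<^sup>2"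
    by (elim rot_derivE) (rule that; blast)
  have mF [measurable]: "F \<in> borel_measurable \<mu>" and mF' [measurable]: "F' \<in> borel_measurable \<mu>"
    using C(2,3) measurable_cong_sets[OF st refl] by auto
  show iF: "integrable \<mu> F" and iF': "integrable \<mu> F'"
    using C(4,5) sp by (auto intro!: integrable_const_bound[where B = C])
  have bound: "\<bar>\<theta> * (\<integral>u. F' u \<partial>\<mu>)\<bar> \<le> C * \<theta>\<^sup>2" if t: "\<bar>\<theta>\<bar> \<le> 1" for \<theta>
  proof -
    let ?R = "mat_mult n (plane_rot n a b \<theta>)"
    have g: "plane_rot n a b \<theta> \<in> orth_group n" by (rule plane_rot_orth[OF ab])
    have mR [measurable]: "?R \<in> measurable \<mu> \<mu>"
    proof -
      have "?R \<in> orth_measurable n"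
      proof (rule measurable_restrict_space1, rule borel_measurable_continuous_onI)
        show "continuous_on UNIV ?R"
          unfolding mat_mult_def
        proof (intro continuous_on_coordinatewise_then_product)
          fix p :: "nat \<times> nat"
          obtain i j where p: "p = (i,j)" by fastforce
          show "continuous_on UNIV (\<lambda>x::rmat. (\<lambda>(i,j). if i < n \<and> j < n
              then \<Sum>k<n. plane_rot n a b \<theta> (i,k) * x (k,j) else 0) p)"
            unfolding p by (cases "i < n \<and> j < n")
              (auto intro!: continuous_intros continuous_on_product_coordinates)
        qed
      qed
      then have "?R \<in> measurable (restrict_space borel (orth_group n)) (restrict_space borel (orth_group n))"
        using orth_group_mult[OF g] by (intro measurable_restrict_space2) (auto simp: space_restrict_space)
      then show ?thesis using measurable_cong_sets[OF st st] by simp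
    qed
    have iFR: "integrable \<mu> (\<lambda>u. F (?R u))"
      using C(4) sp orth_group_mult[OF g] by (auto intro!: integrable_const_bound[where B = C])
    have "(\<integral>u. F (?R u) \<partial>\<mu>) = (\<integral>u. F u \<partial>distr \<mu> \<mu> ?R)"
      by (rule integral_distr[symmetric]) auto
    then have eq: "(\<integral>u. F (?R u) \<partial>\<mu>) = (\<integral>u. F u \<partial>\<mu>)" using inv[OF g] by simp
    have "\<theta> * (\<integral>u. F' u \<partial>\<mu>) = - (\<integral>u. F (?R u) - F u - \<theta> * F' u \<partial>\<mu>)"
      using iF iF' iFR eq by simp
    also have "\<bar>\<dots>\<bar> \<le> (\<integral>u. \<bar>F (?R u) - F u - \<theta> * F' u\<bar> \<partial>\<mu>)"
      unfolding abs_minus_cancel by (rule integral_abs_bound)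
    also have "\<dots> \<le> (\<integral>u. C * \<theta>\<^sup>2 \<partial>\<mu>)"
      using iF iF' iFR C(6) t sp by (intro integral_mono) auto
    finally show ?thesis by (simp add: prob_space)
  qed
  show "(\<integral>u. F' u \<partial>\<mu>) = 0"
  proof (rule ccontr)
    assume "(\<integral>u. F' u \<partial>\<mu>) \<noteq> 0"
    define e where "e = \<bar>\<integral>u. F' u \<partial>\<mu>\<bar>"
    have e: "e > 0" using \<open>_ \<noteq> 0\<close> by (simp add: e_def)
    \<comment> \<open>Any positive angle with \<open>C * \<theta> < e\<close> contradicts the bound;
      the \<open>+ 1\<close> keeps the denominator positive when \<open>C = 0\<close>.\<close>
    define \<theta> where "\<theta> = min 1 (e / (2 * (C + 1)))"
    have \<theta>: "\<theta> > 0" "\<theta> \<le> 1" using e C(1) by (auto simp: \<theta>_def)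
    have "\<theta> * e \<le> C * \<theta>\<^sup>2" using bound[of \<theta>] \<theta> by (simp add: e_def abs_mult)
    then have "e \<le> C * \<theta>" using \<theta> by (simp add: power2_eq_square)
    also have "\<dots> \<le> C * (e / (2 * (C + 1)))" using C(1) by (intro mult_left_mono) (auto simp: \<theta>_def)
    also have "\<dots> < e" using e C(1) by (simp add: field_simps add_nonneg_pos)
    finally show False by simp
  qed
qed

section \<open>Traces of powers and the loop equation\<close>

definition nat_dist :: "nat \<Rightarrow> nat \<Rightarrow> nat" where
  "nat_dist p q = (p - q) + (q - p)"

lemma mat_pow_outside: "\<not> (i < n \<and> j < n) \<Longrightarrow> mat_pow n u k (i,j) = 0"
  by (cases k) (auto simp: mat_id_def mat_mult_def)

lemma mat_pow_Suc_entry: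
  "i < n \<Longrightarrow> j < n \<Longrightarrow> mat_pow n u (Suc k) (i,j) = (\<Sum>m<n. u (i,m) * mat_pow n u k (m,j))"
  by (simp add: mat_mult_def)

lemma mat_pow_add:
  assumes "i < n" "j < n"
  shows "mat_pow n u (p + q) (i,j) = (\<Sum>m<n. mat_pow n u p (i,m) * mat_pow n u q (m,j))"
  using assms
proof (induction p arbitrary: i)
  case 0
  have "(\<Sum>m<n. mat_pow n u 0 (i,m) * mat_pow n u q (m,j)) = (\<Sum>m<n. if m = i then mat_pow n u q (m,j) else 0)"
    using 0 by (intro sum.cong) (auto simp: mat_id_def)
  then show ?case using 0 by simp
next
  case (Suc p)
  have "mat_pow n u (Suc p + q) (i,j) = (\<Sum>m<n. u (i,m) * (\<Sum>l<n. mat_pow n u p (m,l) * mat_pow n u q (l,j)))"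
    using Suc by (simp only: add_Suc mat_pow_Suc_entry) simp
  also have "\<dots> = (\<Sum>l<n. (\<Sum>m<n. u (i,m) * mat_pow n u p (m,l)) * mat_pow n u q (l,j))"
    unfolding sum_distrib_left sum_distrib_right by (subst sum.swap) (simp add: mult.assoc)
  also have "\<dots> = (\<Sum>l<n. mat_pow n u (Suc p) (i,l) * mat_pow n u q (l,j))"
    using Suc.prems by (intro sum.cong refl) (simp only: mat_pow_Suc_entry lessThan_iff)
  finally show ?case .
qed

lemma tr_pow_0: "tr_pow n 0 u = real n"
  by (simp add: tr_pow_def mat_id_def)

text \<open>The left side is the trace of \<open>u^p\<close> times the transpose of
  \<open>u^q\<close>. The transpose inverts \<open>u\<close>, so orthogonality of the columns
  cancels one factor \<open>u\<close> from both powers (\<open>inner\<close>) until one exponent is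
  0; a trace does not see the transposition, hence the symmetric exponent.\<close>

lemma sum_mat_pow_mult:
  assumes u: "u \<in> orth_group n"
  shows "(\<Sum>a<n. \<Sum>b<n. mat_pow n u p (a,b) * mat_pow n u q (a,b)) = tr_pow n (nat_dist p q) u"
proof -
  have base: "(\<Sum>a<n. \<Sum>b<n. mat_pow n u p (a,b) * mat_pow n u 0 (a,b)) = tr_pow n p u" for p
  proof -
    have "(\<Sum>a<n. \<Sum>b<n. mat_pow n u p (a,b) * mat_pow n u 0 (a,b)) =
        (\<Sum>a<n. \<Sum>b<n. if b = a then mat_pow n u p (a,b) else 0)"
      by (intro sum.cong) (auto simp: mat_id_def)
    then show ?thesis by (simp add: tr_pow_def)
  qed
  show ?thesis
  proof (induction p arbitrary: q)
    case 0
    then show ?case using base[of q] by (simp add: nat_dist_def mult.commute)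
  next
    case (Suc p)
    show ?case
    proof (cases q)
      case 0
      then show ?thesis using base[of "Suc p"] by (simp add: nat_dist_def)
    next
      case (Suc q')
      have inner: "(\<Sum>a<n. mat_pow n u (Suc p) (a,b) * mat_pow n u (Suc q') (a,b)) =
          (\<Sum>a<n. mat_pow n u p (a,b) * mat_pow n u q' (a,b))" if b: "b < n" for b
      proof -
        have "(\<Sum>a<n. mat_pow n u (Suc p) (a,b) * mat_pow n u (Suc q') (a,b)) =
          (\<Sum>a<n. \<Sum>m<n. \<Sum>l<n. (u (a,m) * u (a,l)) * (mat_pow n u p (m,b) * mat_pow n u q' (l,b)))"
          using b by (intro sum.cong refl) (simp only: mat_pow_Suc_entry lessThan_iff, simp add: sum_product algebra_simps)
        also have "\<dots> = (\<Sum>m<n. \<Sum>l<n. \<Sum>a<n. (u (a,m) * u (a,l)) * (mat_pow n u p (m,b) * mat_pow n u q' (l,b)))"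
          by (subst sum.swap, rule sum.cong[OF refl], rule sum.swap)
        also have "\<dots> = (\<Sum>m<n. \<Sum>l<n. if l = m then mat_pow n u p (m,b) * mat_pow n u q' (l,b) else 0)"
          by (intro sum.cong refl) (simp add: sum_distrib_right[symmetric] orth_group_column[OF u])
        finally show ?thesis by simp
      qed
      have "(\<Sum>a<n. \<Sum>b<n. mat_pow n u (Suc p) (a,b) * mat_pow n u (Suc q') (a,b)) =
          (\<Sum>a<n. \<Sum>b<n. mat_pow n u p (a,b) * mat_pow n u q' (a,b))"
        by (subst sum.swap, subst (2) sum.swap, intro sum.cong refl inner) simp
      then show ?thesis using Suc.IH[of q'] Suc by (simp add: nat_dist_def)
    qed
  qed
qed

text \<open>Leibniz rule: rotating the factor number \<open>j\<close> inserts
  \<open>E_ab - E_ba\<close> behind \<open>u^j\<close>. The rotated factor itself remains, so the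
  power to the right is \<open>k - j\<close> and not \<open>k - j - 1\<close>.\<close>

lemma rot_deriv_mat_pow:
  assumes ab: "a < n" "b < n" "a \<noteq> b" and cd: "c < n" "d < n"
  shows "rot_deriv n a b (\<lambda>u. mat_pow n u k (c,d))
    (\<lambda>u. \<Sum>j<k. mat_pow n u j (c,a) * mat_pow n u (k - j) (b,d) - mat_pow n u j (c,b) * mat_pow n u (k - j) (a,d))"
  using cd
proof (induction k arbitrary: c)
  case 0
  then show ?case using rot_deriv_const by simp
next
  case (Suc k)
  let ?D = "\<lambda>u c. \<Sum>j<k. mat_pow n u j (c,a) * mat_pow n u (k - j) (b,d) - mat_pow n u j (c,b) * mat_pow n u (k - j) (a,d)"
  have "rot_deriv n a b (\<lambda>u. \<Sum>m<n. u (c,m) * mat_pow n u k (m,d))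
     (\<lambda>u. \<Sum>m<n. ((if c = a then u (b,m) else 0) - (if c = b then u (a,m) else 0)) * mat_pow n u k (m,d)
        + u (c,m) * ?D u m)"
    using Suc by (intro rot_deriv_sum rot_deriv_mult rot_deriv_entry ab) auto
  then show ?case
  proof (rule rot_deriv_cong[OF _ ab])
    fix u assume u: "u \<in> orth_group n"
    show "(\<Sum>m<n. u (c,m) * mat_pow n u k (m,d)) = mat_pow n u (Suc k) (c,d)"
      using Suc by (simp only: mat_pow_Suc_entry)
    \<comment> \<open>The derivative of the first factor is the term \<open>j = 0\<close>; those of
      the other factors come from the induction hypothesis with \<open>j\<close> shifted by
      one.\<close>
    have 1: "(\<Sum>m<n. ((if c = a then u (b,m) else 0) - (if c = b then u (a,m) else 0)) * mat_pow n u k (m,d))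
      = mat_pow n u 0 (c,a) * mat_pow n u (Suc k) (b,d) - mat_pow n u 0 (c,b) * mat_pow n u (Suc k) (a,d)"
      using ab Suc.prems by (auto simp: mat_id_def mat_mult_def sum_negf)
    have "(\<Sum>m<n. u (c,m) * ?D u m) =
      (\<Sum>j<k. (\<Sum>m<n. u (c,m) * mat_pow n u j (m,a)) * mat_pow n u (k - j) (b,d)
         - (\<Sum>m<n. u (c,m) * mat_pow n u j (m,b)) * mat_pow n u (k - j) (a,d))"
      unfolding sum_distrib_left sum_distrib_right sum_subtractf[symmetric]
      by (subst sum.swap) (simp add: algebra_simps)
    also have "\<dots> = (\<Sum>j<k. mat_pow n u (Suc j) (c,a) * mat_pow n u (Suc k - Suc j) (b,d)
         - mat_pow n u (Suc j) (c,b) * mat_pow n u (Suc k - Suc j) (a,d))"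
      using Suc.prems ab by (intro sum.cong refl) (simp only: mat_pow_Suc_entry diff_Suc_Suc)
    finally have 2: "(\<Sum>m<n. u (c,m) * ?D u m) =
      (\<Sum>j<k. mat_pow n u (Suc j) (c,a) * mat_pow n u (Suc k - Suc j) (b,d)
         - mat_pow n u (Suc j) (c,b) * mat_pow n u (Suc k - Suc j) (a,d))" .
    show "(\<Sum>m<n. ((if c = a then u (b,m) else 0) - (if c = b then u (a,m) else 0)) * mat_pow n u k (m,d)
        + u (c,m) * ?D u m)
      = (\<Sum>j<Suc k. mat_pow n u j (c,a) * mat_pow n u (Suc k - j) (b,d) - mat_pow n u j (c,b) * mat_pow n u (Suc k - j) (a,d))"
      unfolding sum.distrib 1 2 sum.lessThan_Suc_shift[of _ k] by simp
  qed
qed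

text \<open>By cyclicity of the trace all \<open>k\<close> positions of the inserted matrix
  contribute alike.\<close>

lemma rot_deriv_tr_pow:
  assumes ab: "a < n" "b < n" "a \<noteq> b"
  shows "rot_deriv n a b (tr_pow n k) (\<lambda>u. real k * (mat_pow n u k (b,a) - mat_pow n u k (a,b)))"
proof -
  have "rot_deriv n a b (\<lambda>u. \<Sum>c<n. mat_pow n u k (c,c))
    (\<lambda>u. \<Sum>c<n. \<Sum>j<k. mat_pow n u j (c,a) * mat_pow n u (k - j) (b,c) - mat_pow n u j (c,b) * mat_pow n u (k - j) (a,c))"
    by (intro rot_deriv_sum rot_deriv_mat_pow ab) auto
  then show ?thesis
  proof (rule rot_deriv_cong[OF _ ab])
    fix u
    have e: "(\<Sum>c<n. mat_pow n u j (c,x) * mat_pow n u (k - j) (y,c)) = mat_pow n u k (y,x)"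
      if "j < k" "x < n" "y < n" for j x y
      using mat_pow_add[OF that(3,2), of u "k - j" j] that by (simp add: mult.commute)
    have "(\<Sum>c<n. \<Sum>j<k. mat_pow n u j (c,a) * mat_pow n u (k - j) (b,c) - mat_pow n u j (c,b) * mat_pow n u (k - j) (a,c))
      = (\<Sum>j<k. mat_pow n u k (b,a) - mat_pow n u k (a,b))"
      by (subst sum.swap) (simp add: sum_subtractf e ab)
    then show "(\<Sum>c<n. \<Sum>j<k. mat_pow n u j (c,a) * mat_pow n u (k - j) (b,c) - mat_pow n u j (c,b) * mat_pow n u (k - j) (a,c))
      = real k * (mat_pow n u k (b,a) - mat_pow n u k (a,b))" by simp
  qed (simp add: tr_pow_def)
qed

lemma rot_deriv_prod_list:
  assumes ab: "a < n" "b < n" "a \<noteq> b"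
    and "\<And>k. rot_deriv n a b (F k) (F' k)"
  shows "rot_deriv n a b (\<lambda>u. \<Prod>k\<leftarrow>ks. F k u)
    (\<lambda>u. \<Sum>i<length ks. F' (ks ! i) u * (\<Prod>k\<leftarrow>delete_nth i ks. F k u))"
proof (induction ks)
  case Nil
  then show ?case using rot_deriv_const by simp
next
  case (Cons k ks)
  from rot_deriv_mult[OF ab assms(4)[of k] Cons]
  show ?case
    by (rule rot_deriv_cong[OF _ ab])
      (simp_all only: list.map prod_list.Cons length_Cons sum.lessThan_Suc_shift nth_Cons_0 nth_Cons_Suc
        delete_nth_simps sum_distrib_left mult.left_commute)
qed

definition tr_prod :: "nat \<Rightarrow> nat list \<Rightarrow> rmat \<Rightarrow> real" where
  "tr_prod n ks u = (\<Prod>k\<leftarrow>ks. tr_pow n k u)"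

lemma tr_prod_Cons: "tr_prod n (k # ks) u = tr_pow n k u * tr_prod n ks u"
  by (simp add: tr_prod_def)

lemma tr_prod_integrable:
  assumes "haar_On n \<mu>"
  shows "integrable \<mu> (tr_prod n ks)"
proof -
  have m: "(\<lambda>u. mat_pow n u k (i,j)) \<in> orth_measurable n" for k i j
  proof (induction k arbitrary: i)
    case (Suc k)
    show ?case
    proof (cases "i < n \<and> j < n")
      case True
      have "(\<lambda>u. \<Sum>m<n. u (i,m) * mat_pow n u k (m,j)) \<in> orth_measurable n"
        using entry_measurable Suc by measurable
      then show ?thesis using True by (simp add: mat_mult_def)
    next
      case False
      then show ?thesis by (subst mat_pow_outside) auto
    qed
  qed simp
  have b: "\<exists>C. \<forall>u\<in>orth_group n. \<bar>tr_pow n k u\<bar> \<le> C" for k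
  proof -
    have "\<bar>mat_pow n u k (i,j)\<bar> \<le> real n ^ k" if "u \<in> orth_group n" for u i j
    proof (induction k arbitrary: i)
      case 0 then show ?case by (simp add: mat_id_def)
    next
      case (Suc k)
      show ?case
      proof (cases "i < n \<and> j < n")
        case True
        have "\<bar>mat_pow n u (Suc k) (i,j)\<bar> \<le> (\<Sum>m<n. \<bar>u (i,m) * mat_pow n u k (m,j)\<bar>)"
          using True by (simp add: mat_mult_def del: abs_mult)
        also have "\<dots> \<le> (\<Sum>m<n. 1 * real n ^ k)"
          unfolding abs_mult
          by (intro sum_mono mult_mono Suc orth_group_entry_bound[OF that]) auto
        finally show ?thesis by simp
      next
        case False
        then show ?thesis by (subst mat_pow_outside) auto
      qed
    qed
    then have "\<bar>tr_pow n k u\<bar> \<le> (\<Sum>i<n. real n ^ k)" if "u \<in> orth_group n" for u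
      unfolding tr_pow_def using that by (intro order.trans[OF sum_abs] sum_mono) auto
    then show ?thesis by blast
  qed
  have mt: "tr_pow n k \<in> orth_measurable n" for k
    unfolding tr_pow_def using m by measurable
  have mp: "tr_prod n ks \<in> orth_measurable n"
  proof (induction ks)
    case Nil then show ?case by (simp add: tr_prod_def)
  next
    case (Cons k ks)
    then show ?case unfolding tr_prod_Cons using mt by measurable
  qed
  have "\<exists>C\<ge>0. \<forall>u\<in>orth_group n. \<bar>tr_prod n ks u\<bar> \<le> C"
  proof (induction ks)
    case Nil then show ?case by (auto simp: tr_prod_def intro!: exI[of _ 1])
  next
    case (Cons k ks)
    then obtain C where C: "C \<ge> 0" "\<forall>u\<in>orth_group n. \<bar>tr_prod n ks u\<bar> \<le> C" by blast
    obtain D where D: "\<forall>u\<in>orth_group n. \<bar>tr_pow n k u\<bar> \<le> D" using b by blast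
    have "\<bar>tr_prod n (k # ks) u\<bar> \<le> max D 0 * C" if "u \<in> orth_group n" for u
      using C D that unfolding tr_prod_Cons abs_mult by (intro mult_mono) (auto simp: max.coboundedI1)
    then show ?case using C(1) by (intro exI[of _ "max D 0 * C"]) auto
  qed
  then obtain C where C: "\<forall>u\<in>orth_group n. \<bar>tr_prod n ks u\<bar> \<le> C" by blast
  interpret prob_space \<mu> using assms by (simp add: haar_On_def)
  have sp: "space \<mu> = orth_group n" and st: "sets \<mu> = sets (restrict_space borel (orth_group n))"
    using assms by (auto simp: haar_On_def)
  show ?thesis
  proof (rule integrable_const_bound[where B = C])
    show "AE u in \<mu>. norm (tr_prod n ks u) \<le> C" using C sp by auto
    show "tr_prod n ks \<in> borel_measurable \<mu>" using mp measurable_cong_sets[OF st refl] by auto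
  qed
qed

definition tr_mom :: "(nat \<Rightarrow> rmat measure) \<Rightarrow> nat \<Rightarrow> nat list \<Rightarrow> real" where
  "tr_mom \<mu> n ks = (\<integral>u. tr_prod n ks u \<partial>\<mu> n)"

text \<open>\<open>integral_rot_deriv\<close> is applied to the \<open>(a,b)\<close> entry of
  \<open>u^k\<close> times the trace product, and the result is summed. For \<open>a = b\<close>
  there is no rotation, but the integrand \<open>?D\<close> vanishes identically, so the full double
  sum is allowed; it turns products of entries into traces, with \<open>sum_mat_pow_mult\<close> for
  the entries in equal index order.\<close>

lemma loop_equation:
  assumes H: "haar_On n (\<mu> n)"
  shows "(\<Sum>j<k. tr_mom \<mu> n (j # (k - j) # ks) - tr_mom \<mu> n (nat_dist j (k - j) # ks))
     + (\<Sum>i<length ks. real (ks ! i) * (tr_mom \<mu> n ((k + ks ! i) # delete_nth i ks)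
          - tr_mom \<mu> n (nat_dist k (ks ! i) # delete_nth i ks))) = 0"
proof -
  let ?D = "\<lambda>a b u. (\<Sum>j<k. mat_pow n u j (a,a) * mat_pow n u (k - j) (b,b) - mat_pow n u j (a,b) * mat_pow n u (k - j) (a,b)) * tr_prod n ks u
     + mat_pow n u k (a,b) * (\<Sum>i<length ks. (real (ks ! i) * (mat_pow n u (ks ! i) (b,a) - mat_pow n u (ks ! i) (a,b))) * tr_prod n (delete_nth i ks) u)"
  have D: "integrable (\<mu> n) (?D a b)" "(\<integral>u. ?D a b u \<partial>\<mu> n) = 0" if "a < n" "b < n" for a b
  proof -
    have "integrable (\<mu> n) (?D a b) \<and> (\<integral>u. ?D a b u \<partial>\<mu> n) = 0"
    proof (cases "a = b")
      case False
      have "rot_deriv n a b (\<lambda>u. mat_pow n u k (a,b) * tr_prod n ks u) (?D a b)"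
        unfolding tr_prod_def
        by (intro rot_deriv_mult rot_deriv_mat_pow rot_deriv_prod_list rot_deriv_tr_pow that False)
      from integral_rot_deriv[OF H that False this] show ?thesis by simp
    qed simp
    then show "integrable (\<mu> n) (?D a b)" "(\<integral>u. ?D a b u \<partial>\<mu> n) = 0" by auto
  qed
  have sp: "space (\<mu> n) = orth_group n" using H by (simp add: haar_On_def)
  let ?R = "\<lambda>u. (\<Sum>j<k. tr_prod n (j # (k - j) # ks) u - tr_prod n (nat_dist j (k - j) # ks) u)
     + (\<Sum>i<length ks. real (ks ! i) * (tr_prod n ((k + ks ! i) # delete_nth i ks) u
          - tr_prod n (nat_dist k (ks ! i) # delete_nth i ks) u))"
  have pt: "(\<Sum>a<n. \<Sum>b<n. ?D a b u) = ?R u" if u: "u \<in> orth_group n" for u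
  proof -
    have 1: "(\<Sum>a<n. \<Sum>b<n. mat_pow n u j (a,a) * mat_pow n u (k - j) (b,b)) = tr_pow n j u * tr_pow n (k - j) u" for j
      by (simp add: tr_pow_def sum_product)
    have 2: "(\<Sum>a<n. \<Sum>b<n. mat_pow n u k (a,b) * mat_pow n u l (b,a)) = tr_pow n (k + l) u" for l
      unfolding tr_pow_def by (intro sum.cong refl mat_pow_add[symmetric]) auto
    have "(\<Sum>a<n. \<Sum>b<n. (\<Sum>j<k. mat_pow n u j (a,a) * mat_pow n u (k - j) (b,b) - mat_pow n u j (a,b) * mat_pow n u (k - j) (a,b)) * tr_prod n ks u)
      = (\<Sum>j<k. (\<Sum>a<n. \<Sum>b<n. mat_pow n u j (a,a) * mat_pow n u (k - j) (b,b) - mat_pow n u j (a,b) * mat_pow n u (k - j) (a,b)) * tr_prod n ks u)"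
      unfolding sum_distrib_right by (subst (2) sum.swap, subst sum.swap) simp
    also have "\<dots> = (\<Sum>j<k. tr_prod n (j # (k - j) # ks) u - tr_prod n (nat_dist j (k - j) # ks) u)"
      unfolding sum_subtractf[of _ _ "{..<n}"] 1 sum_mat_pow_mult[OF u] by (simp add: tr_prod_Cons algebra_simps)
    finally have A: "(\<Sum>a<n. \<Sum>b<n. (\<Sum>j<k. mat_pow n u j (a,a) * mat_pow n u (k - j) (b,b) - mat_pow n u j (a,b) * mat_pow n u (k - j) (a,b)) * tr_prod n ks u)
      = (\<Sum>j<k. tr_prod n (j # (k - j) # ks) u - tr_prod n (nat_dist j (k - j) # ks) u)" .
    have "(\<Sum>a<n. \<Sum>b<n. mat_pow n u k (a,b) * (\<Sum>i<length ks. (real (ks ! i) * (mat_pow n u (ks ! i) (b,a) - mat_pow n u (ks ! i) (a,b))) * tr_prod n (delete_nth i ks) u))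
      = (\<Sum>i<length ks. \<Sum>a<n. \<Sum>b<n. mat_pow n u k (a,b) * ((real (ks ! i) * (mat_pow n u (ks ! i) (b,a) - mat_pow n u (ks ! i) (a,b))) * tr_prod n (delete_nth i ks) u))"
      unfolding sum_distrib_left by (subst (2) sum.swap, subst sum.swap) simp
    also have "\<dots> = (\<Sum>i<length ks. (real (ks ! i) * tr_prod n (delete_nth i ks) u) *
        (\<Sum>a<n. \<Sum>b<n. mat_pow n u k (a,b) * mat_pow n u (ks ! i) (b,a) - mat_pow n u k (a,b) * mat_pow n u (ks ! i) (a,b)))"
      unfolding sum_distrib_left by (intro sum.cong refl) (simp add: algebra_simps)
    also have "\<dots> = (\<Sum>i<length ks. real (ks ! i) * (tr_prod n ((k + ks ! i) # delete_nth i ks) u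
          - tr_prod n (nat_dist k (ks ! i) # delete_nth i ks) u))"
      unfolding sum_subtractf 2 sum_mat_pow_mult[OF u] by (intro sum.cong refl) (simp add: tr_prod_Cons algebra_simps)
    finally show ?thesis unfolding sum.distrib A by simp
  qed
  have "(\<integral>u. ?R u \<partial>\<mu> n) = (\<integral>u. (\<Sum>a<n. \<Sum>b<n. ?D a b u) \<partial>\<mu> n)"
    by (intro Bochner_Integration.integral_cong refl pt[symmetric]) (simp add: sp)
  also have "\<dots> = (\<Sum>a<n. \<integral>u. (\<Sum>b<n. ?D a b u) \<partial>\<mu> n)"
    by (rule Bochner_Integration.integral_sum) (intro Bochner_Integration.integrable_sum D(1); simp)
  also have "\<dots> = (\<Sum>a<n. \<Sum>b<n. \<integral>u. ?D a b u \<partial>\<mu> n)"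
    by (intro sum.cong refl Bochner_Integration.integral_sum D(1)) auto
  also have "\<dots> = 0" using D(2) by simp
  finally have "(\<integral>u. ?R u \<partial>\<mu> n) = 0" .
  moreover note tr_prod_integrable[OF H]
  ultimately show ?thesis unfolding tr_mom_def by simp
qed

section \<open>Convergence by induction on the total degree\<close>

definition pos_lists :: "nat \<Rightarrow> nat list set" where
  "pos_lists d = {ks. (\<forall>k\<in>set ks. k \<ge> 1) \<and> sum_list ks = d}"

lemma finite_pos_lists: "finite (pos_lists d)"
proof (rule finite_subset[OF _ finite_lists_length_le[of "{..d}" d]])
  have "length ks \<le> sum_list ks" if "\<forall>k\<in>set ks. k \<ge> 1" for ks :: "nat list"
    using that by (induction ks) auto
  then show "pos_lists d \<subseteq> {xs. set xs \<subseteq> {..d} \<and> length xs \<le> d}"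
    by (auto simp: pos_lists_def intro: member_le_sum_list)
qed simp

lemma tr_mom_Nil:
  assumes "haar_On n (\<mu> n)" shows "tr_mom \<mu> n [] = 1"
proof -
  interpret prob_space "\<mu> n" using assms by (simp add: haar_On_def)
  show ?thesis by (simp add: tr_mom_def tr_prod_def prob_space)
qed

lemma tr_mom_0: "tr_mom \<mu> n (0 # ks) = real n * tr_mom \<mu> n ks"
  by (simp add: tr_mom_def tr_prod_Cons tr_pow_0)

text \<open>The summand \<open>j = 0\<close> of the loop equation is \<open>n T_k - T_k\<close>,
  because \<open>T_0 = n\<close>. The first two sums have smaller degree, and the bracket collects
  the terms of the same degree as the left side, which lack the factor \<open>n\<close>.\<close>

lemma loop_equation_solved:
  assumes H: "haar_On n (\<mu> n)" and k: "k \<ge> 1"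
  shows "real n * tr_mom \<mu> n (k # ks) =
     (\<Sum>j=1..<k. tr_mom \<mu> n (nat_dist j (k - j) # ks))
     + (\<Sum>i<length ks. real (ks ! i) * tr_mom \<mu> n (nat_dist k (ks ! i) # delete_nth i ks))
     + (tr_mom \<mu> n (k # ks) - (\<Sum>j=1..<k. tr_mom \<mu> n (j # (k - j) # ks))
        - (\<Sum>i<length ks. real (ks ! i) * tr_mom \<mu> n ((k + ks ! i) # delete_nth i ks)))"
proof -
  have "{..<k} = insert 0 {1..<k}" using k by auto
  then have *: "(\<Sum>j<k. f j) = f 0 + (\<Sum>j=1..<k. f j)" for f :: "nat \<Rightarrow> real" by simp
  show ?thesis
    using loop_equation[where \<mu> = \<mu>, OF H, of k ks]
    unfolding * sum_subtractf right_diff_distrib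
    by (simp add: tr_mom_0 nat_dist_def)
qed

text \<open>In the induction, \<open>y\<close> collects the terms of lower degree, whose limits are
  known: a term with leading index 0 survives the division by \<open>n\<close>, the others vanish
  (\<open>small\<close>). The terms of the same degree form the error in
  \<open>perturbation_limit\<close>.\<close>

theorem orth_trace_moments_limit:
  fixes M :: "'w measure" and X :: "nat \<Rightarrow> 'w \<Rightarrow> real"
  assumes H: "\<And>n. haar_On n (\<mu> n)" and M: "prob_space M"
    and ind: "prob_space.indep_vars M (\<lambda>_. borel) X {1..}"
    and nd: "\<And>k. k \<ge> 1 \<Longrightarrow> distributed M lborel (X k)
                 (normal_density (if even k then 1 else 0) (sqrt (real k)))"
    and ks: "\<forall>k\<in>set ks. k \<ge> 1"
  shows "(\<lambda>n. tr_mom \<mu> n ks) \<longlonglongrightarrow> (\<integral>\<omega>. (\<Prod>k\<leftarrow>ks. X k \<omega>) \<partial>M)"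
proof -
  interpret prob_space M by (rule M)
  define L where "L l = (\<integral>\<omega>. (\<Prod>k\<leftarrow>l. X k \<omega>) \<partial>M)" for l
  note rec = gaussian_moment_recursion[OF ind, folded L_def]
  have "(\<lambda>n. tr_mom \<mu> n ks) \<longlonglongrightarrow> L ks" if "ks \<in> pos_lists d" for d ks
    using that
  proof (induction d arbitrary: ks rule: less_induct)
    case (less d)
    show ?case
    proof (cases "d = 0")
      case True
      then have "ks = []" using less.prems by (cases ks) (auto simp: pos_lists_def)
      then show ?thesis using tr_mom_Nil[of _ \<mu>] H by (simp add: L_def prob_space)
    next
      case False
      \<comment> \<open>The value 0 at \<open>[]\<close> is a mere default: for
        \<open>d \<noteq> 0\<close> the empty list is not in \<open>pos_lists d\<close>.\<close>
      define y where "y n l = (case l of [] \<Rightarrow> 0 | k # ks \<Rightarrow>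
        (\<Sum>j=1..<k. tr_mom \<mu> n (nat_dist j (k - j) # ks) / real n)
     + (\<Sum>i<length ks. real (ks ! i) * (tr_mom \<mu> n (nat_dist k (ks ! i) # delete_nth i ks) / real n)))" for n l
      \<comment> \<open>The weight \<open>2 * d + 1\<close> bounds the terms of the same degree: one
        for the moment itself, fewer than \<open>k\<close> products of two traces, and coefficients
        \<open>ks ! i\<close> of total at most \<open>d\<close>.\<close>
      define \<epsilon> where "\<epsilon> n = (2 * real d + 1) / real n" for n
      have small: "(\<lambda>n. tr_mom \<mu> n (p # l) / real n) \<longlonglongrightarrow> (if p = 0 then L l else 0)"
        if l: "\<forall>k\<in>set l. k \<ge> 1" "p + sum_list l < d" for p l
      proof (cases "p = 0")
        case True
        have "(\<lambda>n. tr_mom \<mu> n l) \<longlonglongrightarrow> L l"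
          using l by (intro less.IH[of "sum_list l"]) (auto simp: pos_lists_def)
        moreover have "\<forall>\<^sub>F n in sequentially. tr_mom \<mu> n l = tr_mom \<mu> n (p # l) / real n"
          using eventually_gt_at_top[of 0] by eventually_elim (simp add: True tr_mom_0)
        ultimately show ?thesis using True by (simp add: Lim_transform_eventually)
      next
        case False
        have "(\<lambda>n. tr_mom \<mu> n (p # l)) \<longlonglongrightarrow> L (p # l)"
          using l False by (intro less.IH[of "p + sum_list l"]) (auto simp: pos_lists_def)
        from tendsto_mult[OF this lim_inverse_n] show ?thesis using False by (simp add: divide_inverse)
      qed
      show ?thesis
      proof (rule perturbation_limit[where I = "pos_lists d" and y = y and \<epsilon> = \<epsilon>, OF finite_pos_lists])
        show "\<epsilon> \<longlonglongrightarrow> 0"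
          unfolding \<epsilon>_def using tendsto_mult[OF tendsto_const lim_inverse_n, of "2 * real d + 1"]
          by (simp add: divide_inverse)
        show "ks \<in> pos_lists d" by fact
      next
        fix l assume l: "l \<in> pos_lists d"
        then obtain k ks where kk: "l = k # ks" using False by (cases l) (auto simp: pos_lists_def)
        have k: "k \<ge> 1" "\<forall>k\<in>set ks. k \<ge> 1" "k + sum_list ks = d" using l kk by (auto simp: pos_lists_def)
        have "(\<lambda>n. y n l) \<longlonglongrightarrow> (\<Sum>j=1..<k. if nat_dist j (k - j) = 0 then L ks else 0)
           + (\<Sum>i<length ks. real (ks ! i) * (if nat_dist k (ks ! i) = 0 then L (delete_nth i ks) else 0))"
          unfolding y_def kk list.case
        proof (intro tendsto_add tendsto_sum tendsto_mult tendsto_const small)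
          fix j assume "j \<in> {1..<k}"
          then show "nat_dist j (k - j) + sum_list ks < d" using k by (auto simp: nat_dist_def)
        next
          fix i assume "i \<in> {..<length ks}"
          then have i: "i < length ks" by simp
          then have "ks ! i \<ge> 1" using k by simp
          then show "nat_dist k (ks ! i) + sum_list (delete_nth i ks) < d"
            using k sum_list_delete_nth[OF i] by (auto simp: nat_dist_def)
          show "\<forall>k\<in>set (delete_nth i ks). k \<ge> 1" using k set_delete_nth by fastforce
        qed (use k in auto)
        also have "(\<Sum>j=1..<k. if nat_dist j (k - j) = 0 then L ks else 0) = (if even k then 1 else 0) * L ks"
        proof -
          have "(\<Sum>j=1..<k. if nat_dist j (k - j) = 0 then L ks else 0) = (\<Sum>j=1..<k. if j = k div 2 then (if even k then L ks else 0) else 0)"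
            by (intro sum.cong) (auto simp: nat_dist_def)
          also have "\<dots> = (if even k then 1 else 0) * L ks" using k(1) by (auto elim!: evenE)
          finally show ?thesis .
        qed
        also have "(\<Sum>i<length ks. real (ks ! i) * (if nat_dist k (ks ! i) = 0 then L (delete_nth i ks) else 0)) =
            (\<Sum>i<length ks. if ks ! i = k then real k * L (delete_nth i ks) else 0)"
          by (intro sum.cong) (auto simp: nat_dist_def)
        finally show "(\<lambda>n. y n l) \<longlonglongrightarrow> L l" using rec[OF nd k(1,2)] by (simp add: kk)
      next
        show "\<forall>\<^sub>F n in sequentially. \<forall>l\<in>pos_lists d.
          \<bar>tr_mom \<mu> n l - y n l\<bar> \<le> \<epsilon> n * (\<Sum>j\<in>pos_lists d. \<bar>tr_mom \<mu> n j\<bar>)"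
          using eventually_gt_at_top[of 0]
        proof (eventually_elim, intro ballI)
          fix n l assume n: "n > (0::nat)" and l: "l \<in> pos_lists d"
          then obtain k ks where kk: "l = k # ks" using False by (cases l) (auto simp: pos_lists_def)
          have k: "k \<ge> 1" "\<forall>k\<in>set ks. k \<ge> 1" "k + sum_list ks = d" using l kk by (auto simp: pos_lists_def)
          define S where "S = (\<Sum>j\<in>pos_lists d. \<bar>tr_mom \<mu> n j\<bar>)"
          have S: "\<bar>tr_mom \<mu> n j\<bar> \<le> S" if "j \<in> pos_lists d" for j
            unfolding S_def using that finite_pos_lists
            by (intro member_le_sum[of j _ "\<lambda>j. \<bar>tr_mom \<mu> n j\<bar>"]) auto
          have S0: "S \<ge> 0" unfolding S_def by (simp add: sum_nonneg)
          define A where "A = (\<Sum>j=1..<k. tr_mom \<mu> n (j # (k - j) # ks))"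
          define B where "B = (\<Sum>i<length ks. real (ks ! i) * tr_mom \<mu> n ((k + ks ! i) # delete_nth i ks))"
          have "\<bar>A\<bar> \<le> (\<Sum>j=1..<k. S)"
            unfolding A_def using k
            by (intro order.trans[OF sum_abs] sum_mono S) (auto simp: pos_lists_def)
          also have "\<dots> \<le> real d * S" using k S0 by (auto intro!: mult_right_mono)
          finally have A: "\<bar>A\<bar> \<le> real d * S" .
          have "\<bar>B\<bar> \<le> (\<Sum>i<length ks. real (ks ! i) * S)"
            unfolding B_def
          proof (intro order.trans[OF sum_abs] sum_mono)
            fix i assume "i \<in> {..<length ks}"
            then have i: "i < length ks" by simp
            have "(k + ks ! i) # delete_nth i ks \<in> pos_lists d"
              using k sum_list_delete_nth[OF i] set_delete_nth[of i ks] by (auto simp: pos_lists_def)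
            from S[OF this] show "\<bar>real (ks ! i) * tr_mom \<mu> n ((k + ks ! i) # delete_nth i ks)\<bar> \<le> real (ks ! i) * S"
              by (simp add: abs_mult mult_left_mono)
          qed
          also have "\<dots> = real (sum_list ks) * S"
            by (simp add: sum_list_sum_nth sum_distrib_right atLeast0LessThan)
          also have "\<dots> \<le> real d * S" using k S0 by (intro mult_right_mono) auto
          finally have B: "\<bar>B\<bar> \<le> real d * S" .
          have "real n * (tr_mom \<mu> n l - y n l) = tr_mom \<mu> n l - A - B"
            using loop_equation_solved[where \<mu> = \<mu>, OF H k(1), of n ks] n
            unfolding y_def kk list.case right_diff_distrib distrib_left sum_distrib_left A_def B_def
            by (simp add: mult.left_commute)
          then have "\<bar>real n * (tr_mom \<mu> n l - y n l)\<bar> \<le> (2 * real d + 1) * S"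
            using A B S[OF l] by (simp add: algebra_simps)
          then have "real n * \<bar>tr_mom \<mu> n l - y n l\<bar> \<le> (2 * real d + 1) * S"
            unfolding abs_mult by simp
          then show "\<bar>tr_mom \<mu> n l - y n l\<bar> \<le> \<epsilon> n * (\<Sum>j\<in>pos_lists d. \<bar>tr_mom \<mu> n j\<bar>)"
            using n by (simp add: \<epsilon>_def S_def[symmetric] field_simps)
        qed
      qed
    qed
  qed
  from this[of ks "sum_list ks"] show ?thesis using ks by (simp add: L_def pos_lists_def)
qed

section \<open>Moments of the semicircle law\<close>

definition sc_int :: "nat \<Rightarrow> real" where
  "sc_int p = integral {-2..2} (\<lambda>t. t ^ p * sqrt (4 - t\<^sup>2))"

lemma sc_integrable: "(\<lambda>t::real. t ^ p * sqrt (4 - t\<^sup>2)) integrable_on {-2..2}"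
  by (intro integrable_continuous_real continuous_intros)

lemma semicircle_window_pos: "t \<in> {-2<..<2} \<Longrightarrow> 4 - t\<^sup>2 > 0" for t :: real
  using abs_square_less_1[of "t/2"] by (auto simp: power_divide)

lemma sc_int_0: "sc_int 0 = 2 * pi"
proof -
  have "((\<lambda>t. sqrt (4 - t\<^sup>2)) has_integral
      ((2 * sqrt (4 - 2\<^sup>2) / 2 + 2 * arcsin (2 / 2)) - (-2 * sqrt (4 - (-2)\<^sup>2) / 2 + 2 * arcsin (-2 / 2)))) {-2..2::real}"
  \<comment> \<open>Both summands of the primitive have infinite slope at the ends, so the
    derivative is computed in the interior only.\<close>
  proof (rule fundamental_theorem_of_calculus_interior)
    show "continuous_on {-2..2} (\<lambda>t::real. t * sqrt (4 - t\<^sup>2) / 2 + 2 * arcsin (t / 2))"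
      by (intro continuous_intros) auto
    fix t :: real assume t: "t \<in> {-2<..<2}"
    note w = semicircle_window_pos[OF t]
    have e: "sqrt (1 - (t/2)\<^sup>2) = sqrt (4 - t\<^sup>2) / 2"
    proof -
      have "1 - (t/2)\<^sup>2 = (4 - t\<^sup>2) / 2\<^sup>2" by (simp add: power_divide)
      then show ?thesis using w by (simp only: real_sqrt_divide real_sqrt_abs abs_numeral)
    qed
    have sq: "sqrt (4 - t\<^sup>2) * sqrt (4 - t\<^sup>2) = 4 - t\<^sup>2" using w by simp
    have "((\<lambda>t. t * sqrt (4 - t\<^sup>2) / 2 + 2 * arcsin (t / 2)) has_real_derivative
        (sqrt (4 - t\<^sup>2) + t * (inverse (sqrt (4 - t\<^sup>2)) / 2 * (- (2 * t)))) / 2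
          + 2 * (inverse (sqrt (1 - (t/2)\<^sup>2)) * (1/2))) (at t)"
      using t w by (auto intro!: derivative_eq_intros simp: power2_eq_square)
    also have "(sqrt (4 - t\<^sup>2) + t * (inverse (sqrt (4 - t\<^sup>2)) / 2 * (- (2 * t)))) / 2
          + 2 * (inverse (sqrt (1 - (t/2)\<^sup>2)) * (1/2)) = sqrt (4 - t\<^sup>2)"
      unfolding e using w sq by (simp add: field_simps power2_eq_square)
    finally show "((\<lambda>t. t * sqrt (4 - t\<^sup>2) / 2 + 2 * arcsin (t / 2)) has_vector_derivative sqrt (4 - t\<^sup>2)) (at t)"
      by (simp add: has_real_derivative_iff_has_vector_derivative)
  qed simp
  then have "((\<lambda>t. sqrt (4 - t\<^sup>2)) has_integral 2 * pi) {-2..2::real}" by simp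
  then show ?thesis unfolding sc_int_def by (simp add: integral_unique)
qed

text \<open>The power 3/2 of \<open>4 - t\<^sup>2\<close> vanishes at both ends, so derivatives of
  its products with monomials integrate to relations between moments without boundary terms.\<close>

lemma sc_deriv:
  fixes t :: real assumes t: "t \<in> {-2<..<2}"
  shows "((\<lambda>t. (4 - t\<^sup>2) * sqrt (4 - t\<^sup>2)) has_real_derivative - 3 * t * sqrt (4 - t\<^sup>2)) (at t)"
proof -
  note w = semicircle_window_pos[OF t]
  have q: "(4 - t\<^sup>2) * inverse (sqrt (4 - t\<^sup>2)) = sqrt (4 - t\<^sup>2)"
    using real_div_sqrt[of "4 - t\<^sup>2"] w by (simp add: divide_inverse)
  have "((\<lambda>t. (4 - t\<^sup>2) * sqrt (4 - t\<^sup>2)) has_real_derivative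
      - (2 * t) * sqrt (4 - t\<^sup>2) + (4 - t\<^sup>2) * (inverse (sqrt (4 - t\<^sup>2)) / 2 * (- (2 * t)))) (at t)"
    using w by (auto intro!: derivative_eq_intros)
  also have "- (2 * t) * sqrt (4 - t\<^sup>2) + (4 - t\<^sup>2) * (inverse (sqrt (4 - t\<^sup>2)) / 2 * (- (2 * t))) = - 3 * t * sqrt (4 - t\<^sup>2)"
    using q by (simp add: mult.assoc[symmetric])
  finally show ?thesis .
qed

lemma sc_int_1: "sc_int 1 = 0"
proof -
  have "((\<lambda>t. - 3 * t * sqrt (4 - t\<^sup>2)) has_integral
      ((4 - 2\<^sup>2) * sqrt (4 - 2\<^sup>2) - (4 - (-2)\<^sup>2) * sqrt (4 - (-2)\<^sup>2))) {-2..2::real}"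
    by (rule fundamental_theorem_of_calculus_interior)
      (auto intro!: continuous_intros sc_deriv[simplified] simp: has_real_derivative_iff_has_vector_derivative[symmetric])
  then have "((\<lambda>t. - 3 * t * sqrt (4 - t\<^sup>2)) has_integral 0) {-2..2::real}" by simp
  from has_integral_mult_right[OF this, of "-1/3"]
  have "((\<lambda>t. t ^ 1 * sqrt (4 - t\<^sup>2)) has_integral 0) {-2..2::real}" by simp
  then show ?thesis unfolding sc_int_def by (rule integral_unique)
qed

text \<open>Integrate the derivative of \<open>t ^ (p + 1)\<close> times the power 3/2 of
  \<open>4 - t\<^sup>2\<close>. For even \<open>p\<close> this is the two-term recursion of the
  Catalan numbers.\<close>

lemma sc_int_rec: "real (p + 4) * sc_int (p + 2) = 4 * real (p + 1) * sc_int p"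
proof -
  let ?F = "\<lambda>t::real. t ^ (p + 1) * ((4 - t\<^sup>2) * sqrt (4 - t\<^sup>2))"
  let ?f = "\<lambda>t::real. 4 * real (p + 1) * (t ^ p * sqrt (4 - t\<^sup>2)) - real (p + 4) * (t ^ (p + 2) * sqrt (4 - t\<^sup>2))"
  have "(?f has_integral (?F 2 - ?F (-2))) {-2..2::real}"
  proof (rule fundamental_theorem_of_calculus_interior)
    show "continuous_on {-2..2} ?F" by (intro continuous_intros)
    fix t :: real assume t: "t \<in> {-2<..<2}"
    have "(?F has_real_derivative
        (real (p + 1) * t ^ p) * ((4 - t\<^sup>2) * sqrt (4 - t\<^sup>2)) + t ^ (p + 1) * (- 3 * t * sqrt (4 - t\<^sup>2))) (at t)"
      using DERIV_mult[OF DERIV_pow[of "p + 1" t] sc_deriv[OF t]] by (simp add: algebra_simps)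
    also have "(real (p + 1) * t ^ p) * ((4 - t\<^sup>2) * sqrt (4 - t\<^sup>2)) + t ^ (p + 1) * (- 3 * t * sqrt (4 - t\<^sup>2)) = ?f t"
      by (simp add: algebra_simps power2_eq_square)
    finally show "(?F has_vector_derivative ?f t) (at t)"
      by (simp add: has_real_derivative_iff_has_vector_derivative)
  qed simp
  then have 1: "integral {-2..2} ?f = 0" by (intro integral_unique) simp
  have "integral {-2..2} ?f = 4 * real (p + 1) * sc_int p - real (p + 4) * sc_int (p + 2)"
    unfolding sc_int_def using sc_integrable[of p] sc_integrable[of "p + 2"]
    by (subst Henstock_Kurzweil_Integration.integral_diff) (auto simp: integrable_on_cmult_left)
  with 1 show ?thesis by simp
qed

definition sc_mom :: "nat \<Rightarrow> real" where
  "sc_mom p = sc_int p / (2 * pi)"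

lemma sc_mom_0: "sc_mom 0 = 1" and sc_mom_1: "sc_mom (Suc 0) = 0"
  and sc_mom_rec: "real (p + 4) * sc_mom (p + 2) = 4 * real (p + 1) * sc_mom p"
  using sc_int_0 sc_int_1 sc_int_rec[of p] by (simp_all add: sc_mom_def)

text \<open>Reversing the sum replaces the weight \<open>i\<close> by \<open>p - i\<close>, and the
  two weights add up to \<open>p\<close>.\<close>

lemma sum_index_symmetric:
  fixes c :: "nat \<Rightarrow> real"
  shows "2 * (\<Sum>i\<le>p. real i * (c i * c (p - i))) = real p * (\<Sum>i\<le>p. c i * c (p - i))"
proof -
  have "(\<Sum>i\<le>p. real i * (c i * c (p - i))) = (\<Sum>i\<le>p. real (p - i) * (c (p - i) * c (p - (p - i))))"
    by (rule sum.nat_diff_reindex[symmetric, of _ "Suc p", simplified lessThan_Suc_atMost, simplified])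
  also have "\<dots> = (\<Sum>i\<le>p. real (p - i) * (c i * c (p - i)))"
    by (intro sum.cong) (auto simp: mult.commute)
  finally have "2 * (\<Sum>i\<le>p. real i * (c i * c (p - i))) =
     (\<Sum>i\<le>p. real i * (c i * c (p - i)) + real (p - i) * (c i * c (p - i)))"
    by (simp add: sum.distrib)
  also have "\<dots> = (\<Sum>i\<le>p. real p * (c i * c (p - i)))"
    by (intro sum.cong) (auto simp: of_nat_diff algebra_simps)
  finally show ?thesis by (simp add: sum_distrib_left)
qed

text \<open>Catalan convolution: symmetrising \<open>i\<close> against \<open>p - i\<close> turns the two-term recursion for the moments
  into the same two-term recursion for the convolution.\<close>

lemma sc_mom_convolution: "sc_mom (p + 2) = (\<Sum>i\<le>p. sc_mom i * sc_mom (p - i))"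
proof (induction p rule: less_induct)
  case (less p)
  let ?c = sc_mom
  define S where "S p = (\<Sum>i\<le>p. ?c i * ?c (p - i))" for p
  have "(real p + 4) * S p = 2 * (\<Sum>i\<le>p. real i * (?c i * ?c (p - i))) + 4 * S p"
    unfolding sum_index_symmetric S_def by (simp add: algebra_simps)
  also have "\<dots> = 2 * (\<Sum>i\<le>p. (real i + 2) * (?c i * ?c (p - i)))"
    unfolding S_def by (simp add: sum.distrib sum_distrib_left algebra_simps)
  finally have A: "(real p + 4) * S p = 2 * (\<Sum>i\<le>p. (real i + 2) * (?c i * ?c (p - i)))" .
  have B: "(\<Sum>i\<le>p. (real i + 2) * (?c i * ?c (p - i))) = 2 * real (p + 1) * ?c p"
  proof (cases "p \<ge> 2")
    case False
    then have "p = 0 \<or> p = 1" by auto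
    then show ?thesis by (auto simp: sc_mom_0 sc_mom_1)
  next
    case True
    then obtain q where q: "p = q + 2" by (metis add.commute le_Suc_ex)
    have "(\<Sum>i\<le>p. (real i + 2) * (?c i * ?c (p - i))) =
        2 * ?c p + (\<Sum>i\<le>q. (real (i + 2) + 2) * (?c (i + 2) * ?c (q - i)))"
      unfolding q by (simp add: sum.atMost_Suc_shift sc_mom_0 sc_mom_1 del: sum.atMost_Suc)
    also have "(\<Sum>i\<le>q. (real (i + 2) + 2) * (?c (i + 2) * ?c (q - i))) =
        (\<Sum>i\<le>q. (4 * (real i + 1)) * (?c i * ?c (q - i)))"
    proof (intro sum.cong refl)
      fix i
      have "(real (i + 2) + 2) * ?c (i + 2) = 4 * (real i + 1) * ?c i" using sc_mom_rec[of i] by (simp add: algebra_simps)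
      then show "(real (i + 2) + 2) * (?c (i + 2) * ?c (q - i)) = (4 * (real i + 1)) * (?c i * ?c (q - i))"
        by (metis mult.assoc)
    qed
    also have "\<dots> = 2 * (2 * (\<Sum>i\<le>q. real i * (?c i * ?c (q - i)))) + 4 * S q"
      by (simp add: S_def sum.distrib sum_distrib_left algebra_simps)
    also have "\<dots> = (2 * real q + 4) * S q"
      unfolding sum_index_symmetric by (simp add: S_def algebra_simps)
    also have "S q = ?c p" using less[of q] q by (simp add: S_def)
    finally show ?thesis using q by (simp add: algebra_simps)
  qed
  have "(real p + 4) * S p = (real p + 4) * ?c (p + 2)"
    unfolding A B using sc_mom_rec[of p] by simp
  moreover have "real p + 4 \<noteq> 0" by linarith
  ultimately have "S p = ?c (p + 2)" by (metis mult_left_cancel)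
  then show ?case by (simp add: S_def)
qed

section \<open>Integrals against the semicircle law\<close>

lemma semicircle_density_shift: "semicircle_density m v (t + m) = semicircle_density 0 v t"
  by (simp add: semicircle_density_def)

lemma semicircle_density_measurable [measurable]: "semicircle_density m v \<in> borel_measurable borel"
  unfolding semicircle_density_def[abs_def] by measurable

lemma semicircle_density_nonneg:
  assumes "0 \<le> v" shows "0 \<le> semicircle_density m v t"
proof -
  have "(t - m)\<^sup>2 \<le> 4 * v" if "\<bar>t - m\<bar> \<le> 2 * sqrt v"
  proof -
    have "\<bar>t - m\<bar>\<^sup>2 \<le> (2 * sqrt v)\<^sup>2" using that by (intro power_mono) auto
    then show ?thesis using assms by (simp add: power_mult_distrib)
  qed
  then show ?thesis using assms by (auto simp: semicircle_density_def)
qed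

lemma semicircle_law_integrable:
  fixes f :: "real \<Rightarrow> real"
  assumes "continuous_on UNIV f"
  shows "integrable (semicircle_law m 1) f"
proof -
  have [measurable]: "f \<in> borel_measurable borel"
    using assms by (rule borel_measurable_continuous_onI)
  have "set_integrable lborel {m - 2..m + 2} (\<lambda>t. sqrt (4 - (t - m)\<^sup>2) / (2 * pi) * f t)"
    by (rule borel_integrable_atLeastAtMost')
      (intro continuous_intros continuous_on_subset[OF assms]; simp)
  then have "integrable lborel (\<lambda>t. indicator {m - 2..m + 2} t *\<^sub>R (sqrt (4 - (t - m)\<^sup>2) / (2 * pi) * f t))"
    by (simp add: set_integrable_def)
  also have "(\<lambda>t. indicator {m - 2..m + 2} t *\<^sub>R (sqrt (4 - (t - m)\<^sup>2) / (2 * pi) * f t))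
      = (\<lambda>t. semicircle_density m 1 t *\<^sub>R f t)"
    by (auto simp: fun_eq_iff semicircle_density_def abs_le_iff split: split_indicator)
  finally show ?thesis
    unfolding semicircle_law_def by (subst integrable_density) (auto simp: semicircle_density_nonneg)
qed

text \<open>Translation invariance of Lebesgue measure; it reduces the law of mean 1 to the centred
  one.\<close>

lemma semicircle_law_integral:
  fixes f :: "real \<Rightarrow> real"
  assumes f: "f \<in> borel_measurable borel"
  shows "(\<integral>t. f t \<partial>semicircle_law m 1) = (\<integral>t. f (t + m) \<partial>semicircle_law 0 1)"
proof -
  note [measurable] = f
  have *: "(\<integral>t. g t \<partial>semicircle_law m 1) = (\<integral>t. semicircle_density m 1 t *\<^sub>R g t \<partial>lborel)"
    if [measurable]: "g \<in> borel_measurable borel" for g :: "real \<Rightarrow> real" and m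
    unfolding semicircle_law_def by (subst integral_density) (auto simp: semicircle_density_nonneg)
  have "(\<integral>t. f t \<partial>semicircle_law m 1) = (\<integral>t. semicircle_density m 1 (m + 1 * t) *\<^sub>R f (m + 1 * t) \<partial>lborel)"
    unfolding *[OF f] by (subst lborel_integral_real_affine[of 1 _ m]) auto
  also have "\<dots> = (\<integral>t. semicircle_density 0 1 t *\<^sub>R f (t + m) \<partial>lborel)"
    using semicircle_density_shift[of m 1] by (simp add: add.commute)
  also have "\<dots> = (\<integral>t. f (t + m) \<partial>semicircle_law 0 1)" by (subst *) auto
  finally show ?thesis .
qed

lemma semicircle_law_moment: "(\<integral>t. t ^ p \<partial>semicircle_law 0 1) = sc_mom p"
proof -
  have "(\<integral>t. t ^ p \<partial>semicircle_law 0 1) = (\<integral>t. semicircle_density 0 1 t *\<^sub>R t ^ p \<partial>lborel)"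
    unfolding semicircle_law_def by (subst integral_density) (auto simp: semicircle_density_nonneg)
  also have "\<dots> = (\<integral>t. (indicator {-2..2} t *\<^sub>R (t ^ p * sqrt (4 - t\<^sup>2))) / (2 * pi) \<partial>lborel)"
    by (intro Bochner_Integration.integral_cong)
       (auto simp: semicircle_density_def abs_le_iff split: split_indicator)
  also have "\<dots> = (LINT t:{-2..2}|lborel. t ^ p * sqrt (4 - t\<^sup>2)) / (2 * pi)"
    by (simp add: set_lebesgue_integral_def)
  also have "(LINT t:{-2..2}|lborel. t ^ p * sqrt (4 - t\<^sup>2)) = sc_int p"
    unfolding sc_int_def
    by (intro set_borel_integral_eq_integral borel_integrable_atLeastAtMost' continuous_intros)
  finally show ?thesis by (simp add: sc_mom_def)
qed

section \<open>Schwinger--Dyson equations for free families\<close>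

locale star_ps =
  fixes sm :: "complex \<Rightarrow> 'a::ring_1 \<Rightarrow> 'a" and st :: "'a \<Rightarrow> 'a" and \<phi> :: "'a \<Rightarrow> complex"
  assumes sps: "star_prob_space sm st \<phi>"
begin

lemma sm_add_left: "sm (a + b) x = sm a x + sm b x"
  and sm_1: "sm 1 x = x"
  and sm_mult_left: "sm a x * y = sm a (x * y)"
  and sm_mult_right: "x * sm a y = sm a (x * y)"
  and st_add: "st (x + y) = st x + st y"
  and st_sm: "st (sm a x) = sm (cnj a) (st x)"
  and \<phi>_add: "\<phi> (x + y) = \<phi> x + \<phi> y"
  and \<phi>_sm: "\<phi> (sm a x) = a * \<phi> x"
  and \<phi>_1: "\<phi> 1 = 1"
  using sps unfolding star_prob_space_def by metis+

lemma \<phi>_0: "\<phi> 0 = 0"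
  using \<phi>_add[of 0 0] by simp

lemma sm_0: "sm 0 x = 0"
  using sm_add_left[of 0 0 x] by simp

lemma sm_m1: "sm (-1) x = - x"
  using sm_add_left[of 1 "-1" x] by (simp add: sm_0 sm_1 eq_neg_iff_add_eq_0 add.commute)

lemma \<phi>_diff: "\<phi> (x - y) = \<phi> x - \<phi> y"
  using \<phi>_add[of "x - y" y] by simp

lemma star_alg_diff:
  "a \<in> star_alg sm st x \<Longrightarrow> b \<in> star_alg sm st x \<Longrightarrow> a - b \<in> star_alg sm st x"
  using star_alg.add[OF _ star_alg.smul[of b sm st x "-1"], of a] by (simp add: sm_m1)

text \<open>In \<open>dsum a zs b\<close> every letter of \<open>zs\<close> carries a covariance; the letters are removed one at a time,
  each removal splitting the product \<open>a zs b\<close> into two factors.\<close>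

primrec dsum :: "'a \<Rightarrow> ('a \<times> complex) list \<Rightarrow> 'a \<Rightarrow> complex" where
  "dsum a [] b = 0"
| "dsum a (z # zs) b = snd z * \<phi> a * \<phi> (prod_list (map fst zs) * b) + dsum (a * fst z) zs b"

lemma dsum_add_left: "dsum (a + a') zs b = dsum a zs b + dsum a' zs b"
  by (induction zs arbitrary: a a') (simp_all add: \<phi>_add algebra_simps)

lemma dsum_sm_left: "dsum (sm c a) zs b = c * dsum a zs b"
  by (induction zs arbitrary: a) (simp_all add: \<phi>_sm sm_mult_left algebra_simps)

lemma dsum_add_right: "dsum a zs (b + b') = dsum a zs b + dsum a zs b'"
  by (induction zs arbitrary: a) (simp_all add: \<phi>_add algebra_simps)

lemma dsum_sm_right: "dsum a zs (sm c b) = c * dsum a zs b"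
  by (induction zs arbitrary: a) (simp_all add: \<phi>_sm sm_mult_right algebra_simps)

lemma dsum_diff_left: "dsum (a - a') zs b = dsum a zs b - dsum a' zs b"
  using dsum_add_left[of "a - a'" a' zs b] by simp

lemma dsum_diff_right: "dsum a zs (b - b') = dsum a zs b - dsum a zs b'"
  using dsum_add_right[of a zs "b - b'" b'] by simp

lemma dsum_append:
  "dsum a (xs @ ys) b = dsum a xs (prod_list (map fst ys) * b) + dsum (a * prod_list (map fst xs)) ys b"
  by (induction xs arbitrary: a) (simp_all add: mult.assoc)

lemma dsum_eq_sum:
  "dsum a zs b = (\<Sum>i<length zs. snd (zs ! i) * \<phi> (a * prod_list (map fst (take i zs)))
      * \<phi> (prod_list (map fst (drop (Suc i) zs)) * b))"
proof (induction zs arbitrary: a)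
  case (Cons z zs)
  then show ?case
    by (simp add: sum.lessThan_Suc_shift mult.assoc del: sum.lessThan_Suc)
qed simp

lemma dsum_zero_left:
  assumes "\<And>us vs. zs = us @ vs \<Longrightarrow> \<phi> (a * prod_list (map fst us)) = 0"
  shows "dsum a zs b = 0"
  using assms
proof (induction zs arbitrary: a)
  case (Cons z zs)
  have "\<phi> a = 0" using Cons.prems[of "[]"] by simp
  moreover have "dsum (a * fst z) zs b = 0"
  proof (rule Cons.IH)
    fix us vs assume "zs = us @ vs"
    then show "\<phi> (a * fst z * prod_list (map fst us)) = 0"
      using Cons.prems[of "z # us" vs] by (simp add: mult.assoc)
  qed
  ultimately show ?case by simp
qed simp

lemma dsum_zero_right:
  assumes "\<And>us vs. zs = us @ vs \<Longrightarrow> \<phi> (prod_list (map fst vs) * b) = 0"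
  shows "dsum a zs b = 0"
  using assms
proof (induction zs arbitrary: a)
  case (Cons z zs)
  have "\<phi> (prod_list (map fst zs) * b) = 0" using Cons.prems[of "[z]" zs] by simp
  moreover have "dsum (a * fst z) zs b = 0"
    using Cons.prems by (intro Cons.IH) (metis append_Cons)
  ultimately show ?case by simp
qed simp

lemma dsum_zero_cov: "(\<And>z. z \<in> set zs \<Longrightarrow> snd z = 0) \<Longrightarrow> dsum a zs b = 0"
  by (induction zs arbitrary: a) simp_all

lemma dsum_lin_cov:
  "dsum a (map (\<lambda>l. (f l, \<alpha> * g l + \<beta> * g' l)) w) b =
    \<alpha> * dsum a (map (\<lambda>l. (f l, g l)) w) b + \<beta> * dsum a (map (\<lambda>l. (f l, g' l)) w) b"
  by (induction w arbitrary: a) (simp_all add: algebra_simps comp_def)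

section \<open>The Schwinger--Dyson relation under affine changes of letters\<close>

text \<open>The free analogue of Gaussian integration by parts: contracting \<open>s\<close> with a
  letter costs their covariance and cuts the word at that letter. Storing the covariance beside the
  letter makes the relation linear in each such pair.\<close>

definition SD :: "'a \<Rightarrow> ('a \<times> complex) list \<Rightarrow> bool" where
  "SD s zs \<longleftrightarrow> \<phi> (s * prod_list (map fst zs)) = dsum 1 zs 1"

lemma SD_middle:
  "SD s (A @ (z,k) # B) \<longleftrightarrow>
    \<phi> (s * (prod_list (map fst A) * (z * prod_list (map fst B)))) =
      dsum 1 A (z * prod_list (map fst B)) + k * \<phi> (prod_list (map fst A)) * \<phi> (prod_list (map fst B))
      + dsum (prod_list (map fst A) * z) B 1"
  by (simp add: SD_def dsum_append add.assoc)

inductive_set affine_letters :: "('a \<times> complex) set \<Rightarrow> ('a \<times> complex) set" for B where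
  base: "p \<in> B \<Longrightarrow> p \<in> affine_letters B"
| one: "(1, 0) \<in> affine_letters B"
| add: "(z,k) \<in> affine_letters B \<Longrightarrow> (z',k') \<in> affine_letters B \<Longrightarrow> (z + z', k + k') \<in> affine_letters B"
| scale: "(z,k) \<in> affine_letters B \<Longrightarrow> (sm c z, c * k) \<in> affine_letters B"

text \<open>Both sides are linear in each letter taken together with its covariance, and the letter
  1 with covariance 0 can be erased. Letters are treated from left to right: the prefix
  \<open>A\<close> consists of base letters, and a treated letter either joins it or
  disappears.\<close>

lemma SD_affine_letters:
  assumes base: "\<And>zs. set zs \<subseteq> B \<Longrightarrow> SD s zs"
    and "set zs \<subseteq> affine_letters B"
  shows "SD s zs"
proof -
  have "SD s (A @ zs)" if "set A \<subseteq> B" for A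
    using that assms(2)
  proof (induction zs arbitrary: A)
    case Nil then show ?case using base by simp
  next
    case (Cons p zs)
    have IH: "\<And>A. set A \<subseteq> B \<Longrightarrow> SD s (A @ zs)" using Cons by simp
    have "p \<in> affine_letters B" using Cons.prems by simp
    then show ?case
    proof (induction rule: affine_letters.induct)
      case (base p)
      then show ?case using IH[of "A @ [p]"] Cons.prems(1) by simp
    next
      case one
      then show ?case using IH[of A] Cons.prems(1)
        unfolding SD_middle by (simp add: SD_def dsum_append add.assoc)
    next
      case (add z k z' k')
      then show ?case unfolding SD_middle
        by (simp add: distrib_left distrib_right \<phi>_add dsum_add_left dsum_add_right)
    next
      case (scale z k c)
      then show ?case unfolding SD_middle
        by (simp add: sm_mult_left sm_mult_right \<phi>_sm dsum_sm_left dsum_sm_right algebra_simps)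
    qed
  qed
  from this[of "[]"] show ?thesis by simp
qed

lemma star_free_prod:
  assumes "star_free sm st \<phi> I x" "ps \<noteq> []"
    and "\<And>i a. (i,a) \<in> set ps \<Longrightarrow> i \<in> I \<and> a \<in> star_alg sm st (x i) \<and> \<phi> a = 0"
    and "distinct_adj (map fst ps)"
  shows "\<phi> (prod_list (map snd ps)) = 0"
proof -
  have "\<forall>j. Suc j < length ps \<longrightarrow> fst (ps ! j) \<noteq> fst (ps ! Suc j)"
    using assms(4) by (simp add: distinct_adj_conv_nth)
  then show ?thesis using assms(1-3) unfolding star_free_def by blast
qed

end

section \<open>Propagation of the equation through freeness\<close>

text \<open>Each letter \<open>l\<close> has a colour \<open>col l\<close>, which names its free
  subalgebra, a mean \<open>m l\<close> and covariances \<open>\<kappa> l\<close>. The equation is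
  assumed for words of a single colour only. The locale is instantiated with the two semicirculars
  inside a circular element and with the whole limiting family.\<close>

locale free_letters = star_ps sm st \<phi>
  for sm :: "complex \<Rightarrow> 'a::ring_1 \<Rightarrow> 'a" and st \<phi> +
  fixes I :: "'i set" and x :: "'i \<Rightarrow> 'a" and L :: "'l set" and col :: "'l \<Rightarrow> 'i" and y :: "'l \<Rightarrow> 'a"
    and \<kappa> :: "'l \<Rightarrow> 'l \<Rightarrow> complex" and m :: "'l \<Rightarrow> complex"
  assumes free: "star_free sm st \<phi> I x"
    and col: "l \<in> L \<Longrightarrow> col l \<in> I"
    and y_alg: "l \<in> L \<Longrightarrow> y l \<in> star_alg sm st (x (col l))"
    and \<kappa>_zero: "l \<in> L \<Longrightarrow> l' \<in> L \<Longrightarrow> col l \<noteq> col l' \<Longrightarrow> \<kappa> l l' = 0"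
    and mono_SD: "l \<in> L \<Longrightarrow> set w \<subseteq> L \<Longrightarrow> (\<And>l'. l' \<in> set w \<Longrightarrow> col l' = col l) \<Longrightarrow>
      \<phi> (y l * prod_list (map y w)) =
        m l * \<phi> (prod_list (map y w)) + dsum 1 (map (\<lambda>l'. (y l', \<kappa> l l')) w) 1"
begin

definition ev :: "'l list \<Rightarrow> 'a" where
  "ev w = prod_list (map y w)"

lemma ev_simps [simp]: "ev [] = 1" "ev (l # w) = y l * ev w" "ev (v @ w) = ev v * ev w"
  by (simp_all add: ev_def)

definition tag :: "'l \<Rightarrow> 'l list \<Rightarrow> ('a \<times> complex) list" where
  "tag l w = map (\<lambda>l'. (y l', \<kappa> l l')) w"

lemma tag_simps [simp]: "tag l (v @ w) = tag l v @ tag l w" "prod_list (map fst (tag l w)) = ev w"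
  by (simp_all add: tag_def ev_def comp_def)

lemma tag_split: "tag l w = us @ vs \<Longrightarrow> \<exists>u v. w = u @ v \<and> us = tag l u \<and> vs = tag l v"
  by (auto simp: tag_def map_eq_append_conv)

definition cen :: "'l list \<Rightarrow> 'a" where
  "cen w = ev w - sm (\<phi> (ev w)) 1"

definition cprod :: "'l list list \<Rightarrow> 'a" where
  "cprod ws = prod_list (map cen ws)"

lemma cprod_simps [simp]: "cprod [] = 1" "cprod (w # ws) = cen w * cprod ws" "cprod (us @ ws) = cprod us * cprod ws"
  by (simp_all add: cprod_def)

text \<open>Continues \<open>dsum\<close> into the centred words. The constant subtracted in
  \<open>cen w\<close> contains no letter, so letters are removed from \<open>cen w\<close> just as
  from \<open>w\<close>.\<close>

primrec cdsum :: "'l \<Rightarrow> 'a \<Rightarrow> 'l list list \<Rightarrow> complex" where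
  "cdsum l a [] = 0"
| "cdsum l a (w # ws) = dsum a (tag l w) (cprod ws) + cdsum l (a * cen w) ws"

lemma cdsum_diff: "cdsum l (a - a') ws = cdsum l a ws - cdsum l a' ws"
  by (induction ws arbitrary: a a') (simp_all add: dsum_diff_left left_diff_distrib)

lemma cdsum_sm: "cdsum l (sm c a) ws = c * cdsum l a ws"
  by (induction ws arbitrary: a) (simp_all add: dsum_sm_left sm_mult_left distrib_left)

text \<open>The defect of the Schwinger--Dyson equation, extended to products in which the words \<open>ws\<close> are centred.\<close>

definition defect :: "'l \<Rightarrow> 'l list \<Rightarrow> 'l list list \<Rightarrow> complex" where
  "defect l v ws = \<phi> (y l * (ev v * cprod ws)) - m l * \<phi> (ev v * cprod ws)
      - dsum 1 (tag l v) (cprod ws) - cdsum l (ev v) ws"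

text \<open>Every term of the defect is linear in the first centred word, and centring subtracts a
  multiple of the empty word. A centred word is thus traded for the plain word and for no
  word.\<close>

lemma defect_Cons: "defect l v (w # ws) = defect l (v @ w) ws - \<phi> (ev w) * defect l v ws"
proof -
  have 1: "cen w * z = ev w * z - sm (\<phi> (ev w)) z" for z
    by (simp add: cen_def left_diff_distrib sm_mult_left)
  have 2: "z * cen w = z * ev w - sm (\<phi> (ev w)) z" for z
    by (simp add: cen_def right_diff_distrib sm_mult_right)
  show ?thesis
    unfolding defect_def
    by (simp add: 1 2 right_diff_distrib \<phi>_diff sm_mult_right \<phi>_sm dsum_diff_right dsum_sm_right
        cdsum_diff cdsum_sm dsum_append mult.assoc)
qed

definition wcol :: "'l list \<Rightarrow> 'i" where
  "wcol w = col (hd w)"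

definition mono_word :: "'l list \<Rightarrow> bool" where
  "mono_word w \<longleftrightarrow> w \<noteq> [] \<and> set w \<subseteq> L \<and> (\<forall>l\<in>set w. wcol w = col l)"

definition runs :: "'l list list \<Rightarrow> bool" where
  "runs ws \<longleftrightarrow> (\<forall>w\<in>set ws. mono_word w) \<and> distinct_adj (map wcol ws)"

lemma runs_exist: "set u \<subseteq> L \<Longrightarrow> \<exists>ws. concat ws = u \<and> runs ws"
proof (induction u)
  case Nil then show ?case by (intro exI[of _ "[]"]) (simp add: runs_def)
next
  case (Cons a u)
  then obtain ws where ws: "concat ws = u" "runs ws" by auto
  show ?case
  proof (cases ws)
    case Nil
    then show ?thesis using ws Cons.prems
      by (intro exI[of _ "[[a]]"]) (auto simp: runs_def mono_word_def wcol_def)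
  next
    case (Cons w ws')
    show ?thesis
    proof (cases "wcol w = col a")
      case True
      have "runs ((a # w) # ws')" using ws(2) Cons True \<open>set (a # u) \<subseteq> L\<close>
        by (cases ws') (auto simp: runs_def mono_word_def wcol_def)
      then show ?thesis using ws Cons by (intro exI[of _ "(a # w) # ws'"]) auto
    next
      case False
      then have "runs ([a] # w # ws')" using ws(2) Cons \<open>set (a # u) \<subseteq> L\<close>
        by (auto simp: runs_def mono_word_def wcol_def)
      then show ?thesis using ws Cons by (intro exI[of _ "[a] # w # ws'"]) auto
    qed
  qed
qed

lemma ev_alg: "set w \<subseteq> L \<Longrightarrow> \<forall>l\<in>set w. col l = c \<Longrightarrow> ev w \<in> star_alg sm st (x c)"
  by (induction w) (auto intro!: star_alg.one star_alg.mult dest: y_alg)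

lemma cen_alg:
  assumes "mono_word w"
  shows "cen w \<in> star_alg sm st (x (wcol w))" "wcol w \<in> I" "\<phi> (cen w) = 0"
proof -
  show "cen w \<in> star_alg sm st (x (wcol w))"
    unfolding cen_def using assms
    by (intro star_alg_diff ev_alg star_alg.smul star_alg.one) (auto simp: mono_word_def)
  show "wcol w \<in> I" using assms col by (cases w) (auto simp: mono_word_def wcol_def)
  show "\<phi> (cen w) = 0" by (simp add: cen_def \<phi>_diff \<phi>_sm \<phi>_1)
qed

definition colored :: "'l list list \<Rightarrow> ('i \<times> 'a) list" where
  "colored ws = map (\<lambda>w. (wcol w, cen w)) ws"

lemma colored_simps: "prod_list (map snd (colored ws)) = cprod ws" "map fst (colored ws) = map wcol ws"
  by (simp_all add: colored_def cprod_def comp_def)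

lemma colored_centered:
  "runs ws \<Longrightarrow> (i,a) \<in> set (colored ws) \<Longrightarrow> i \<in> I \<and> a \<in> star_alg sm st (x i) \<and> \<phi> a = 0"
  by (auto simp: colored_def runs_def cen_alg)

lemma phi_cprod: "runs ws \<Longrightarrow> ws \<noteq> [] \<Longrightarrow> \<phi> (cprod ws) = 0"
  using star_free_prod[OF free, of "colored ws"] colored_centered[of ws]
  by (simp add: colored_simps runs_def) (simp add: colored_def)

lemma centre: "a \<in> star_alg sm st z \<Longrightarrow> a - sm (\<phi> a) 1 \<in> star_alg sm st z \<and> \<phi> (a - sm (\<phi> a) 1) = 0"
  by (auto intro!: star_alg_diff star_alg.smul star_alg.one simp: \<phi>_diff \<phi>_sm \<phi>_1)

text \<open>Split \<open>a\<close> into its centred part and a scalar. Freeness kills both products,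
  the second one because \<open>ws\<close> is nonempty.\<close>

lemma phi_alg_cprod:
  assumes "runs ws" "ws \<noteq> []" "wcol (hd ws) \<noteq> c" "c \<in> I" "a \<in> star_alg sm st (x c)"
  shows "\<phi> (a * cprod ws) = 0"
proof -
  let ?a = "a - sm (\<phi> a) 1"
  have "\<phi> (prod_list (map snd ((c,?a) # colored ws))) = 0"
    using assms centre[OF assms(5)] colored_centered[OF assms(1)]
    by (intro star_free_prod[OF free]) (auto simp: runs_def colored_simps distinct_adj_Cons hd_map)
  then have "\<phi> (?a * cprod ws) = 0" by (simp add: colored_simps)
  then show ?thesis using phi_cprod[OF assms(1,2)] by (simp add: left_diff_distrib \<phi>_diff sm_mult_left \<phi>_sm)
qed

lemma phi_cprod_alg:
  assumes "runs ws" "ws \<noteq> []" "wcol (last ws) \<noteq> c" "c \<in> I" "b \<in> star_alg sm st (x c)"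
  shows "\<phi> (cprod ws * b) = 0"
proof -
  let ?b = "b - sm (\<phi> b) 1"
  have "\<phi> (prod_list (map snd (colored ws @ [(c,?b)]))) = 0"
    using assms centre[OF assms(5)] colored_centered[OF assms(1)]
    by (intro star_free_prod[OF free]) (auto simp: runs_def colored_simps distinct_adj_append_iff last_map)
  then have "\<phi> (cprod ws * ?b) = 0" by (simp add: colored_simps)
  then show ?thesis using phi_cprod[OF assms(1,2)] by (simp add: right_diff_distrib \<phi>_diff sm_mult_right \<phi>_sm)
qed

text \<open>Both ends may have the same colour, since the nonempty centred middle keeps the product
  alternating.\<close>

lemma phi_alg_cprod_alg:
  assumes "runs ws" "ws \<noteq> []" "wcol (hd ws) \<noteq> c" "wcol (last ws) \<noteq> c" "c \<in> I"
    "a \<in> star_alg sm st (x c)" "b \<in> star_alg sm st (x c)"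
  shows "\<phi> (a * cprod ws * b) = 0"
proof -
  let ?a = "a - sm (\<phi> a) 1" and ?b = "b - sm (\<phi> b) 1"
  have "\<phi> (prod_list (map snd ((c,?a) # colored ws @ [(c,?b)]))) = 0"
    using assms centre[OF assms(6)] centre[OF assms(7)] colored_centered[OF assms(1)]
    by (intro star_free_prod[OF free])
      (auto simp: runs_def colored_simps distinct_adj_Cons distinct_adj_append_iff last_map hd_append hd_map)
  then have "\<phi> (?a * (cprod ws * ?b)) = 0" by (simp add: colored_simps)
  moreover have "\<phi> (?a * cprod ws) = 0"
    using phi_alg_cprod[OF assms(1-3,5)] centre[OF assms(6)] by blast
  moreover have "\<phi> (cprod ws * b) = 0" by (rule phi_cprod_alg[OF assms(1,2,4,5,7)])
  ultimately show ?thesis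
    by (simp add: left_diff_distrib right_diff_distrib \<phi>_diff sm_mult_left sm_mult_right \<phi>_sm mult.assoc)
qed

lemma runs_appendD: "runs (us @ ws) \<Longrightarrow> runs us \<and> runs ws"
  by (auto simp: runs_def distinct_adj_append_iff)

text \<open>A removed letter of another colour has covariance 0. One of colour \<open>col l\<close>
  sits in a run that is not the first, so the factor to its left consists of \<open>ev v\<close>, a
  centred alternating product whose ends have other colours, and a piece of the run;
  \<open>phi_alg_cprod_alg\<close> makes its state vanish.\<close>

lemma cdsum_runs:
  assumes l: "l \<in> L" and v: "set v \<subseteq> L" "\<forall>l'\<in>set v. col l' = col l"
    and "runs (us @ ws)" "us @ ws \<noteq> [] \<Longrightarrow> wcol (hd (us @ ws)) \<noteq> col l"
  shows "cdsum l (ev v * cprod us) ws = 0"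
  using assms(4,5)
proof (induction ws arbitrary: us)
  case (Cons w ws)
  have "cdsum l (ev v * cprod (us @ [w])) ws = 0"
    using Cons.prems by (intro Cons.IH) auto
  moreover have "dsum (ev v * cprod us) (tag l w) (cprod ws) = 0"
  proof (cases "wcol w = col l")
    case False
    have "mono_word w" using Cons.prems by (simp add: runs_def)
    then show ?thesis using False l
      by (intro dsum_zero_cov) (auto simp: tag_def mono_word_def intro!: \<kappa>_zero)
  next
    case True
    have w: "mono_word w" using Cons.prems by (simp add: runs_def)
    have us: "us \<noteq> []" using Cons.prems True by auto
    have "wcol (last us) \<noteq> wcol w"
      using Cons.prems us by (auto simp: runs_def distinct_adj_append_iff last_map)
    then have last: "wcol (last us) \<noteq> col l" using True by simp
    have hd: "wcol (hd us) \<noteq> col l" using Cons.prems us by simp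
    show ?thesis
    proof (rule dsum_zero_left)
      fix ps qs assume "tag l w = ps @ qs"
      then obtain p q where pq: "w = p @ q" "ps = tag l p" using tag_split by blast
      have "ev p \<in> star_alg sm st (x (col l))"
        using w pq True by (intro ev_alg) (auto simp: mono_word_def, (metis UnI1)+)
      then show "\<phi> (ev v * cprod us * prod_list (map fst ps)) = 0"
        using phi_alg_cprod_alg[OF _ us hd last col[OF l] ev_alg[OF v]] runs_appendD[OF Cons.prems(1)] pq
        by simp
    qed
  qed
  ultimately show ?case by (simp add: mult.assoc)
qed simp

text \<open>All four terms vanish separately. In the first three an element of colour
  \<open>col l\<close> stands to the left of the centred product, which is
  \<open>phi_alg_cprod\<close>; the last one is \<open>cdsum_runs\<close>.\<close>

lemma defect_runs:
  assumes l: "l \<in> L" and v: "set v \<subseteq> L" "\<forall>l'\<in>set v. col l' = col l"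
    and ws: "runs ws" "ws \<noteq> []" "wcol (hd ws) \<noteq> col l"
  shows "defect l v ws = 0"
proof -
  have "\<phi> ((y l * ev v) * cprod ws) = 0" "\<phi> (ev v * cprod ws) = 0"
    using y_alg[OF l] ev_alg[OF v] by (auto intro!: phi_alg_cprod[OF ws col[OF l]] star_alg.mult)
  moreover have "dsum 1 (tag l v) (cprod ws) = 0"
  proof (rule dsum_zero_right)
    fix ps qs assume "tag l v = ps @ qs"
    then obtain p q where pq: "v = p @ q" "qs = tag l q" using tag_split by blast
    have "ev q \<in> star_alg sm st (x (col l))" using v pq by (intro ev_alg) auto
    then show "\<phi> (prod_list (map fst qs) * cprod ws) = 0"
      using phi_alg_cprod[OF ws col[OF l]] pq by simp
  qed
  moreover have "cdsum l (ev v) ws = 0" using cdsum_runs[OF l v, of "[]" ws] ws by simp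
  ultimately show ?thesis by (simp add: defect_def mult.assoc)
qed

text \<open>Undoing all centrings with \<open>defect_Cons\<close> leaves plain words in which some
  of the words of \<open>ws\<close> are kept and the others dropped.\<close>

lemma defect_zero_of_subseqs:
  "(\<And>ss. ss \<in> set (List.subseqs ws) \<Longrightarrow> defect l (v @ concat ss) [] = 0) \<Longrightarrow> defect l v ws = 0"
proof (induction ws arbitrary: v)
  case (Cons w ws)
  have "defect l (v @ w) ws = 0"
  proof (rule Cons.IH)
    fix ss assume "ss \<in> set (List.subseqs ws)"
    then show "defect l ((v @ w) @ concat ss) [] = 0"
      using Cons.prems[of "w # ss"] by (simp add: Let_def)
  qed
  moreover have "defect l v ws = 0"
    using Cons.prems by (intro Cons.IH) (simp add: Let_def)
  ultimately show ?case by (simp add: defect_Cons)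
qed simp

lemma length_concat_subseqs: "ss \<in> set (List.subseqs ws) \<Longrightarrow> length (concat ss) \<le> length (concat ws)"
proof (induction ws arbitrary: ss)
  case (Cons w ws)
  then consider ss' where "ss = w # ss'" "ss' \<in> set (List.subseqs ws)" | "ss \<in> set (List.subseqs ws)"
    by (auto simp: Let_def)
  then show ?case
  proof cases
    case 1 then show ?thesis using Cons.IH[of ss'] by simp
  next
    case 2 then show ?thesis using Cons.IH[of ss] by simp
  qed
qed simp

text \<open>Among the plain words of this expansion only the one that keeps all of \<open>ws\<close>
  has full length. If all shorter ones have defect 0, it inherits the vanishing of the centred
  product.\<close>

lemma defect_concat_zero:
  assumes "defect l v ws = 0" "\<And>w. w \<in> set ws \<Longrightarrow> w \<noteq> []"
    and "\<And>ss. ss \<in> set (List.subseqs ws) \<Longrightarrow> length (concat ss) < length (concat ws) \<Longrightarrow> defect l (v @ concat ss) [] = 0"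
  shows "defect l (v @ concat ws) [] = 0"
  using assms
proof (induction ws arbitrary: v)
  case (Cons w ws)
  have w: "length w > 0" using Cons.prems(2)[of w] by simp
  have "defect l v ws = 0"
  proof (rule defect_zero_of_subseqs)
    fix ss assume ss: "ss \<in> set (List.subseqs ws)"
    then show "defect l (v @ concat ss) [] = 0"
      using Cons.prems(3)[of ss] length_concat_subseqs[OF ss] w by (simp add: Let_def)
  qed
  then have "defect l (v @ w) ws = 0" using Cons.prems(1) by (simp add: defect_Cons)
  then have "defect l ((v @ w) @ concat ws) [] = 0"
  proof (rule Cons.IH)
    fix ss assume "ss \<in> set (List.subseqs ws)" "length (concat ss) < length (concat ws)"
    then show "defect l ((v @ w) @ concat ss) [] = 0"
      using Cons.prems(3)[of "w # ss"] by (simp add: Let_def)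
  qed (use Cons.prems(2) in auto)
  then show ?case by simp
qed simp

lemma set_concat_subseqs: "ss \<in> set (List.subseqs ws) \<Longrightarrow> set (concat ss) \<subseteq> set (concat ws)"
proof (induction ws arbitrary: ss)
  case (Cons w ws)
  then consider ss' where "ss = w # ss'" "ss' \<in> set (List.subseqs ws)" | "ss \<in> set (List.subseqs ws)"
    by (auto simp: Let_def)
  then show ?case
  proof cases
    case 1 then show ?thesis using Cons.IH[of ss'] by auto
  next
    case 2 then show ?thesis using Cons.IH[of ss] by auto
  qed
qed simp

text \<open>\<open>u\<close> is split into a first run \<open>v\<close> of colour
  \<open>col l\<close>, possibly empty, and the further runs \<open>us\<close>. Without further runs
  this is \<open>mono_SD\<close>. Otherwise the centred version holds by freeness, and the plain one
  differs from it by shorter words, which the induction on the length covers.\<close>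

lemma defect_zero: "l \<in> L \<Longrightarrow> set u \<subseteq> L \<Longrightarrow> defect l u [] = 0"
proof (induction "length u" arbitrary: u rule: less_induct)
  case less
  obtain ws where ws: "concat ws = u" "runs ws" using runs_exist[OF less.prems(2)] by blast
  obtain v us where vu: "u = v @ concat us" "runs us" "set v \<subseteq> L" "\<forall>l'\<in>set v. col l' = col l"
    "us \<noteq> [] \<Longrightarrow> wcol (hd us) \<noteq> col l"
  proof (cases "ws \<noteq> [] \<and> wcol (hd ws) = col l")
    case True
    then obtain w ws' where w: "ws = w # ws'" by (cases ws) auto
    show ?thesis
      by (rule that[of w ws'])
        (use ws w True in \<open>auto simp: runs_def mono_word_def distinct_adj_Cons list.map_sel\<close>)
  next
    case False
    then show ?thesis using ws by (intro that[of "[]" ws]) auto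
  qed
  show ?case
  proof (cases "us = []")
    case True
    then show ?thesis
      using mono_SD[OF less.prems(1) vu(3)] vu(1,4) by (auto simp: defect_def ev_def tag_def)
  next
    case False
    have "defect l v us = 0"
      using defect_runs[OF less.prems(1) vu(3,4,2) False] vu(5) False by blast
    then have "defect l (v @ concat us) [] = 0"
    proof (rule defect_concat_zero)
      fix ss assume ss: "ss \<in> set (List.subseqs us)" "length (concat ss) < length (concat us)"
      then show "defect l (v @ concat ss) [] = 0"
        using vu(1) less.prems set_concat_subseqs[OF ss(1)] by (intro less.hyps) auto
    qed (use vu(2) in \<open>auto simp: runs_def mono_word_def\<close>)
    then show ?thesis using vu by simp
  qed
qed

theorem free_SD:
  assumes "l \<in> L" "set w \<subseteq> L"
  shows "\<phi> (y l * prod_list (map y w)) =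
    m l * \<phi> (prod_list (map y w)) + dsum 1 (map (\<lambda>l'. (y l', \<kappa> l l')) w) 1"
  using defect_zero[OF assms] by (simp add: defect_def ev_def tag_def algebra_simps)

end

text \<open>The letter \<open>(k,e)\<close> stands for the trace of \<open>u ^ k\<close>, starred if \<open>e\<close>. The number \<open>nc_mom w\<close> counts
  the noncrossing partitions of the word \<open>w\<close> into pairs of compatible letters and singletons with \<open>k = 2\<close>;
  the singletons account for the mean \<open>1\<close> of \<open>x 2\<close>.\<close>

fun compatible :: "nat \<times> bool \<Rightarrow> nat \<times> bool \<Rightarrow> bool" where
  "compatible (k,e) (k',e') \<longleftrightarrow> k = k' \<and> (k \<le> 2 \<or> e \<noteq> e')"

function nc_mom :: "(nat \<times> bool) list \<Rightarrow> nat" where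
  "nc_mom [] = 1"
| "nc_mom (p # w) = (if fst p = 2 then nc_mom w else 0) +
     (\<Sum>i<length w. if compatible p (w ! i) then nc_mom (take i w) * nc_mom (drop (Suc i) w) else 0)"
  by pat_completeness auto
termination by (relation "Wellfounded.measure length") auto

section \<open>Semicircular and circular variables and the limiting family\<close>

context star_ps
begin

text \<open>For powers of \<open>s\<close> the equation is the Catalan convolution of the
  moments.\<close>

lemma semicircular_SD:
  assumes "semicircular sm st \<phi> 0 1 s"
  shows "SD s (replicate p (s,1))"
proof -
  have mom: "\<phi> (s ^ p) = complex_of_real (sc_mom p)" for p
    using assms by (simp add: semicircular_def semicircle_law_moment)
  have "\<phi> (s ^ Suc p) = (\<Sum>i<p. \<phi> (s ^ i) * \<phi> (s ^ (p - Suc i)))"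
  proof (cases p)
    case 0
    then show ?thesis using mom[of 1] by (simp add: sc_mom_1)
  next
    case (Suc q)
    then show ?thesis
      using sc_mom_convolution[of q] by (simp only: mom) (simp add: lessThan_Suc_atMost)
  qed
  then show ?thesis
    by (simp add: SD_def dsum_eq_sum prod_list_replicate)
qed

text \<open>Mixed moments in \<open>x - 1\<close> and \<open>x\<close> obey the same recursion as
  the integrals of \<open>(t - 1) ^ a * t ^ b\<close>, which replaces a binomial expansion; the law
  is then translated.\<close>

lemma semicircular_shift:
  assumes "semicircular sm st \<phi> 1 1 x"
  shows "semicircular sm st \<phi> 0 1 (x - 1)"
proof -
  have st: "st x = x" and mom: "\<And>p. \<phi> (x ^ p) = complex_of_real (\<integral>t. t ^ p \<partial>semicircle_law 1 1)"
    using assms by (auto simp: semicircular_def)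
  have "st 1 = 1" using sps by (simp add: star_prob_space_def)
  then have st1: "st (x - 1) = x - 1" using st_add[of "x - 1" 1] st by (simp add: algebra_simps)
  have mixed: "\<phi> ((x - 1) ^ a * x ^ b) = complex_of_real (\<integral>t. (t - 1) ^ a * t ^ b \<partial>semicircle_law 1 1)" for a b
  proof (induction a arbitrary: b)
    case 0
    then show ?case using mom by simp
  next
    case (Suc a)
    have int: "integrable (semicircle_law 1 1) (\<lambda>t. (t - 1) ^ a * t ^ b)" for a b
      by (intro semicircle_law_integrable continuous_intros)
    have "(x - 1) ^ Suc a * x ^ b = (x - 1) ^ a * x ^ Suc b - (x - 1) ^ a * x ^ b"
    proof -
      have "(x - 1) ^ Suc a * x ^ b = (x - 1) ^ a * ((x - 1) * x ^ b)"
        by (simp only: power_Suc2 mult.assoc)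
      also have "(x - 1) * x ^ b = x ^ Suc b - x ^ b" by (simp add: left_diff_distrib)
      finally show ?thesis by (simp only: right_diff_distrib)
    qed
    then have "\<phi> ((x - 1) ^ Suc a * x ^ b) = complex_of_real
        ((\<integral>t. (t - 1) ^ a * t ^ Suc b \<partial>semicircle_law 1 1) - (\<integral>t. (t - 1) ^ a * t ^ b \<partial>semicircle_law 1 1))"
      by (simp add: \<phi>_diff Suc del: power_Suc)
    also have "(\<integral>t. (t - 1) ^ a * t ^ Suc b \<partial>semicircle_law 1 1) - (\<integral>t. (t - 1) ^ a * t ^ b \<partial>semicircle_law 1 1)
        = (\<integral>t. (t - 1) ^ a * t ^ Suc b - (t - 1) ^ a * t ^ b \<partial>semicircle_law 1 1)"
      by (rule Bochner_Integration.integral_diff[symmetric]) (rule int)+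
    also have "\<dots> = (\<integral>t. (t - 1) ^ Suc a * t ^ b \<partial>semicircle_law 1 1)"
      by (intro Bochner_Integration.integral_cong) (auto simp: algebra_simps)
    finally show ?case .
  qed
  have "\<phi> ((x - 1) ^ p) = complex_of_real (\<integral>t. t ^ p \<partial>semicircle_law 0 1)" for p
    using mixed[of p 0] semicircle_law_integral[of "\<lambda>t. (t - 1) ^ p" 1] by simp
  with st1 show ?thesis by (simp add: semicircular_def)
qed

text \<open>\<open>x\<close> is a centred semicircular element plus 1, hence an affine letter of
  covariance 1 with \<open>x - 1\<close>. The constant in the first factor gives the mean
  term.\<close>

lemma semicircular_mean_one_SD:
  assumes "semicircular sm st \<phi> 1 1 x"
  shows "\<phi> (x * x ^ p) = \<phi> (x ^ p) + dsum 1 (replicate p (x,1)) 1"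
proof -
  let ?s = "x - 1"
  have "SD ?s zs" if "set zs \<subseteq> {(?s,1)}" for zs
  proof -
    have "zs = replicate (length zs) (?s,1)" using that by (intro replicate_eqI) auto
    then obtain p where "zs = replicate p (?s,1)" by blast
    then show ?thesis using semicircular_SD[OF semicircular_shift[OF assms]] by simp
  qed
  moreover have "(?s + 1, 1 + 0) \<in> affine_letters {(?s,1)}"
    by (rule affine_letters.add[OF affine_letters.base affine_letters.one]) simp
  then have "set (replicate p (x,1)) \<subseteq> affine_letters {(?s,1)}" by auto
  ultimately have "SD ?s (replicate p (x,1))" by (rule SD_affine_letters)
  then have "\<phi> ((x - 1) * x ^ p) = dsum 1 (replicate p (x,1)) 1"
    by (simp add: SD_def prod_list_replicate)
  then have "\<phi> (x * x ^ p) - \<phi> (x ^ p) = dsum 1 (replicate p (x,1)) 1"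
    by (simp only: left_diff_distrib \<phi>_diff mult_1_left)
  then show ?thesis by (simp add: diff_eq_eq add.commute)
qed

text \<open>Freeness gives the equations for \<open>s1\<close> and \<open>s2\<close> on words in
  both; they extend to words in \<open>c\<close> and \<open>st c\<close>, which are affine letters,
  and are combined linearly in the first factor. With \<open>d = \<i>\<close> for \<open>c\<close>
  and \<open>d = - \<i>\<close> for \<open>st c\<close>, two letters have the covariance
  \<open>(1 + d * d') / 2\<close>, which is 0 for equal and 1 for opposite stars.\<close>

lemma circular_SD:
  assumes "circular sm st \<phi> c"
  defines "y \<equiv> \<lambda>e. if e then st c else c"
  shows "\<phi> (y e * prod_list (map y w)) = dsum 1 (map (\<lambda>e'. (y e', if e \<noteq> e' then 1 else 0)) w) 1"
proof -
  define r where "r = complex_of_real (1 / sqrt 2)"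
  have r: "r * r = 1 / 2" by (simp add: r_def flip: of_real_mult)
  have cr: "cnj r = r" by (simp add: r_def)
  obtain s1 s2 where s: "semicircular sm st \<phi> 0 1 s1" "semicircular sm st \<phi> 0 1 s2"
    and fr: "star_free sm st \<phi> {0::nat, 1} (\<lambda>i. if i = 0 then s1 else s2)"
    and c: "c = sm r (s1 + sm \<i> s2)"
    using assms(1) unfolding circular_def r_def by blast
  let ?s = "\<lambda>i::nat. if i = 0 then s1 else s2"
  interpret F: free_letters sm st \<phi> "{0::nat, 1}" ?s "{0::nat, 1}" "\<lambda>i. i" ?s
    "\<lambda>i j. if i = j then 1 else 0" "\<lambda>_. 0"
  proof
    fix l :: nat and w assume l: "l \<in> {0,1}" and w: "\<And>l'. l' \<in> set w \<Longrightarrow> l' = l"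
    then have "w = replicate (length w) l" by (intro replicate_eqI) auto
    then obtain p where p: "w = replicate p l" by blast
    have "semicircular sm st \<phi> 0 1 (?s l)" using s by simp
    from semicircular_SD[OF this, of p]
    show "\<phi> (?s l * prod_list (map ?s w)) = 0 * \<phi> (prod_list (map ?s w))
        + dsum 1 (map (\<lambda>l'. (?s l', if l = l' then 1 else 0)) w) 1"
      unfolding p by (simp add: SD_def)
  qed (use fr in \<open>auto intro: star_alg.gen\<close>)
  have SDs: "SD (?s i) zs" if i: "i \<in> {0,1}"
    and zs: "set zs \<subseteq> affine_letters {(s1, if i = 0 then 1 else 0), (s2, if i = 1 then 1 else 0)}" for i zs
  proof (rule SD_affine_letters[OF _ zs])
    let ?f = "\<lambda>j. (?s j, if i = j then 1 else (0::complex))"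
    fix zs :: "('a \<times> complex) list" assume "set zs \<subseteq> {(s1, if i = 0 then 1 else 0), (s2, if i = 1 then 1 else 0)}"
    then have "zs \<in> lists (?f ` {0,1})" by auto
    then have "zs \<in> map ?f ` lists {0,1}" by (simp only: lists_image)
    then obtain w where w: "zs = map ?f w" "set w \<subseteq> {0,1}" by auto
    show "SD (?s i) zs" using F.free_SD[OF i w(2)] by (simp add: SD_def w(1) comp_def)
  qed
  have sts: "st s1 = s1" "st s2 = s2" using s by (auto simp: semicircular_def)
  have stc: "st c = sm r (s1 + sm (-\<i>) s2)"
    by (simp add: c st_sm st_add cr sts)
  \<comment> \<open>The covariances with \<open>s1\<close> and \<open>s2\<close>, left unsimplified
    to match the shape that the rules of \<open>affine_letters\<close> produce.\<close>
  define k1 where "k1 = (\<lambda>e::bool. r * (1 + (if e then -\<i> else \<i>) * 0))"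
  define k2 where "k2 = (\<lambda>e::bool. r * (0 + (if e then -\<i> else \<i>) * 1))"
  have y_eq: "y e = sm r (s1 + sm (if e then -\<i> else \<i>) s2)" for e
    unfolding y_def using stc c by (cases e) simp_all
  have a1: "(y e, k1 e) \<in> affine_letters {(s1,1), (s2,0)}" for e
    unfolding y_eq k1_def by (intro affine_letters.scale affine_letters.add[OF affine_letters.base affine_letters.scale[OF affine_letters.base]]) simp_all
  have a2: "(y e, k2 e) \<in> affine_letters {(s1,0), (s2,1)}" for e
    unfolding y_eq k2_def by (intro affine_letters.scale affine_letters.add[OF affine_letters.base affine_letters.scale[OF affine_letters.base]]) simp_all
  have "SD s1 (map (\<lambda>e. (y e, k1 e)) w)" using SDs[of 0 "map (\<lambda>e. (y e, k1 e)) w"] a1 by auto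
  then have 1: "\<phi> (s1 * prod_list (map y w)) = dsum 1 (map (\<lambda>e. (y e, k1 e)) w) 1"
    by (simp add: SD_def comp_def)
  have "SD s2 (map (\<lambda>e. (y e, k2 e)) w)" using SDs[of 1 "map (\<lambda>e. (y e, k2 e)) w"] a2 by auto
  then have 2: "\<phi> (s2 * prod_list (map y w)) = dsum 1 (map (\<lambda>e. (y e, k2 e)) w) 1"
    by (simp add: SD_def comp_def)
  define d where "d = (if e then -\<i> else \<i>)"
  have "\<phi> (y e * prod_list (map y w)) = r * \<phi> (s1 * prod_list (map y w)) + (r * d) * \<phi> (s2 * prod_list (map y w))"
    unfolding y_eq[of e] d_def[symmetric]
    by (simp add: sm_mult_left distrib_right \<phi>_sm \<phi>_add algebra_simps)
  also have "\<dots> = dsum 1 (map (\<lambda>e'. (y e', r * k1 e' + (r * d) * k2 e')) w) 1"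
    unfolding 1 2 dsum_lin_cov ..
  also have "(\<lambda>e'. (y e', r * k1 e' + (r * d) * k2 e')) = (\<lambda>e'. (y e', if e \<noteq> e' then 1 else 0))"
  proof
    fix e'
    have "r * k1 e' + (r * d) * k2 e' = (r * r) * (1 + d * (if e' then -\<i> else \<i>))"
      unfolding k1_def k2_def by (simp add: algebra_simps)
    also have "\<dots> = (if e \<noteq> e' then 1 else 0)" unfolding r d_def by auto
    finally show "(y e', r * k1 e' + (r * d) * k2 e') = (y e', if e \<noteq> e' then 1 else 0)" by simp
  qed
  finally show ?thesis .
qed

text \<open>\<open>compatible\<close> is the covariance of two letters: stars are irrelevant for
  \<open>k <= 2\<close>, where the variable is self-adjoint, and must differ for circular variables.
  With this covariance \<open>free_SD\<close> coincides with the recursion of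
  \<open>nc_mom\<close>.\<close>

theorem free_family_moments:
  assumes fr: "star_free sm st \<phi> {1..} x"
    and x1: "semicircular sm st \<phi> 0 1 (x 1)" and x2: "semicircular sm st \<phi> 1 1 (x 2)"
    and x3: "\<And>k. k \<ge> 3 \<Longrightarrow> circular sm st \<phi> (x k)"
    and ks: "\<forall>(k,e)\<in>set ks. k \<ge> 1"
  shows "\<phi> (prod_list (map (\<lambda>(k,e). if e then st (x k) else x k) ks)) = of_nat (nc_mom ks)"
proof -
  let ?y = "\<lambda>(k,e). if e then st (x k) else x k"
  let ?\<kappa> = "\<lambda>p q. if compatible p q then 1 else (0::complex)"
  let ?m = "\<lambda>p. if fst p = 2 then 1 else (0::complex)"
  have st: "st (x 1) = x 1" "st (x 2) = x 2" using x1 x2 by (auto simp: semicircular_def)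
  interpret free_letters sm st \<phi> "{1::nat..}" x "{p. fst p \<ge> 1}" fst ?y ?\<kappa> ?m
  proof
    fix l :: "nat \<times> bool" and w :: "(nat \<times> bool) list"
    assume l: "l \<in> {p. 1 \<le> fst p}" and w: "\<And>l'. l' \<in> set w \<Longrightarrow> fst l' = fst l"
    obtain k e where ke: "l = (k,e)" by fastforce
    show "\<phi> (?y l * prod_list (map ?y w)) = ?m l * \<phi> (prod_list (map ?y w))
      + dsum 1 (map (\<lambda>l'. (?y l', ?\<kappa> l l')) w) 1"
    proof (cases "k \<ge> 3")
      case True
      \<comment> \<open>A word of colour \<open>k\<close> is a word in stars alone, the form
        required by \<open>circular_SD\<close>.\<close>
      have w': "w = map (\<lambda>e. (k,e)) (map snd w)"
        unfolding map_map by (rule map_idI[symmetric]) (use w ke in \<open>auto simp: prod_eq_iff\<close>)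
      have "\<phi> (?y (k,e) * prod_list (map ?y (map (\<lambda>e. (k,e)) v)))
         = dsum 1 (map (\<lambda>l'. (?y l', ?\<kappa> (k,e) l')) (map (\<lambda>e. (k,e)) v)) 1" for v
        using circular_SD[OF x3[OF True], of e v] True by (simp add: comp_def)
      from this[of "map snd w", folded w'] show ?thesis using True ke by simp
    next
      case False
      then have "k = 1 \<or> k = 2" using l ke by auto
      then have y: "?y l' = x k" and \<kappa>: "?\<kappa> l l' = 1" if "l' \<in> set w \<or> l' = l" for l'
        using that w[of l'] ke st by (auto split: if_splits, (cases l', auto)+)
      have mw: "map ?y w = replicate (length w) (x k)"
        using y by (auto intro!: replicate_eqI)
      have mk: "map (\<lambda>l'. (?y l', ?\<kappa> l l')) w = replicate (length w) (x k, 1)"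
        using y \<kappa> by (auto intro!: replicate_eqI)
      show ?thesis
      proof (cases "k = 1")
        case True
        then show ?thesis using semicircular_SD[OF x1, of "length w"] y[of l] ke
          unfolding mw mk by (simp add: SD_def)
      next
        case k: False
        then have "k = 2" using \<open>k = 1 \<or> k = 2\<close> by simp
        then show ?thesis using semicircular_mean_one_SD[OF x2, of "length w"] y[of l] ke
          unfolding mw mk by (simp add: prod_list_replicate)
      qed
    qed
  next
    fix l l' :: "nat \<times> bool" assume "fst l \<noteq> fst l'"
    then show "?\<kappa> l l' = 0" by (cases l; cases l') auto
  qed (use fr in \<open>auto intro: star_alg.gen star_alg.gen_star\<close>)
  have "\<phi> (prod_list (map ?y ks)) = of_nat (nc_mom ks)" if "set ks \<subseteq> {p. fst p \<ge> 1}"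
    using that
  proof (induction ks rule: nc_mom.induct)
    case 1 then show ?case by (simp add: \<phi>_1)
  next
    case (2 p w)
    have p: "p \<in> {p. fst p \<ge> 1}" and w: "set w \<subseteq> {p. fst p \<ge> 1}" using 2(4) by auto
    have t: "\<phi> (prod_list (map ?y (take i w))) = of_nat (nc_mom (take i w))"
      "\<phi> (prod_list (map ?y (drop (Suc i) w))) = of_nat (nc_mom (drop (Suc i) w))"
      if "i < length w" "compatible p (w ! i)" for i
      using 2(2)[of i] 2(3)[of i] that w set_take_subset[of i w] set_drop_subset[of "Suc i" w] by auto
    have "\<phi> (prod_list (map ?y (p # w))) = ?m p * \<phi> (prod_list (map ?y w)) + dsum 1 (map (\<lambda>l'. (?y l', ?\<kappa> p l')) w) 1"
      using free_SD[OF p w] by simp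
    also have "?m p * \<phi> (prod_list (map ?y w)) = of_nat (if fst p = 2 then nc_mom w else 0)"
      using 2(1) w by simp
    also have "dsum 1 (map (\<lambda>l'. (?y l', ?\<kappa> p l')) w) 1 =
        (\<Sum>i<length w. ?\<kappa> p (w ! i) * \<phi> (prod_list (map ?y (take i w))) * \<phi> (prod_list (map ?y (drop (Suc i) w))))"
      unfolding dsum_eq_sum by (intro sum.cong) (auto simp: take_map drop_map comp_def)
    also have "\<dots> = (\<Sum>i<length w. of_nat (if compatible p (w ! i) then nc_mom (take i w) * nc_mom (drop (Suc i) w) else 0))"
      by (intro sum.cong refl) (auto simp: t)
    finally show ?case by simp
  qed
  moreover have "set ks \<subseteq> {p. fst p \<ge> 1}" using ks by auto
  ultimately show ?thesis by blast
qed

end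

section \<open>Rotation-invariant noncrossing pairings\<close>

text \<open>Only the upper half of noncrossing is stated. That \<open>\<pi> b\<close> also lies
  above \<open>a\<close> follows: otherwise the arc from \<open>\<pi> b\<close> to \<open>b\<close>
  contains \<open>a\<close>, so that \<open>\<pi> a < b\<close>. Outside \<open>D\<close> the map is
  the identity, so equal pairings are equal functions.\<close>

definition ncp :: "nat set \<Rightarrow> (nat \<Rightarrow> nat) set" where
  "ncp D = {\<pi>. (\<forall>x. x \<notin> D \<longrightarrow> \<pi> x = x) \<and> (\<forall>x\<in>D. \<pi> x \<in> D \<and> \<pi> x \<noteq> x \<and> \<pi> (\<pi> x) = x)
     \<and> (\<forall>a\<in>D. \<forall>b\<in>D. a < b \<and> b < \<pi> a \<longrightarrow> \<pi> b < \<pi> a)}"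

definition ncinv :: "nat set \<Rightarrow> (nat \<Rightarrow> nat) \<Rightarrow> (nat \<Rightarrow> nat) set" where
  "ncinv D \<gamma> = {\<pi>\<in>ncp D. \<forall>x\<in>D. \<pi> (\<gamma> x) = \<gamma> (\<pi> x)}"

lemma ncpD:
  assumes "\<pi> \<in> ncp D"
  shows "x \<notin> D \<Longrightarrow> \<pi> x = x" "x \<in> D \<Longrightarrow> \<pi> x \<in> D" "x \<in> D \<Longrightarrow> \<pi> x \<noteq> x" "\<pi> (\<pi> x) = x"
    "a \<in> D \<Longrightarrow> b \<in> D \<Longrightarrow> a < b \<Longrightarrow> b < \<pi> a \<Longrightarrow> \<pi> b < \<pi> a"
  using assms unfolding ncp_def by (auto, (cases "x \<in> D", auto)?)

lemma finite_ncp: "finite D \<Longrightarrow> finite (ncp D)"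
proof (rule inj_on_finite)
  show "inj_on (\<lambda>\<pi>. restrict \<pi> D) (ncp D)"
  proof (rule inj_onI)
    fix \<pi> \<rho> assume "\<pi> \<in> ncp D" "\<rho> \<in> ncp D" "restrict \<pi> D = restrict \<rho> D"
    then show "\<pi> = \<rho>" by (intro ext) (metis ncpD(1) restrict_apply')
  qed
  show "(\<lambda>\<pi>. restrict \<pi> D) ` ncp D \<subseteq> D \<rightarrow>\<^sub>E D" by (auto simp: ncpD)
qed (simp add: finite_PiE)

lemma finite_ncinv: "finite D \<Longrightarrow> finite (ncinv D \<gamma>)"
  unfolding ncinv_def using finite_ncp by simp

lemma ncinv_empty: "ncinv {} \<gamma> = {\<lambda>x. x}"
  by (auto simp: ncinv_def ncp_def)

lemma ncinv_cong: "(\<And>x. x \<in> D \<Longrightarrow> \<gamma> x = \<gamma>' x) \<Longrightarrow> ncinv D \<gamma> = ncinv D \<gamma>'"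
  unfolding ncinv_def by (auto simp: ncpD(2))

text \<open>An outer pairing \<open>\<rho>\<close> of \<open>E0\<close> splits the remaining points into the part \<open>E1\<close> below it and the part \<open>E2\<close> to its right.\<close>

lemma card_ncinv_split:
  assumes D: "D = E0 \<union> E1 \<union> E2" "finite D" "E0 \<inter> E1 = {}"
    and E2: "\<And>a b. a \<in> E0 \<union> E1 \<Longrightarrow> b \<in> E2 \<Longrightarrow> a < b"
    and E1: "\<And>a b b'. a \<in> E0 \<Longrightarrow> b \<in> E1 \<Longrightarrow> b' \<in> E1 \<Longrightarrow> a < b \<Longrightarrow> a < b'"
    and cover: "\<And>a. a \<in> E1 \<Longrightarrow> \<exists>a0\<in>E0. a0 < a \<and> a < \<rho> a0"
    and \<rho>: "\<And>x. x \<in> E0 \<Longrightarrow> \<rho> x \<in> E0 \<and> \<rho> x \<noteq> x \<and> \<rho> (\<rho> x) = x"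
      "\<And>a b. a \<in> E0 \<Longrightarrow> b \<in> E0 \<Longrightarrow> a < b \<Longrightarrow> b < \<rho> a \<Longrightarrow> \<rho> b < \<rho> a"
      "\<And>x. x \<in> E0 \<Longrightarrow> \<rho> (\<gamma> x) = \<gamma> (\<rho> x)"
    and \<gamma>: "\<And>x. x \<in> E0 \<Longrightarrow> \<gamma> x \<in> E0" "\<And>x. x \<in> E1 \<Longrightarrow> \<gamma> x \<in> E1" "\<And>x. x \<in> E2 \<Longrightarrow> \<gamma> x \<in> E2"
  shows "card {\<pi>\<in>ncinv D \<gamma>. \<forall>x\<in>E0. \<pi> x = \<rho> x} = card (ncinv E1 \<gamma>) * card (ncinv E2 \<gamma>)"
proof -
  define glue where "glue = (\<lambda>(\<alpha>::nat\<Rightarrow>nat, \<beta>::nat\<Rightarrow>nat) x. if x \<in> E0 then \<rho> x else if x \<in> E1 then \<alpha> x else \<beta> x)"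
  define res where "res E \<pi> = (\<lambda>x. if x \<in> E then \<pi> x else x)" for E :: "nat set" and \<pi> :: "nat \<Rightarrow> nat"
  define A where "A = {\<pi>\<in>ncinv D \<gamma>. \<forall>x\<in>E0. \<pi> x = \<rho> x}"
  have dis: "E0 \<inter> E2 = {}" "E1 \<inter> E2 = {}" using E2 by blast+
  have "bij_betw glue (ncinv E1 \<gamma> \<times> ncinv E2 \<gamma>) A"
  proof (rule bij_betw_byWitness[where f' = "\<lambda>\<pi>. (res E1 \<pi>, res E2 \<pi>)"])
    show "\<forall>p\<in>ncinv E1 \<gamma> \<times> ncinv E2 \<gamma>. (res E1 (glue p), res E2 (glue p)) = p"
    proof clarify
      fix \<alpha> \<beta> assume ab: "\<alpha> \<in> ncinv E1 \<gamma>" "\<beta> \<in> ncinv E2 \<gamma>"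
      have "res E1 (glue (\<alpha>,\<beta>)) x = \<alpha> x" "res E2 (glue (\<alpha>,\<beta>)) x = \<beta> x" for x
        using ab D(3) dis by (auto simp: res_def glue_def ncinv_def ncpD(1))
      then show "res E1 (glue (\<alpha>,\<beta>)) = \<alpha> \<and> res E2 (glue (\<alpha>,\<beta>)) = \<beta>" by blast
    qed
    show "\<forall>\<pi>\<in>A. glue (res E1 \<pi>, res E2 \<pi>) = \<pi>"
      using D(1) by (auto simp: A_def glue_def res_def ncinv_def ncpD(1) fun_eq_iff)
    show "glue ` (ncinv E1 \<gamma> \<times> ncinv E2 \<gamma>) \<subseteq> A"
    proof clarify
      fix \<alpha> \<beta> assume ab: "\<alpha> \<in> ncinv E1 \<gamma>" "\<beta> \<in> ncinv E2 \<gamma>"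
      define \<pi> where "\<pi> = glue (\<alpha>,\<beta>)"
      have a: "\<alpha> \<in> ncp E1" "\<And>x. x \<in> E1 \<Longrightarrow> \<alpha> (\<gamma> x) = \<gamma> (\<alpha> x)"
        and b: "\<beta> \<in> ncp E2" "\<And>x. x \<in> E2 \<Longrightarrow> \<beta> (\<gamma> x) = \<gamma> (\<beta> x)"
        using ab by (auto simp: ncinv_def)
      have p0: "\<pi> x = \<rho> x" if "x \<in> E0" for x using that by (simp add: \<pi>_def glue_def)
      have p1: "\<pi> x = \<alpha> x" if "x \<in> E1" for x using that D(3) by (auto simp: \<pi>_def glue_def)
      have p2: "\<pi> x = \<beta> x" if "x \<in> E2" for x using that dis by (auto simp: \<pi>_def glue_def)
      have out: "\<pi> x = x" if "x \<notin> D" for x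
        using that D(1) ncpD(1)[OF b(1)] by (auto simp: \<pi>_def glue_def)
      have inD: "\<pi> x \<in> D \<and> \<pi> x \<noteq> x \<and> \<pi> (\<pi> x) = x" if xD: "x \<in> D" for x
      proof -
        consider "x \<in> E0" | "x \<in> E1" | "x \<in> E2" using xD D(1) by blast
        then show ?thesis
        proof cases
          case 1 then show ?thesis using p0 \<rho>(1)[OF 1] D(1) by simp
        next
          case 2 then show ?thesis using p1 ncpD[OF a(1)] D(1) by simp
        next
          case 3 then show ?thesis using p2 ncpD[OF b(1)] D(1) by simp
        qed
      qed
      have nc: "\<pi> v < \<pi> u" if uv: "u \<in> D" "v \<in> D" "u < v" "v < \<pi> u" for u v
      proof -
        consider "u \<in> E0" | "u \<in> E1" | "u \<in> E2" using uv D(1) by blast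
        then show ?thesis
        proof cases
          case 1
          have ru: "\<rho> u \<in> E0" using \<rho>(1)[OF 1] by simp
          consider "v \<in> E0" | "v \<in> E1" | "v \<in> E2" using uv D(1) by blast
          then show ?thesis
          proof cases
            case v: 1 then show ?thesis using \<rho>(2)[OF 1 v] uv p0[OF 1] p0[OF v] by simp
          next
            case v: 2
            have av: "\<alpha> v \<in> E1" using ncpD(2)[OF a(1) v] .
            \<comment> \<open>No point of \<open>E0\<close> separates \<open>E1\<close>, so
              \<open>v\<close> and its partner lie on the same side of
              \<open>\<rho> u\<close>.\<close>
            have "\<not> \<rho> u < \<alpha> v" using E1[OF ru av v] uv p0[OF 1] by auto
            moreover have "\<rho> u \<noteq> \<alpha> v" using ru av D(3) by auto
            ultimately show ?thesis using p0[OF 1] p1[OF v] by simp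
          next
            case v: 3
            have "\<rho> u < v" using E2 ru v by blast
            then show ?thesis using uv p0[OF 1] by simp
          qed
        next
          case 2
          have au: "\<alpha> u \<in> E1" using ncpD(2)[OF a(1) 2] .
          consider "v \<in> E0" | "v \<in> E1" | "v \<in> E2" using uv D(1) by blast
          then show ?thesis
          proof cases
            case v: 1
            have "v < u" using E1[OF v au 2] uv p1[OF 2] by simp
            then show ?thesis using uv by simp
          next
            case v: 2 then show ?thesis using ncpD(5)[OF a(1) 2 v] uv p1[OF 2] p1[OF v] by simp
          next
            case v: 3
            have "\<alpha> u < v" using E2 au v by blast
            then show ?thesis using uv p1[OF 2] by simp
          qed
        next
          case 3
          have "v \<in> E2" using uv D(1) E2[of v u] 3 by fastforce
          then show ?thesis using ncpD(5)[OF b(1) 3] uv p2[OF 3] p2 by simp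
        qed
      qed
      have com: "\<pi> (\<gamma> x) = \<gamma> (\<pi> x)" if xD: "x \<in> D" for x
      proof -
        consider "x \<in> E0" | "x \<in> E1" | "x \<in> E2" using xD D(1) by blast
        then show ?thesis
          by cases (simp_all add: p0 p1 p2 \<gamma> \<rho>(3) a(2) b(2))
      qed
      show "glue (\<alpha>,\<beta>) \<in> A"
        unfolding \<pi>_def[symmetric] A_def ncinv_def ncp_def
        using out inD nc com p0 by blast
    qed
    show "(\<lambda>\<pi>. (res E1 \<pi>, res E2 \<pi>)) ` A \<subseteq> ncinv E1 \<gamma> \<times> ncinv E2 \<gamma>"
    proof clarify
      fix \<pi> assume "\<pi> \<in> A"
      then have p: "\<pi> \<in> ncp D" "\<And>x. x \<in> D \<Longrightarrow> \<pi> (\<gamma> x) = \<gamma> (\<pi> x)" "\<And>x. x \<in> E0 \<Longrightarrow> \<pi> x = \<rho> x"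
        by (auto simp: A_def ncinv_def)
      note pD = ncpD[OF p(1)]
      have n0: "\<pi> x \<notin> E0" if "x \<notin> E0" for x
        using that p(3)[of "\<pi> x"] pD(4)[of x] \<rho>(1)[of "\<pi> x"] by auto
      \<comment> \<open>By \<open>cover\<close> the point lies under an arc of
        \<open>\<rho>\<close>; noncrossing keeps its partner to the left of the end of that arc,
        hence out of \<open>E2\<close>.\<close>
      have s1: "\<pi> x \<in> E1" if x: "x \<in> E1" for x
      proof -
        obtain a0 where a0: "a0 \<in> E0" "a0 < x" "x < \<rho> a0" using cover[OF x] by blast
        have "\<pi> x < \<pi> a0" using a0 p(3)[OF a0(1)] x D(1) by (intro pD(5)) auto
        then have "\<pi> x < \<rho> a0" using p(3)[OF a0(1)] by simp
        moreover have "\<rho> a0 \<in> E0" using \<rho>(1) a0 by blast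
        ultimately have "\<pi> x \<notin> E2" using E2[of "\<rho> a0" "\<pi> x"] by auto
        moreover have "\<pi> x \<notin> E0" using n0 x D(3) by blast
        ultimately show ?thesis using pD(2)[of x] x D(1) by blast
      qed
      have s2: "\<pi> x \<in> E2" if x: "x \<in> E2" for x
      proof -
        have "\<pi> x \<notin> E0" using n0 x dis by blast
        moreover have "\<pi> x \<notin> E1" using s1[of "\<pi> x"] pD(4)[of x] x dis by auto
        ultimately show ?thesis using pD(2)[of x] x D(1) by blast
      qed
      have "res E \<pi> \<in> ncinv E \<gamma>" if E: "E \<subseteq> D" "\<And>x. x \<in> E \<Longrightarrow> \<pi> x \<in> E" "\<And>x. x \<in> E \<Longrightarrow> \<gamma> x \<in> E" for E
        unfolding ncinv_def ncp_def res_def using E pD p(2) by (auto simp: subset_iff)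
      then show "res E1 \<pi> \<in> ncinv E1 \<gamma> \<and> res E2 \<pi> \<in> ncinv E2 \<gamma>"
        using s1 s2 \<gamma> D(1) by auto
    qed
  qed
  from bij_betw_same_card[OF this] show ?thesis
    by (simp add: A_def card_cartesian_product)
qed

section \<open>Block rotations and their orbits\<close>

text \<open>\<open>brot\<close> rotates each block cyclically, backwards if the letter is starred: it is the permutation of the
  column indices in the word of a product of traces.\<close>

definition cyc :: "nat \<Rightarrow> nat \<Rightarrow> bool \<Rightarrow> nat \<Rightarrow> nat" where
  "cyc c k e x = (if e then (if x = c then c + k - 1 else x - 1) else (if Suc x = c + k then c else Suc x))"

lemma cyc_in: "x \<in> {c..<c+k} \<Longrightarrow> cyc c k e x \<in> {c..<c+k}"
  by (auto simp: cyc_def)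

lemma cyc_inverse: "x \<in> {c..<c+k} \<Longrightarrow> cyc c k e (cyc c k (\<not> e) x) = x"
  by (auto simp: cyc_def)

text \<open>Forward, \<open>j\<close> steps add \<open>j\<close> modulo \<open>k\<close>. The
  backward rotation undoes the forward one, so a forward path from \<open>z\<close> to
  \<open>x\<close> is read in reverse.\<close>

lemma cyc_trans:
  assumes "x \<in> {c..<c+k}" "z \<in> {c..<c+k}"
  shows "\<exists>j. (cyc c k e ^^ j) x = z"
proof -
  have fwd: "(cyc c k False ^^ j) (c + i) = c + (i + j) mod k" if "i < k" for i j
  proof (induction j)
    case 0 then show ?case using that by simp
  next
    case (Suc j)
    have "(i + j) mod k < k" using that by simp
    then show ?case using Suc by (auto simp: cyc_def mod_Suc)
  qed
  have F: "\<exists>j. (cyc c k False ^^ j) x = z" if xz: "x \<in> {c..<c+k}" "z \<in> {c..<c+k}" for x z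
  proof -
    obtain i l where il: "x = c + i" "z = c + l" "i < k" "l < k"
      using xz by (metis atLeastLessThan_iff le_Suc_ex nat_add_left_cancel_less)
    have "(i + (k - i + l)) mod k = l" using il by simp
    then show ?thesis using fwd[OF il(3), of "k - i + l"] il by auto
  qed
  show ?thesis
  proof (cases e)
    case False then show ?thesis using F[OF assms] by simp
  next
    case True
    obtain j where j: "(cyc c k False ^^ j) z = x" using F[OF assms(2,1)] by blast
    have "(cyc c k True ^^ j) ((cyc c k False ^^ j) v) = v \<and> (cyc c k False ^^ j) v \<in> {c..<c+k}"
      if "v \<in> {c..<c+k}" for v
      using that
    proof (induction j arbitrary: v)
      case (Suc j)
      have v: "cyc c k False v \<in> {c..<c+k}" using Suc.prems by (rule cyc_in)
      have "(cyc c k True ^^ Suc j) ((cyc c k False ^^ Suc j) v)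
          = cyc c k True ((cyc c k True ^^ j) ((cyc c k False ^^ j) (cyc c k False v)))"
        by (simp add: funpow_swap1)
      also have "\<dots> = v" using Suc.IH[OF v] cyc_inverse[OF Suc.prems, of True] by simp
      finally show ?case using Suc.IH[OF v] by (simp add: funpow_swap1)
    qed simp
    from this[OF assms(2)] show ?thesis using True j by auto
  qed
qed

definition wsz :: "(nat \<times> bool) list \<Rightarrow> nat" where
  "wsz w = sum_list (map fst w)"

lemma wsz_simps [simp]: "wsz [] = 0" "wsz (p # w) = fst p + wsz w" "wsz (u @ v) = wsz u + wsz v"
  by (simp_all add: wsz_def)

fun brot :: "nat \<Rightarrow> (nat \<times> bool) list \<Rightarrow> nat \<Rightarrow> nat" where
  "brot c [] x = x"
| "brot c (p # w) x = (if x < c + fst p then cyc c (fst p) (snd p) x else brot (c + fst p) w x)"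

lemma brot_append:
  "c \<le> x \<Longrightarrow> brot c (u @ v) x = (if x < c + wsz u then brot c u x else brot (c + wsz u) v x)"
  by (induction u arbitrary: c) (auto simp: add.assoc)

definition blk :: "nat \<Rightarrow> (nat \<times> bool) list \<Rightarrow> nat \<Rightarrow> nat set" where
  "blk c w i = {c + wsz (take i w)..<c + wsz (take i w) + fst (w ! i)}"

lemma wsz_take_Suc: "i < length w \<Longrightarrow> wsz (take (Suc i) w) = wsz (take i w) + fst (w ! i)"
  by (simp add: take_Suc_conv_app_nth)

lemma wsz_split: "i < length w \<Longrightarrow> wsz w = wsz (take i w) + fst (w ! i) + wsz (drop (Suc i) w)"
  by (metis append_take_drop_id wsz_simps(3) wsz_take_Suc)

lemma brot_blk:
  assumes "i < length w" "x \<in> blk c w i"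
  shows "brot c w x = cyc (c + wsz (take i w)) (fst (w ! i)) (snd (w ! i)) x"
proof -
  have "w = take i w @ w ! i # drop (Suc i) w" using assms(1) by (rule id_take_nth_drop)
  then have "brot c w x = brot c (take i w @ w ! i # drop (Suc i) w) x" by simp
  also have "\<dots> = cyc (c + wsz (take i w)) (fst (w ! i)) (snd (w ! i)) x"
    using assms by (subst brot_append) (auto simp: blk_def)
  finally show ?thesis .
qed

lemma blk_subset: "i < length w \<Longrightarrow> blk c w i \<subseteq> {c..<c + wsz w}"
  using wsz_split[of i w] by (auto simp: blk_def)

lemma blk_cover: "x \<in> {c..<c + wsz w} \<Longrightarrow> \<exists>i<length w. x \<in> blk c w i"
proof (induction w arbitrary: c)
  case (Cons p w)
  show ?case
  proof (cases "x < c + fst p")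
    case True
    then show ?thesis using Cons.prems by (intro exI[of _ 0]) (auto simp: blk_def)
  next
    case False
    then obtain i where "i < length w" "x \<in> blk (c + fst p) w i" using Cons.IH[of "c + fst p"] Cons.prems by auto
    then show ?thesis by (intro exI[of _ "Suc i"]) (auto simp: blk_def add.assoc)
  qed
qed simp

lemma blk_disjoint:
  assumes "i < j" "j < length w" shows "blk c w i \<inter> blk c w j = {}"
proof -
  have "take j w = take (Suc i) w @ take (j - Suc i) (drop (Suc i) w)"
    using assms by (metis Suc_leI le_add_diff_inverse take_add)
  then have "wsz (take j w) = wsz (take (Suc i) w) + wsz (take (j - Suc i) (drop (Suc i) w))"
    by (metis wsz_simps(3))
  then have "wsz (take i w) + fst (w ! i) \<le> wsz (take j w)" using assms wsz_take_Suc[of i w] by simp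
  then show ?thesis by (auto simp: blk_def)
qed

lemma brot_blk_in: "i < length w \<Longrightarrow> x \<in> blk c w i \<Longrightarrow> brot c w x \<in> blk c w i"
  using brot_blk[of i w x c] cyc_in[of x "c + wsz (take i w)" "fst (w ! i)" "snd (w ! i)"] by (simp add: blk_def)

lemma brot_in: "x \<in> {c..<c + wsz w} \<Longrightarrow> brot c w x \<in> {c..<c + wsz w}"
  using blk_cover[of x c w] brot_blk_in[of _ w x c] blk_subset[of _ w c] by blast

lemma brot_blk_trans:
  assumes "i < length w" "x \<in> blk c w i" "z \<in> blk c w i"
  shows "\<exists>j. (brot c w ^^ j) x = z"
proof -
  let ?f = "cyc (c + wsz (take i w)) (fst (w ! i)) (snd (w ! i))"
  have "(brot c w ^^ j) x = (?f ^^ j) x \<and> (?f ^^ j) x \<in> blk c w i" for j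
  proof (induction j)
    case (Suc j)
    then show ?case using brot_blk[OF assms(1)] brot_blk_in[OF assms(1)] by simp
  qed (use assms in simp)
  moreover obtain j where "(?f ^^ j) x = z"
    using cyc_trans assms(2,3) unfolding blk_def by blast
  ultimately show ?thesis by metis
qed

text \<open>The blocks are the orbits of the rotation, and an invariant pairing commutes with it.\<close>

lemma ncinv_blk:
  assumes "\<pi> \<in> ncinv {c..<c + wsz w} (brot c w)" "i < length w" "x \<in> blk c w i" "z \<in> blk c w i"
    and "j < length w" "\<pi> x \<in> blk c w j"
  shows "\<pi> z \<in> blk c w j"
proof -
  obtain r where r: "(brot c w ^^ r) x = z" using brot_blk_trans[OF assms(2-4)] by blast
  have "(brot c w ^^ r) x \<in> blk c w i \<and> \<pi> ((brot c w ^^ r) x) \<in> blk c w j" for r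
  proof (induction r)
    case (Suc r)
    have "(brot c w ^^ r) x \<in> {c..<c + wsz w}" using Suc blk_subset[OF assms(2)] by blast
    then have "\<pi> (brot c w ((brot c w ^^ r) x)) = brot c w (\<pi> ((brot c w ^^ r) x))"
      using assms(1) by (simp add: ncinv_def)
    then show ?case using Suc brot_blk_in[OF assms(5)] brot_blk_in[OF assms(2)] by simp
  qed (use assms in simp)
  then show ?thesis using r by blast
qed

text \<open>A strictly decreasing map of \<open>k\<close> points into an interval of length
  \<open>k\<close> has no slack: counting from the first point bounds it above, counting back from
  the last point bounds it below.\<close>

lemma antitone_interval:
  fixes f :: "nat \<Rightarrow> nat"
  assumes rng: "\<And>i. i < k \<Longrightarrow> f i \<in> {c..<c+k}" and dec: "\<And>i j. i < j \<Longrightarrow> j < k \<Longrightarrow> f j < f i" and "i < k"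
  shows "f i = c + k - 1 - i"
proof -
  have up: "f i + i \<le> c + k - 1" if "i < k" for i
    using that
  proof (induction i)
    case 0 then show ?case using rng[of 0] by auto
  next
    case (Suc i) then show ?case using dec[of i "Suc i"] by auto
  qed
  have "c + j \<le> f (k - 1 - j)" if "j < k" for j
    using that
  proof (induction j)
    case 0 then show ?case using rng[of "k - 1"] by auto
  next
    case (Suc j)
    then have "f (k - 1 - j) < f (k - 1 - Suc j)" by (intro dec) auto
    then show ?case using Suc by auto
  qed
  from this[of "k - 1 - i"] up[of i] assms(3) show ?thesis by simp
qed

text \<open>The rotation moves the partners of \<open>c\<close> and \<open>Suc c\<close> in the same
  direction, whereas noncrossing nests the arc at \<open>Suc c\<close> inside a longer arc at
  \<open>c\<close>. So \<open>c\<close> and \<open>Suc c\<close> must be partners, and invariance of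
  this pair forces \<open>k = 2\<close>.\<close>

lemma ncinv_self_block:
  assumes \<pi>: "\<pi> \<in> ncinv {c..<c + wsz ((k,e) # w)} (brot c ((k,e) # w))" and k: "k \<ge> 1"
    and m: "\<pi> c \<in> {c..<c+k}"
  shows "k = 2 \<and> (\<forall>x\<in>{c..<c+k}. \<pi> x = c + c + k - 1 - x)"
proof -
  let ?D = "{c..<c + wsz ((k,e) # w)}"
  have p: "\<pi> \<in> ncp ?D" and com: "\<And>x. x \<in> ?D \<Longrightarrow> \<pi> (brot c ((k,e) # w) x) = brot c ((k,e) # w) (\<pi> x)"
    using \<pi> by (auto simp: ncinv_def)
  have rot: "brot c ((k,e) # w) x = cyc c k e x" if "x \<in> {c..<c+k}" for x using that by simp
  have BD: "{c..<c+k} \<subseteq> ?D" by auto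
  have cD: "c \<in> ?D" using k by simp
  have ne: "\<pi> c \<noteq> c" using ncpD(3)[OF p cD] .
  then have k2: "k \<ge> 2" using m by auto
  have mem: "\<pi> x \<in> {c..<c+k}" if "x \<in> {c..<c+k}" for x
    using ncinv_blk[OF \<pi>, of 0 c x 0] that m k by (simp add: blk_def)
  have c1: "Suc c \<in> {c..<c+k}" "c \<in> {c..<c+k}" using k2 by auto
  have pc: "\<pi> c = Suc c \<longleftrightarrow> \<pi> (Suc c) = c" by (metis ncpD(4)[OF p])
  have nc: "Suc c < \<pi> c \<Longrightarrow> \<pi> (Suc c) < \<pi> c"
    using c1 BD by (intro ncpD(5)[OF p]) auto
  have gt: "\<pi> c > c" using m ne by auto
  have "\<pi> c = Suc c \<and> k = 2"
  proof (cases e)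
    case False
    have "\<pi> (cyc c k e c) = cyc c k e (\<pi> c)"
      using com[OF cD] rot[OF c1(2)] rot[OF m] by simp
    then have "\<pi> (Suc c) = (if Suc (\<pi> c) = c + k then c else Suc (\<pi> c))"
      using False k2 by (simp add: cyc_def)
    then show ?thesis using nc pc gt by (auto split: if_splits)
  next
    case True
    have "\<pi> (cyc c k e (Suc c)) = cyc c k e (\<pi> (Suc c))"
      using com[of "Suc c"] rot[OF c1(1)] rot[OF mem[OF c1(1)]] BD c1 by auto
    then have "\<pi> c = (if \<pi> (Suc c) = c then c + k - 1 else \<pi> (Suc c) - 1)"
      using True k2 by (simp add: cyc_def)
    then show ?thesis using nc pc gt by (auto split: if_splits)
  qed
  then show ?thesis using pc by (auto simp: less_Suc_eq)
qed

text \<open>The pairing exchanges the two blocks, so their lengths agree; noncrossing makes it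
  decreasing, hence the reflection given by \<open>antitone_interval\<close>. A reflection turns a
  forward rotation into a backward one, so equal stars contradict invariance at \<open>Suc c\<close>
  as soon as \<open>k >= 3\<close>.\<close>

lemma ncinv_other_block:
  assumes \<pi>: "\<pi> \<in> ncinv {c..<c + wsz ((k,e) # w)} (brot c ((k,e) # w))" and k: "k \<ge> 1"
    and i: "i < length w" and m: "\<pi> c \<in> blk c ((k,e) # w) (Suc i)"
  defines "s \<equiv> c + k + wsz (take i w)"
  shows "compatible (k,e) (w ! i) \<and> (\<forall>x\<in>{c..<c+k} \<union> {s..<s+k}. \<pi> x = c + s + k - 1 - x)"
proof -
  let ?D = "{c..<c + wsz ((k,e) # w)}"
  obtain k' e' where we: "w ! i = (k',e')" by fastforce
  have p: "\<pi> \<in> ncp ?D" and com: "\<And>x. x \<in> ?D \<Longrightarrow> \<pi> (brot c ((k,e) # w) x) = brot c ((k,e) # w) (\<pi> x)"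
    using \<pi> by (auto simp: ncinv_def)
  have blk0: "blk c ((k,e) # w) 0 = {c..<c+k}" by (simp add: blk_def)
  have blkS: "blk c ((k,e) # w) (Suc i) = {s..<s+k'}" by (simp add: blk_def s_def we add.assoc)
  have BD: "{c..<c+k} \<subseteq> ?D" "{s..<s+k'} \<subseteq> ?D"
    using blk_subset[of "Suc i" "(k,e) # w" c] i by (auto simp: blkS)
  have rot0: "brot c ((k,e) # w) x = cyc c k e x" if "x \<in> {c..<c+k}" for x using that by simp
  have rot1: "brot c ((k,e) # w) x = cyc s k' e' x" if "x \<in> {s..<s+k'}" for x
    using brot_blk[of "Suc i" "(k,e) # w" x c] i that by (simp add: blkS we s_def add.assoc)
  have f: "\<pi> x \<in> {s..<s+k'}" if "x \<in> {c..<c+k}" for x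
    using ncinv_blk[OF \<pi>, of 0 c x "Suc i"] that m i k by (simp add: blk0 blkS)
  have b: "\<pi> x \<in> {c..<c+k}" if "x \<in> {s..<s+k'}" for x
    using ncinv_blk[OF \<pi>, of "Suc i" "\<pi> c" x 0] that m i k ncpD(4)[OF p, of c] by (simp add: blk0 blkS)
  have inj: "inj_on \<pi> S" for S by (rule inj_onI) (metis ncpD(4)[OF p])
  have "card {c..<c+k} \<le> card {s..<s+k'}" using f by (intro card_inj_on_le[OF inj] image_subsetI) simp_all
  moreover have "card {s..<s+k'} \<le> card {c..<c+k}" using b by (intro card_inj_on_le[OF inj] image_subsetI) simp_all
  ultimately have kk: "k' = k" by simp
  have sc: "s \<ge> c + k" by (simp add: s_def)
  have pc: "\<pi> (c + j) = s + k - 1 - j" if "j < k" for j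
  proof (rule antitone_interval[where f = "\<lambda>j. \<pi> (c + j)", OF _ _ that])
    fix j assume "j < k" then show "\<pi> (c + j) \<in> {s..<s+k}" using f[of "c + j"] kk by simp
  next
    fix i j assume ij: "i < j" "j < k"
    have "\<pi> (c + i) \<ge> s" using f[of "c + i"] ij by simp
    then show "\<pi> (c + j) < \<pi> (c + i)"
      using ij sc BD(1) by (intro ncpD(5)[OF p]) auto
  qed
  have p0: "\<pi> x = c + s + k - 1 - x" if "x \<in> {c..<c+k}" for x
    using pc[of "x - c"] that by auto
  have p1: "\<pi> x = c + s + k - 1 - x" if "x \<in> {s..<s+k}" for x
  proof -
    have "\<pi> x \<in> {c..<c+k}" using b that kk by simp
    then have "\<pi> (\<pi> x) = c + s + k - 1 - \<pi> x" "\<pi> x \<in> {c..<c+k}" using p0 by auto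
    then show ?thesis using ncpD(4)[OF p, of x] sc by auto
  qed
  have "k \<le> 2 \<or> e \<noteq> e'"
  proof (rule ccontr)
    assume "\<not> ?thesis"
    then have k3: "k \<ge> 3" "e' = e" by auto
    have c1: "Suc c \<in> {c..<c+k}" using k3 by simp
    have pc1: "\<pi> (Suc c) = s + k - 2" using pc[of 1] k3 by simp
    have "\<pi> (cyc c k e (Suc c)) = cyc s k e (\<pi> (Suc c))"
      using com[of "Suc c"] rot0[OF c1] rot1[OF f[OF c1]] BD c1 kk k3 by auto
    then show False
      unfolding pc1 using pc[of 0] pc[of 2] k3 by (cases e) (auto simp: cyc_def split: if_splits)
  qed
  then show ?thesis using p0 p1 we kk by auto
qed

text \<open>Invariant pairings are sorted by the block that contains the partner of
  \<open>c\<close>: its own, possible for \<open>k = 2\<close> only, or a compatible later one. The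
  pairing of these blocks is then a prescribed reflection, and \<open>card_ncinv_split\<close>
  counts the rest as a product. These are the two kinds of summands in
  \<open>nc_mom\<close>.\<close>

theorem card_ncinv:
  "\<forall>p\<in>set w. fst p \<ge> 1 \<Longrightarrow> card (ncinv {c..<c + wsz w} (brot c w)) = nc_mom w"
proof (induction w arbitrary: c rule: nc_mom.induct)
  case 1
  then show ?case by (simp add: ncinv_empty)
next
  case (2 p w)
  obtain k e where p: "p = (k,e)" by fastforce
  let ?W = "(k,e) # w"
  have k: "k \<ge> 1" and w: "\<forall>p\<in>set w. fst p \<ge> 1" using 2(4) p by auto
  define D where "D = {c..<c + wsz ?W}"
  define \<gamma> where "\<gamma> = brot c ?W"
  define s where "s i = c + k + wsz (take i w)" for i
  define A0 where "A0 = {\<pi>\<in>ncinv D \<gamma>. \<forall>x\<in>{c..<c+k}. \<pi> x = c + c + k - 1 - x}"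
  define A where "A i = {\<pi>\<in>ncinv D \<gamma>. \<forall>x\<in>{c..<c+k} \<union> {s i..<s i+k}. \<pi> x = c + s i + k - 1 - x}" for i
  define J where "J = {i. i < length w \<and> compatible (k,e) (w ! i)}"
  have rot0: "\<gamma> x = cyc c k e x" if "x \<in> {c..<c+k}" for x using that by (simp add: \<gamma>_def)
  have rotw: "\<gamma> x = brot (c + k) w x" if "x \<ge> c + k" for x using that by (simp add: \<gamma>_def)
  have finD: "finite D" by (simp add: D_def)
  have fin: "finite (ncinv D \<gamma>)" by (rule finite_ncinv[OF finD])
  have blkS: "blk c ?W (Suc i) = {s i..<s i+k}" if "i \<in> J" for i
    using that by (cases "w ! i") (auto simp: blk_def s_def J_def add.assoc)
  have union: "ncinv D \<gamma> = (if k = 2 then A0 else {}) \<union> (\<Union>i\<in>J. A i)"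
  proof (intro equalityI subsetI)
    fix \<pi> assume \<pi>: "\<pi> \<in> ncinv D \<gamma>"
    then have "\<pi> \<in> ncp D" by (simp add: ncinv_def)
    then have "\<pi> c \<in> D" by (rule ncpD(2)) (use k in \<open>simp add: D_def\<close>)
    then obtain i where i: "i < length ?W" "\<pi> c \<in> blk c ?W i" using blk_cover unfolding D_def by blast
    show "\<pi> \<in> (if k = 2 then A0 else {}) \<union> (\<Union>i\<in>J. A i)"
    proof (cases i)
      case 0
      then have "\<pi> c \<in> {c..<c+k}" using i by (simp add: blk_def)
      from ncinv_self_block[OF \<pi>[unfolded D_def \<gamma>_def] k this] \<pi> show ?thesis by (simp add: A0_def)
    next
      case (Suc i')
      then have "i' < length w" "\<pi> c \<in> blk c ?W (Suc i')" using i by auto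
      from ncinv_other_block[OF \<pi>[unfolded D_def \<gamma>_def] k this] \<pi> \<open>i' < length w\<close>
      show ?thesis by (auto simp: A_def J_def s_def)
    qed
  qed (auto simp: A0_def A_def split: if_splits)
  have Ac: "\<pi> c \<in> blk c ?W (Suc i)" if "\<pi> \<in> A i" "i \<in> J" for \<pi> i
    using that(1) k unfolding blkS[OF that(2)] by (auto simp: A_def s_def)
  have A0c: "\<pi> c \<in> blk c ?W 0" if "\<pi> \<in> A0" for \<pi>
    using that k by (auto simp: A0_def blk_def)
  have dis: "A i \<inter> A j = {}" if "i \<in> J" "j \<in> J" "i \<noteq> j" for i j
  proof -
    have "blk c ?W (Suc i) \<inter> blk c ?W (Suc j) = {}"
      using that blk_disjoint[of "Suc i" "Suc j" ?W c] blk_disjoint[of "Suc j" "Suc i" ?W c]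
      by (cases i j rule: linorder_cases) (auto simp: J_def)
    then show ?thesis using Ac that by blast
  qed
  have dis0: "A0 \<inter> A i = {}" if "i \<in> J" for i
  proof -
    have "blk c ?W 0 \<inter> blk c ?W (Suc i) = {}"
      using that by (intro blk_disjoint) (auto simp: J_def)
    then show ?thesis using Ac A0c that by blast
  qed
  have finA: "finite A0" "finite (A i)" for i using fin by (auto simp: A0_def A_def)
  have finJ: "finite J" by (simp add: J_def)
  have cardA0: "card A0 = nc_mom w" if k2: "k = 2"
  proof -
    let ?E2 = "{c+k..<c+k+wsz w}"
    have "card A0 = card (ncinv {} \<gamma>) * card (ncinv ?E2 \<gamma>)"
      unfolding A0_def
    proof (rule card_ncinv_split[OF _ finD])
      fix x assume x: "x \<in> {c..<c+k}"
      then have xc: "x = c \<or> x = Suc c" using k2 by auto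
      show "c + c + k - 1 - x \<in> {c..<c+k} \<and> c + c + k - 1 - x \<noteq> x \<and> c + c + k - 1 - (c + c + k - 1 - x) = x"
        using xc k2 by auto
      have x': "c + c + k - 1 - x \<in> {c..<c+k}" using x by auto
      show "\<gamma> x \<in> {c..<c+k}" using rot0[OF x] cyc_in[OF x] by simp
      show "c + c + k - 1 - \<gamma> x = \<gamma> (c + c + k - 1 - x)"
        unfolding rot0[OF x] rot0[OF x'] using xc k2 by (auto simp: cyc_def)
    next
      fix x assume x: "x \<in> ?E2"
      then show "\<gamma> x \<in> ?E2" using rotw[of x] brot_in[OF x] by simp
    qed (auto simp: D_def)
    also have "ncinv ?E2 \<gamma> = ncinv ?E2 (brot (c + k) w)" by (rule ncinv_cong) (simp add: rotw)
    also have "card \<dots> = nc_mom w" by (rule 2(1)[OF _ w]) (simp add: p k2)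
    finally show ?thesis by (simp add: ncinv_empty)
  qed
  have cardA: "card (A i) = nc_mom (take i w) * nc_mom (drop (Suc i) w)" if iJ: "i \<in> J" for i
  proof -
    have i: "i < length w" and co: "compatible (k,e) (w ! i)" using iJ by (auto simp: J_def)
    obtain e' where we: "w ! i = (k,e')" "k \<le> 2 \<or> e \<noteq> e'" using co by (cases "w ! i") auto
    let ?E0 = "{c..<c+k} \<union> {s i..<s i+k}" and ?E1 = "{c+k..<s i}"
      and ?E2 = "{s i+k..<s i+k+wsz (drop (Suc i) w)}"
    have sk: "s i \<ge> c + k" by (simp add: s_def)
    have tot: "c + wsz ?W = s i + k + wsz (drop (Suc i) w)"
      using wsz_split[OF i] we by (simp add: s_def)
    have rot1: "\<gamma> x = cyc (s i) k e' x" if "x \<in> {s i..<s i+k}" for x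
      using brot_blk[of "Suc i" ?W x c] i that blkS[OF iJ] we by (simp add: \<gamma>_def s_def add.assoc)
    have g1: "\<gamma> x = brot (c + k) (take i w) x" if "x \<in> ?E1" for x
      using rotw[of x] brot_append[of "c + k" x "take i w" "drop i w"] that by (simp add: s_def)
    have g2: "\<gamma> x = brot (s i + k) (drop (Suc i) w) x" if "x \<in> ?E2" for x
      using rotw[of x] brot_append[of "c + k" x "take (Suc i) w" "drop (Suc i) w"] that sk wsz_take_Suc[OF i] we
      by (simp add: s_def add.assoc)
    have E1eq: "?E1 = {c+k..<c+k+wsz (take i w)}" by (simp add: s_def)
    have "card (A i) = card (ncinv ?E1 \<gamma>) * card (ncinv ?E2 \<gamma>)"
      unfolding A_def
    proof (rule card_ncinv_split[OF _ finD])
      show "D = ?E0 \<union> ?E1 \<union> ?E2" unfolding D_def tot using sk by auto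
    next
      fix x assume x: "x \<in> ?E0"
      show r: "c + s i + k - 1 - x \<in> ?E0 \<and> c + s i + k - 1 - x \<noteq> x \<and> c + s i + k - 1 - (c + s i + k - 1 - x) = x"
        using x sk by auto
      show "\<gamma> x \<in> ?E0" using x rot0[of x] rot1[of x] cyc_in[of x c k e] cyc_in[of x "s i" k e'] by auto
      show "c + s i + k - 1 - \<gamma> x = \<gamma> (c + s i + k - 1 - x)"
      proof (cases "x \<in> {c..<c+k}")
        case True
        then have "c + s i + k - 1 - x \<in> {s i..<s i+k}" by auto
        from rot0[OF True] rot1[OF this] show ?thesis
          using True we(2) sk k by (auto simp: cyc_def)
      next
        case False
        then have x1: "x \<in> {s i..<s i+k}" using x by blast
        then have "c + s i + k - 1 - x \<in> {c..<c+k}" by auto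
        from rot1[OF x1] rot0[OF this] show ?thesis
          using x1 we(2) sk k by (auto simp: cyc_def)
      qed
    next
      fix a assume "a \<in> ?E1"
      then show "\<exists>a0\<in>?E0. a0 < a \<and> a < c + s i + k - 1 - a0" using k by (intro bexI[of _ c]) auto
    next
      fix x assume x: "x \<in> ?E1"
      then show "\<gamma> x \<in> ?E1" using g1[OF x] brot_in[of x "c + k" "take i w"] unfolding E1eq by simp
    next
      fix x assume x: "x \<in> ?E2"
      then show "\<gamma> x \<in> ?E2" using g2[OF x] brot_in[OF x] by simp
    qed (use sk in auto)
    also have "ncinv ?E1 \<gamma> = ncinv {c+k..<c+k+wsz (take i w)} (brot (c + k) (take i w))"
      unfolding E1eq by (rule ncinv_cong) (simp add: g1 E1eq)
    also have "card \<dots> = nc_mom (take i w)"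
      using 2(2)[of i] i co p w set_take_subset[of i w] by auto
    also have "ncinv ?E2 \<gamma> = ncinv ?E2 (brot (s i + k) (drop (Suc i) w))"
      by (rule ncinv_cong) (rule g2)
    also have "card \<dots> = nc_mom (drop (Suc i) w)"
      using 2(3)[of i] i co p w set_drop_subset[of "Suc i" w] by auto
    finally show ?thesis .
  qed
  have "card (ncinv D \<gamma>) = card (if k = 2 then A0 else {}) + card (\<Union>i\<in>J. A i)"
    unfolding union using finA finJ dis0 by (intro card_Un_disjoint) auto
  also have "card (\<Union>i\<in>J. A i) = (\<Sum>i\<in>J. card (A i))"
    using finA finJ dis by (intro card_UN_disjoint) auto
  also have "\<dots> = (\<Sum>i<length w. if compatible p (w ! i) then nc_mom (take i w) * nc_mom (drop (Suc i) w) else 0)"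
    by (simp add: cardA J_def p sum.inter_filter[symmetric] lessThan_def)
  also have "card (if k = 2 then A0 else {}) = (if fst p = 2 then nc_mom w else 0)"
    using cardA0 p by simp
  finally show ?case by (simp add: p D_def \<gamma>_def)
qed

section \<open>The Haar state of the free orthogonal group\<close>

text \<open>A noncrossing pairing of \<open>K\<close> points is represented by the set of all index lists of length \<open>K\<close> that are
  constant on its pairs; over the infinite alphabet \<open>nat\<close> this set determines the pairing, whatever \<open>n\<close> is.\<close>

definition ins_pair :: "nat \<Rightarrow> nat list set \<Rightarrow> nat list set" where
  "ins_pair p A = {a @ [k,k] @ b | a b k. length a = p \<and> a @ b \<in> A}"

inductive ncv :: "nat \<Rightarrow> nat list set \<Rightarrow> bool" where
  ncv_Nil: "ncv 0 {[]}"
| ncv_ins: "ncv K A \<Longrightarrow> p \<le> K \<Longrightarrow> ncv (Suc (Suc K)) (ins_pair p A)"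

lemma ins_pair_iff: "length a = p \<Longrightarrow> a @ s # t # b \<in> ins_pair p A \<longleftrightarrow> s = t \<and> a @ b \<in> A"
  by (auto simp: ins_pair_def)

lemma finite_ncv: "finite {A. ncv K A}"
proof (induction K rule: less_induct)
  case (less K)
  show ?case
  proof (cases "\<exists>L. K = Suc (Suc L)")
    case True
    then obtain L where L: "K = Suc (Suc L)" by blast
    have "{A. ncv K A} \<subseteq> (\<lambda>(p,A). ins_pair p A) ` ({..L} \<times> {A. ncv L A})"
    proof
      fix A assume "A \<in> {A. ncv K A}"
      then have "ncv K A" by simp
      then show "A \<in> (\<lambda>(p,A). ins_pair p A) ` ({..L} \<times> {A. ncv L A})"
        using L by cases auto
    qed
    moreover have "finite ((\<lambda>(p,A). ins_pair p A) ` ({..L} \<times> {A. ncv L A}))"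
      using less[of L] L by simp
    ultimately show ?thesis by (rule finite_subset)
  next
    case False
    have "{A. ncv K A} \<subseteq> {{[]}}"
    proof
      fix A assume "A \<in> {A. ncv K A}"
      then have "ncv K A" by simp
      then show "A \<in> {{[]}}" using False by cases auto
    qed
    then show ?thesis by (rule finite_subset) simp
  qed
qed

definition ind :: "nat list set \<Rightarrow> nat list \<Rightarrow> real" where
  "ind A y = (if y \<in> A then 1 else 0)"

lemma finite_idx_lists: "finite (idx_lists n K)"
  unfolding idx_lists_def using finite_lists_length_eq[of "{..<n}" K] by (simp add: conj_commute)

lemma split_pair_at:
  assumes "Suc (Suc p) \<le> length y"
  obtains a s t b where "y = a @ s # t # b" "length a = p"
proof -
  have "length (take p y) = p" "y = take p y @ y ! p # y ! Suc p # drop (Suc (Suc p)) y"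
    using assms by (auto simp: Cons_nth_drop_Suc)
  then show ?thesis using that by blast
qed

lemma sum_idx_lists_insert:
  assumes "p \<le> K"
  shows "(\<Sum>x\<in>idx_lists n (Suc (Suc K)). F x) =
    (\<Sum>y\<in>idx_lists n K. \<Sum>s<n. \<Sum>t<n. F (take p y @ s # t # drop p y))"
proof -
  let ?g = "\<lambda>(y,s,t). take p y @ s # t # drop p y"
  have "bij_betw ?g (idx_lists n K \<times> {..<n} \<times> {..<n}) (idx_lists n (Suc (Suc K)))"
  proof (rule bij_betw_byWitness[where f' = "\<lambda>x. (take p x @ drop (Suc (Suc p)) x, x ! p, x ! Suc p)"])
    show "\<forall>z\<in>idx_lists n K \<times> {..<n} \<times> {..<n}.
        (\<lambda>x. (take p x @ drop (Suc (Suc p)) x, x ! p, x ! Suc p)) (?g z) = z"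
      using assms by (auto simp: idx_lists_def nth_append min_def)
    show "\<forall>x\<in>idx_lists n (Suc (Suc K)). ?g (take p x @ drop (Suc (Suc p)) x, x ! p, x ! Suc p) = x"
      using assms by (auto simp: idx_lists_def Cons_nth_drop_Suc min_def)
    show "?g ` (idx_lists n K \<times> {..<n} \<times> {..<n}) \<subseteq> idx_lists n (Suc (Suc K))"
    proof (rule image_subsetI)
      fix z assume z: "z \<in> idx_lists n K \<times> {..<n} \<times> {..<n}"
      obtain y s t where zy: "z = (y,s,t)" by (cases z) auto
      have y: "y \<in> idx_lists n K" and st: "s \<in> {..<n}" "t \<in> {..<n}" using z zy by auto
      have "set (take p y) \<subseteq> {..<n}" "set (drop p y) \<subseteq> {..<n}"
        using y set_take_subset[of p y] set_drop_subset[of p y] unfolding idx_lists_def by blast+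
      then show "?g z \<in> idx_lists n (Suc (Suc K))"
        using y st assms by (simp add: idx_lists_def zy)
    qed
    show "(\<lambda>x. (take p x @ drop (Suc (Suc p)) x, x ! p, x ! Suc p)) ` idx_lists n (Suc (Suc K))
        \<subseteq> idx_lists n K \<times> {..<n} \<times> {..<n}"
    proof (rule image_subsetI)
      fix x assume x: "x \<in> idx_lists n (Suc (Suc K))"
      then have "x ! p \<in> set x" "x ! Suc p \<in> set x" using assms by (auto simp: idx_lists_def)
      then have "x ! p < n" "x ! Suc p < n" using x by (auto simp: idx_lists_def)
      then show "(take p x @ drop (Suc (Suc p)) x, x ! p, x ! Suc p) \<in> idx_lists n K \<times> {..<n} \<times> {..<n}"
        using assms x order.trans[OF set_take_subset[of p x]] order.trans[OF set_drop_subset[of "Suc (Suc p)" x]]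
        by (simp add: idx_lists_def)
    qed
  qed
  from sum.reindex_bij_betw[OF this, of F, symmetric] show ?thesis
    by (simp add: sum.cartesian_product case_prod_beta)
qed

text \<open>Contracting two adjacent points of a noncrossing pairing gives a multiple of a noncrossing pairing:
  a closed loop if the points are partners, and otherwise their partners get paired.\<close>

lemma ncv_contract:
  assumes "ncv K A" "Suc (Suc p) \<le> K"
  shows "\<exists>c B. ncv (K - 2) B \<and> (\<forall>y\<in>idx_lists n (K - 2).
    (\<Sum>k<n. ind A (take p y @ k # k # drop p y)) = c * ind B y)"
  using assms
proof (induction arbitrary: p rule: ncv.induct)
  case (ncv_ins K A q)
  have pK: "p \<le> K" using ncv_ins.prems by simp
  consider "p = q" | "p = Suc q" | "q = Suc p" | "Suc (Suc q) \<le> p" | "Suc (Suc p) \<le> q" by linarith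
  then show ?case
  proof cases
    case 1
    have "(\<Sum>k<n. ind (ins_pair q A) (take p y @ k # k # drop p y)) = real n * ind A y" if "y \<in> idx_lists n K" for y
      using that pK 1 by (simp add: ind_def ins_pair_iff idx_lists_def)
    then show ?thesis using ncv_ins.hyps(1) by (intro exI[of _ "real n"] exI[of _ A]) simp
  next
    case 2
    have "(\<Sum>k<n. ind (ins_pair q A) (take p y @ k # k # drop p y)) = 1 * ind A y" if y: "y \<in> idx_lists n K" for y
    proof -
      have len: "length y = K" using y by (simp add: idx_lists_def)
      have ty: "take p y = take q y @ [y ! q]" using 2 pK len by (simp add: take_Suc_conv_app_nth)
      have dy: "y ! q # drop p y = drop q y" using 2 pK len by (simp add: Cons_nth_drop_Suc)
      have yn: "y ! q < n" using y 2 pK by (auto simp: idx_lists_def subset_iff)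
      have "(\<Sum>k<n. ind (ins_pair q A) (take p y @ k # k # drop p y)) =
          (\<Sum>k<n. if k = y ! q then ind A y else 0)"
      proof (intro sum.cong refl)
        fix k
        show "ind (ins_pair q A) (take p y @ k # k # drop p y) = (if k = y ! q then ind A y else 0)"
          unfolding ty using dy 2 pK len by (auto simp: ind_def ins_pair_iff)
      qed
      then show ?thesis using yn by simp
    qed
    then show ?thesis using ncv_ins.hyps(1) by (intro exI[of _ 1] exI[of _ A]) simp
  next
    case 3
    have "(\<Sum>k<n. ind (ins_pair q A) (take p y @ k # k # drop p y)) = 1 * ind A y" if y: "y \<in> idx_lists n K" for y
    proof -
      have len: "length y = K" using y by (simp add: idx_lists_def)
      have pl: "p < K" using 3 ncv_ins.hyps by simp
      have dy: "drop p y = y ! p # drop (Suc p) y" using pl len by (simp add: Cons_nth_drop_Suc)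
      have yn: "y ! p < n" using y pl by (auto simp: idx_lists_def subset_iff)
      have ins: "(take p y @ [k]) @ k # y ! p # drop (Suc p) y \<in> ins_pair q A
          \<longleftrightarrow> k = y ! p \<and> (take p y @ [k]) @ drop (Suc p) y \<in> A" for k
        using 3 pl len by (intro ins_pair_iff) simp
      have "(\<Sum>k<n. ind (ins_pair q A) (take p y @ k # k # drop p y)) =
          (\<Sum>k<n. if k = y ! p then ind A y else 0)"
      proof (intro sum.cong refl)
        fix k
        have "take p y @ y ! p # drop (Suc p) y = y" using dy by (metis append_take_drop_id)
        then show "ind (ins_pair q A) (take p y @ k # k # drop p y) = (if k = y ! p then ind A y else 0)"
          using ins[of k] dy by (auto simp: ind_def)
      qed
      then show ?thesis using yn by simp
    qed
    then show ?thesis using ncv_ins.hyps(1) by (intro exI[of _ 1] exI[of _ A]) simp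
  next
    case 4
    then have "Suc (Suc (p - 2)) \<le> K" using pK by simp
    from ncv_ins.IH[OF this] obtain c B where B: "ncv (K - 2) B"
      "\<forall>y\<in>idx_lists n (K - 2). (\<Sum>k<n. ind A (take (p - 2) y @ k # k # drop (p - 2) y)) = c * ind B y" by blast
    have K2: "K = Suc (Suc (K - 2))" using 4 pK by simp
    have "ncv (Suc (Suc (K - 2))) (ins_pair q B)" using B 4 pK by (intro ncv.ncv_ins) auto
    moreover have "(\<Sum>k<n. ind (ins_pair q A) (take p y @ k # k # drop p y)) = c * ind (ins_pair q B) y"
      if y: "y \<in> idx_lists n K" for y
    proof -
      obtain a s t r where r: "y = a @ s # t # r" "length a = q"
        by (rule split_pair_at[of q y]) (use y 4 pK in \<open>auto simp: idx_lists_def\<close>)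
      define m where "m = p - Suc (Suc q)"
      have pm: "p = Suc (Suc (q + m))" using 4 by (simp add: m_def)
      have t1: "take p y = a @ s # t # take m r" "drop p y = drop m r" using r pm by simp_all
      have t2: "take (p - 2) (a @ r) = a @ take m r" "drop (p - 2) (a @ r) = drop m r" using r pm by simp_all
      have ar: "a @ r \<in> idx_lists n (K - 2)" using y r by (auto simp: idx_lists_def)
      have "ind (ins_pair q A) (take p y @ k # k # drop p y) = (if s = t then ind A (take (p - 2) (a @ r) @ k # k # drop (p - 2) (a @ r)) else 0)" for k
        unfolding t1 t2 using ins_pair_iff[OF r(2), of s t "take m r @ k # k # drop m r" A] by (simp add: ind_def)
      then have "(\<Sum>k<n. ind (ins_pair q A) (take p y @ k # k # drop p y)) = (if s = t then c * ind B (a @ r) else 0)"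
        using B(2)[rule_format, OF ar] by (simp del: take_append drop_append)
      also have "\<dots> = c * ind (ins_pair q B) y" using ins_pair_iff[OF r(2), of s t r B] r by (simp add: ind_def)
      finally show ?thesis .
    qed
    ultimately show ?thesis using K2 by (intro exI[of _ c] exI[of _ "ins_pair q B"]) simp
  next
    case 5
    then have "Suc (Suc p) \<le> K" using ncv_ins.hyps by simp
    from ncv_ins.IH[OF this] obtain c B where B: "ncv (K - 2) B"
      "\<forall>y\<in>idx_lists n (K - 2). (\<Sum>k<n. ind A (take p y @ k # k # drop p y)) = c * ind B y" by blast
    have K2: "K = Suc (Suc (K - 2))" using 5 ncv_ins.hyps by simp
    have "ncv (Suc (Suc (K - 2))) (ins_pair (q - 2) B)" using B 5 ncv_ins.hyps by (intro ncv.ncv_ins) auto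
    moreover have "(\<Sum>k<n. ind (ins_pair q A) (take p y @ k # k # drop p y)) = c * ind (ins_pair (q - 2) B) y"
      if y: "y \<in> idx_lists n K" for y
    proof -
      have "Suc (Suc (q - 2)) \<le> length y" using y 5 ncv_ins.hyps by (simp add: idx_lists_def)
      then obtain a s t r where r: "y = a @ s # t # r" "length a = q - 2" by (rule split_pair_at)
      have t1: "take p y = take p a" "drop p y = drop p a @ s # t # r" using r 5 by simp_all
      have t2: "take p (a @ r) = take p a" "drop p (a @ r) = drop p a @ r" using r 5 by simp_all
      have ar: "a @ r \<in> idx_lists n (K - 2)" using y r by (auto simp: idx_lists_def)
      have "ind (ins_pair q A) (take p y @ k # k # drop p y) = (if s = t then ind A (take p (a @ r) @ k # k # drop p (a @ r)) else 0)" for k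
      proof -
        have "length (take p a @ k # k # drop p a) = q" using r 5 by simp
        from ins_pair_iff[OF this, of s t r A] show ?thesis unfolding t1 t2 by (simp add: ind_def)
      qed
      then have "(\<Sum>k<n. ind (ins_pair q A) (take p y @ k # k # drop p y)) = (if s = t then c * ind B (a @ r) else 0)"
        using B(2)[rule_format, OF ar] by (simp del: take_append drop_append)
      also have "\<dots> = c * ind (ins_pair (q - 2) B) y" using ins_pair_iff[OF r(2), of s t r B] r by (simp add: ind_def)
      finally show ?thesis .
    qed
    ultimately show ?thesis using K2 by (intro exI[of _ c] exI[of _ "ins_pair (q - 2) B"]) simp
  qed
qed simp

section \<open>Orthogonal projection onto the noncrossing pairings\<close>

text \<open>Gram--Schmidt, one vector at a time and without linear independence: \<open>r\<close> is
  the part of \<open>f v\<close> orthogonal to the earlier vectors. If \<open>r\<close> vanishes on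
  \<open>I\<close>, division by zero gives \<open>lam = 0\<close>, which is correct since
  \<open>ip t r = 0\<close> as well.\<close>

lemma orthogonal_projection_exists:
  fixes f :: "'v \<Rightarrow> 'i \<Rightarrow> real" and t :: "'i \<Rightarrow> real"
  assumes "finite V" and I: "finite I"
  shows "\<exists>c. \<forall>B\<in>V. (\<Sum>i\<in>I. (\<Sum>A\<in>V. c A * f A i) * f B i) = (\<Sum>i\<in>I. t i * f B i)"
  using assms(1)
proof (induction V arbitrary: t rule: finite_induct)
  case (insert v V)
  define ip where "ip g h = (\<Sum>i\<in>I. g i * h i)" for g h :: "'i \<Rightarrow> real"
  define lc where "lc c = (\<lambda>i. \<Sum>A\<in>V. c A * f A i)" for c
  have ip_diff: "ip (\<lambda>i. g i - g' i) h = ip g h - ip g' h" and ip_add: "ip (\<lambda>i. g i + g' i) h = ip g h + ip g' h"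
    and ip_scale: "ip (\<lambda>i. c * g i) h = c * ip g h" and ip_comm: "ip g h = ip h g" for g g' h c
    by (simp_all add: ip_def left_diff_distrib distrib_right sum_subtractf sum.distrib sum_distrib_left mult.assoc) (simp add: mult.commute)
  have ip_lc: "ip g (lc c) = (\<Sum>A\<in>V. c A * ip g (f A))" for g c
  proof -
    have "ip g (lc c) = (\<Sum>i\<in>I. \<Sum>A\<in>V. c A * (g i * f A i))"
      unfolding ip_def lc_def by (simp add: sum_distrib_left mult.left_commute)
    also have "\<dots> = (\<Sum>A\<in>V. c A * ip g (f A))" unfolding ip_def sum_distrib_left by (rule sum.swap)
    finally show ?thesis .
  qed
  obtain c0 where c0: "\<And>B. B \<in> V \<Longrightarrow> ip (lc c0) (f B) = ip (f v) (f B)"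
    using insert.IH[of "f v"] unfolding ip_def lc_def by blast
  obtain c1 where c1: "\<And>B. B \<in> V \<Longrightarrow> ip (lc c1) (f B) = ip t (f B)"
    using insert.IH[of t] unfolding ip_def lc_def by blast
  define r where "r = (\<lambda>i. f v i - lc c0 i)"
  have rV: "ip r (f B) = 0" if "B \<in> V" for B unfolding r_def ip_diff using c0[OF that] by simp
  define lam where "lam = ip t r / ip r r"
  define u where "u = (\<lambda>i. lc c1 i + lam * r i)"
  have uV: "ip u (f B) = ip t (f B)" if "B \<in> V" for B
    unfolding u_def ip_add ip_scale using c1[OF that] rV[OF that] by simp
  have ur: "ip u r = ip t r"
  proof -
    have "ip (lc c1) r = 0" unfolding ip_comm[of _ r] ip_lc using rV by simp
    then have "ip u r = lam * ip r r" unfolding u_def ip_add ip_scale by simp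
    moreover have "ip t r = 0" if "ip r r = 0"
    proof -
      have "r i = 0" if "i \<in> I" for i
        using \<open>ip r r = 0\<close> that I unfolding ip_def by (simp add: sum_nonneg_eq_0_iff)
      then show ?thesis unfolding ip_def by simp
    qed
    ultimately show ?thesis unfolding lam_def by auto
  qed
  have fv: "f v i = r i + lc c0 i" for i by (simp add: r_def)
  have "ip g (f v) = ip g r + ip g (lc c0)" for g
    unfolding ip_comm[of g] fv ip_add by simp
  then have uv: "ip u (f v) = ip t (f v)" using ur uV by (simp add: ip_lc)
  define c where "c A = (if A = v then lam else c1 A - lam * c0 A)" for A
  have "(\<Sum>A\<in>insert v V. c A * f A i) = u i" for i
  proof -
    have "(\<Sum>A\<in>V. c A * f A i) = (\<Sum>A\<in>V. c1 A * f A i - lam * (c0 A * f A i))"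
      using insert.hyps by (intro sum.cong) (auto simp: c_def algebra_simps)
    also have "\<dots> = lc c1 i - lam * lc c0 i"
      unfolding lc_def by (simp add: sum_subtractf sum_distrib_left)
    finally show ?thesis using insert.hyps by (simp add: c_def u_def r_def algebra_simps)
  qed
  then show ?case using uV uv unfolding ip_def by (intro exI[of _ c]) auto
qed simp

text \<open>The coefficients are not unique when the pairings are linearly dependent on the index
  lists, as for \<open>n = 1\<close>. One choice is fixed for each column \<open>j\<close>, and
  everything below rests on the defining equation alone.\<close>

definition nc_proj_coeff :: "nat \<Rightarrow> nat list \<Rightarrow> nat list set \<Rightarrow> real" where
  "nc_proj_coeff n j = (SOME c. \<forall>B\<in>{A. ncv (length j) A}.
     (\<Sum>i\<in>idx_lists n (length j). (\<Sum>A | ncv (length j) A. c A * ind A i) * ind B i) = ind B j)"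

definition nc_proj :: "nat \<Rightarrow> nat list \<Rightarrow> nat list \<Rightarrow> real" where
  "nc_proj n i j = (\<Sum>A | ncv (length j) A. nc_proj_coeff n j A * ind A i)"

lemma nc_proj_orth:
  assumes "j \<in> idx_lists n K" "ncv K B"
  shows "(\<Sum>i\<in>idx_lists n K. nc_proj n i j * ind B i) = ind B j"
proof -
  have len: "length j = K" using assms by (simp add: idx_lists_def)
  have "\<exists>c. \<forall>B\<in>{A. ncv K A}.
     (\<Sum>i\<in>idx_lists n K. (\<Sum>A | ncv K A. c A * ind A i) * ind B i) =
     (\<Sum>i\<in>idx_lists n K. (if i = j then 1 else 0) * ind B i)"
    by (rule orthogonal_projection_exists[OF finite_ncv finite_idx_lists])
  moreover have "(\<Sum>i\<in>idx_lists n K. (if i = j then 1 else 0) * ind B i) = ind B j" for B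
    using assms(1) finite_idx_lists by (simp add: if_distrib[of "\<lambda>x. x * _"] cong: if_cong)
  ultimately have ex: "\<exists>c. \<forall>B\<in>{A. ncv (length j) A}.
     (\<Sum>i\<in>idx_lists n (length j). (\<Sum>A | ncv (length j) A. c A * ind A i) * ind B i) = ind B j"
    unfolding len by simp
  from someI_ex[OF ex] show ?thesis using assms(2) len by (simp add: nc_proj_def nc_proj_coeff_def)
qed

text \<open>This is \<open>P = P^t P\<close>: one column is expanded in pairings, against which the
  other one is evaluated by \<open>nc_proj_orth\<close>. Symmetry of the projection is read off from
  it.\<close>

lemma nc_proj_gram:
  assumes "i \<in> idx_lists n K" "j \<in> idx_lists n K"
  shows "nc_proj n i j = (\<Sum>k\<in>idx_lists n K. nc_proj n k i * nc_proj n k j)"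
proof -
  have len: "length j = K" using assms by (simp add: idx_lists_def)
  have "(\<Sum>k\<in>idx_lists n K. nc_proj n k i * nc_proj n k j) =
      (\<Sum>k\<in>idx_lists n K. \<Sum>A | ncv K A. nc_proj_coeff n j A * (nc_proj n k i * ind A k))"
    unfolding nc_proj_def[of n _ j] len by (simp add: sum_distrib_left mult.left_commute)
  also have "\<dots> = (\<Sum>A | ncv K A. nc_proj_coeff n j A * (\<Sum>k\<in>idx_lists n K. nc_proj n k i * ind A k))"
    unfolding sum_distrib_left by (rule sum.swap)
  also have "\<dots> = nc_proj n i j"
    unfolding nc_proj_def[of n i j] len using nc_proj_orth[OF assms(1)] by (intro sum.cong) auto
  finally show ?thesis by simp
qed

lemma nc_proj_sym: "i \<in> idx_lists n K \<Longrightarrow> j \<in> idx_lists n K \<Longrightarrow> nc_proj n i j = nc_proj n j i"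
  using nc_proj_gram[of i n K j] nc_proj_gram[of j n K i] by (simp add: mult.commute)

lemma nc_proj_Nil: "nc_proj n [] [] = 1"
proof -
  have "idx_lists n 0 = {[]}" by (auto simp: idx_lists_def)
  then show ?thesis using nc_proj_orth[of "[]" n 0 "{[]}"] ncv_Nil by (simp add: ind_def)
qed

text \<open>The projections commute with the insertion of a pair, because both the insertion and its adjoint
  preserve the spans of the noncrossing pairings.\<close>

lemma nc_proj_cup:
  assumes ab: "a @ b \<in> idx_lists n K" and cd: "c @ d \<in> idx_lists n K" "length c = length a"
    and st: "s < n" "t < n"
  shows "(\<Sum>k<n. nc_proj n (c @ s # t # d) (a @ k # k # b)) = (if s = t then nc_proj n (c @ d) (a @ b) else 0)"
proof -
  define p where "p = length a"
  let ?I = "idx_lists n (Suc (Suc K))"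
  have pK: "p \<le> K" using ab by (auto simp: p_def idx_lists_def)
  have lab: "length (a @ b) = K" "length (a @ k # k' # b) = Suc (Suc K)" for k k' using ab by (auto simp: idx_lists_def)
  \<comment> \<open>In \<open>v\<close> the pair is inserted before projecting, in \<open>v'\<close>
    after it. Both lie in the span of the pairings of \<open>Suc (Suc K)\<close> points
    (\<open>span\<close>), and their difference \<open>w\<close> is orthogonal to that span
    (\<open>orth\<close>), hence 0.\<close>
  define v where "v x = (\<Sum>k<n. nc_proj n x (a @ k # k # b))" for x
  define v' where "v' x = (\<Sum>A | ncv K A. nc_proj_coeff n (a @ b) A * ind (ins_pair p A) x)" for x
  define w where "w x = v x - v' x" for x
  have v'_split: "v' (c @ s # t # d) = (if s = t then nc_proj n (c @ d) (a @ b) else 0)" if "length c = p" for c s t d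
    unfolding v'_def nc_proj_def lab(1) using that by (simp add: ind_def ins_pair_iff)
  have span: "(\<Sum>x\<in>?I. v x * g x) = 0 \<and> (\<Sum>x\<in>?I. v' x * g x) = 0"
    if g: "\<And>B. ncv (Suc (Suc K)) B \<Longrightarrow> (\<Sum>x\<in>?I. g x * ind B x) = 0" for g
  proof
    have "(\<Sum>x\<in>?I. v x * g x) = (\<Sum>x\<in>?I. \<Sum>k<n. \<Sum>A | ncv (Suc (Suc K)) A. nc_proj_coeff n (a @ k # k # b) A * (g x * ind A x))"
      unfolding v_def nc_proj_def lab(2) sum_distrib_right by (intro sum.cong refl) (simp only: mult_ac)
    also have "\<dots> = (\<Sum>k<n. \<Sum>A | ncv (Suc (Suc K)) A. nc_proj_coeff n (a @ k # k # b) A * (\<Sum>x\<in>?I. g x * ind A x))"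
      unfolding sum_distrib_left by (subst sum.swap, rule sum.cong[OF refl], rule sum.swap)
    also have "\<dots> = 0" using g by simp
    finally show "(\<Sum>x\<in>?I. v x * g x) = 0" .
    have "(\<Sum>x\<in>?I. v' x * g x) = (\<Sum>x\<in>?I. \<Sum>A | ncv K A. nc_proj_coeff n (a @ b) A * (g x * ind (ins_pair p A) x))"
      unfolding v'_def sum_distrib_right by (intro sum.cong refl) (simp only: mult_ac)
    also have "\<dots> = (\<Sum>A | ncv K A. nc_proj_coeff n (a @ b) A * (\<Sum>x\<in>?I. g x * ind (ins_pair p A) x))"
      unfolding sum_distrib_left by (rule sum.swap)
    also have "\<dots> = 0" using g ncv_ins[OF _ pK] by simp
    finally show "(\<Sum>x\<in>?I. v' x * g x) = 0" .
  qed
  have orth: "(\<Sum>x\<in>?I. w x * ind B x) = 0" if B: "ncv (Suc (Suc K)) B" for B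
  proof -
    obtain m B' where B': "ncv K B'"
      "\<And>y. y \<in> idx_lists n K \<Longrightarrow> (\<Sum>k<n. ind B (take p y @ k # k # drop p y)) = m * ind B' y"
      using ncv_contract[OF B, of p n] pK by auto
    have "(\<Sum>x\<in>?I. v x * ind B x) = (\<Sum>k<n. \<Sum>x\<in>?I. nc_proj n x (a @ k # k # b) * ind B x)"
      unfolding v_def sum_distrib_right by (rule sum.swap)
    also have "\<dots> = (\<Sum>k<n. ind B (a @ k # k # b))"
      using ab by (intro sum.cong refl nc_proj_orth[OF _ B]) (auto simp: idx_lists_def)
    also have "\<dots> = m * ind B' (a @ b)" using B'(2)[OF ab] by (simp add: p_def)
    finally have 1: "(\<Sum>x\<in>?I. v x * ind B x) = m * ind B' (a @ b)" .
    have "(\<Sum>x\<in>?I. v' x * ind B x) = (\<Sum>y\<in>idx_lists n K. \<Sum>s<n. \<Sum>t<n.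
        v' (take p y @ s # t # drop p y) * ind B (take p y @ s # t # drop p y))"
      by (rule sum_idx_lists_insert[OF pK])
    also have "\<dots> = (\<Sum>y\<in>idx_lists n K. \<Sum>s<n. \<Sum>t<n. if t = s then nc_proj n y (a @ b) * ind B (take p y @ s # t # drop p y) else 0)"
    proof (intro sum.cong refl)
      fix y s t assume "y \<in> idx_lists n K"
      then have "length (take p y) = p" using pK by (simp add: idx_lists_def)
      from v'_split[OF this, of s t "drop p y"]
      show "v' (take p y @ s # t # drop p y) * ind B (take p y @ s # t # drop p y) =
        (if t = s then nc_proj n y (a @ b) * ind B (take p y @ s # t # drop p y) else 0)" by simp
    qed
    also have "\<dots> = (\<Sum>y\<in>idx_lists n K. nc_proj n y (a @ b) * (\<Sum>s<n. ind B (take p y @ s # s # drop p y)))"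
      by (simp add: sum_distrib_left)
    also have "\<dots> = (\<Sum>y\<in>idx_lists n K. nc_proj n y (a @ b) * (m * ind B' y))" by (intro sum.cong refl) (simp add: B'(2))
    also have "\<dots> = m * ind B' (a @ b)"
      using nc_proj_orth[OF ab B'(1)] by (simp add: sum_distrib_left[symmetric] mult.left_commute)
    finally show ?thesis using 1 by (simp add: w_def left_diff_distrib sum_subtractf)
  qed
  have "(\<Sum>x\<in>?I. w x * w x) = 0"
    using span[of w] orth unfolding w_def[of "_"] by (simp add: left_diff_distrib sum_subtractf)
  moreover have "c @ s # t # d \<in> ?I" using cd st by (auto simp: idx_lists_def)
  ultimately have "w (c @ s # t # d) = 0"
    using finite_idx_lists by (simp add: sum_nonneg_eq_0_iff)
  then show ?thesis using v'_split[of c s t d] cd(2) by (simp add: w_def v_def p_def)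
qed

section \<open>Functionals on the free algebra and the ideal of relations\<close>

lemma supp_lc: "ncp_supp (\<lambda>w. \<Sum>x\<in>F. c x * ncp_mono (g x) w) \<subseteq> g ` F"
proof
  fix w assume w: "w \<in> ncp_supp (\<lambda>w. \<Sum>x\<in>F. c x * ncp_mono (g x) w)"
  show "w \<in> g ` F"
  proof (rule ccontr)
    assume "w \<notin> g ` F"
    then have "(\<Sum>x\<in>F. c x * ncp_mono (g x) w) = 0" by (intro sum.neutral) (auto simp: ncp_mono_def)
    then show False using w by (simp add: ncp_supp_def)
  qed
qed

lemma finite_supp_lc: "finite F \<Longrightarrow> finite (ncp_supp (\<lambda>w. \<Sum>x\<in>F. c x * ncp_mono (g x) w))"
  by (rule finite_subset[OF supp_lc]) simp

lemma ncp_eval_superset: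
  assumes "finite S" "ncp_supp p \<subseteq> S"
  shows "ncp_eval h p = (\<Sum>w\<in>S. p w * h w)"
  unfolding ncp_eval_def using assms by (intro sum.mono_neutral_left) (auto simp: ncp_supp_def)

text \<open>The words \<open>g x\<close> may repeat, so polynomials can be handled through an index
  set without computing their coefficients or supports.\<close>

lemma ncp_eval_lc:
  assumes "finite F"
  shows "ncp_eval h (\<lambda>w. \<Sum>x\<in>F. c x * ncp_mono (g x) w) = (\<Sum>x\<in>F. c x * h (g x))"
proof -
  have "ncp_eval h (\<lambda>w. \<Sum>x\<in>F. c x * ncp_mono (g x) w) = (\<Sum>w\<in>g ` F. \<Sum>x\<in>F. c x * (ncp_mono (g x) w * h w))"
    unfolding ncp_eval_superset[OF finite_imageI[OF assms] supp_lc] sum_distrib_right by (simp only: mult.assoc)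
  also have "\<dots> = (\<Sum>x\<in>F. \<Sum>w\<in>g ` F. c x * (ncp_mono (g x) w * h w))" by (rule sum.swap)
  also have "\<dots> = (\<Sum>x\<in>F. c x * h (g x))"
  proof (intro sum.cong refl)
    fix x assume x: "x \<in> F"
    have "(\<Sum>w\<in>g ` F. c x * (ncp_mono (g x) w * h w)) = (\<Sum>w\<in>g ` F. if w = g x then c x * h w else 0)"
      by (intro sum.cong) (auto simp: ncp_mono_def)
    then show "(\<Sum>w\<in>g ` F. c x * (ncp_mono (g x) w * h w)) = c x * h (g x)" using x assms by simp
  qed
  finally show ?thesis .
qed

lemma mono_convolution: "(\<Sum>i\<le>length w. ncp_mono u (take i w) * ncp_mono v (drop i w)) = ncp_mono (u @ v) w"
proof -
  have prod_ind: "(if A then 1 else 0) * (if B then 1 else (0::complex)) = (if C then (if D then 1 else 0) else 0)"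
    if "A \<and> B \<longleftrightarrow> C \<and> D" for A B C D
    using that by (cases A; cases B) auto
  have "(\<Sum>i\<le>length w. ncp_mono u (take i w) * ncp_mono v (drop i w)) =
      (\<Sum>i\<le>length w. if i = length u then (if w = u @ v then 1 else 0) else 0)"
  proof (intro sum.cong refl)
    fix i assume i: "i \<in> {..length w}"
    have "take i w = u \<and> drop i w = v \<longleftrightarrow> i = length u \<and> w = u @ v"
    proof
      assume *: "take i w = u \<and> drop i w = v"
      then have "length u = i" using i by (metis atMost_iff length_take min.absorb2)
      moreover have "w = u @ v" using * append_take_drop_id[of i w] by simp
      ultimately show "i = length u \<and> w = u @ v" by simp
    qed simp
    then show "ncp_mono u (take i w) * ncp_mono v (drop i w) = (if i = length u then (if w = u @ v then 1 else 0) else 0)"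
      unfolding ncp_mono_def by (rule prod_ind)
  qed
  then show ?thesis by (auto simp: ncp_mono_def)
qed

lemma ncp_mult_lc:
  "ncp_mult (\<lambda>w. \<Sum>x\<in>F. c x * ncp_mono (g x) w) (\<lambda>w. \<Sum>y\<in>G. d y * ncp_mono (g' y) w) =
    (\<lambda>w. \<Sum>x\<in>F. \<Sum>y\<in>G. (c x * d y) * ncp_mono (g x @ g' y) w)"
proof
  fix w
  have "ncp_mult (\<lambda>w. \<Sum>x\<in>F. c x * ncp_mono (g x) w) (\<lambda>w. \<Sum>y\<in>G. d y * ncp_mono (g' y) w) w =
      (\<Sum>i\<le>length w. \<Sum>x\<in>F. \<Sum>y\<in>G. (c x * d y) * (ncp_mono (g x) (take i w) * ncp_mono (g' y) (drop i w)))"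
    unfolding ncp_mult_def sum_product by (simp add: mult_ac)
  also have "\<dots> = (\<Sum>x\<in>F. \<Sum>y\<in>G. (c x * d y) * (\<Sum>i\<le>length w. ncp_mono (g x) (take i w) * ncp_mono (g' y) (drop i w)))"
    unfolding sum_distrib_left by (subst sum.swap, rule sum.cong[OF refl], rule sum.swap)
  finally show "ncp_mult (\<lambda>w. \<Sum>x\<in>F. c x * ncp_mono (g x) w) (\<lambda>w. \<Sum>y\<in>G. d y * ncp_mono (g' y) w) w =
    (\<Sum>x\<in>F. \<Sum>y\<in>G. (c x * d y) * ncp_mono (g x @ g' y) w)"
    unfolding mono_convolution .
qed

lemma ncp_sandwich_lc:
  "ncp_mult (ncp_mult (ncp_mono a) (\<lambda>w. \<Sum>x\<in>F. c x * ncp_mono (g x) w)) (ncp_mono b) =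
    (\<lambda>w. \<Sum>x\<in>F. c x * ncp_mono (a @ g x @ b) w)"
proof -
  have 1: "ncp_mult (ncp_mono a) (\<lambda>w. \<Sum>x\<in>F. c x * ncp_mono (g x) w) = (\<lambda>w. \<Sum>x\<in>F. c x * ncp_mono (a @ g x) w)"
    using ncp_mult_lc[of "\<lambda>_. 1" "\<lambda>_. a" "{()}" c g F] by simp
  have "ncp_mult (\<lambda>w. \<Sum>x\<in>F. c x * ncp_mono (a @ g x) w) (ncp_mono b) = (\<lambda>w. \<Sum>x\<in>F. c x * ncp_mono ((a @ g x) @ b) w)"
    using ncp_mult_lc[of c "\<lambda>x. a @ g x" F "\<lambda>_. 1" "\<lambda>_. b" "{()}"] by simp
  then show ?thesis unfolding 1 by simp
qed

lemma zip_gens: "set u \<subseteq> {..<n} \<Longrightarrow> set v \<subseteq> {..<n} \<Longrightarrow> set (zip u v) \<subseteq> gens n"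
  by (auto simp: gens_def dest: set_zip_leftD set_zip_rightD)

lemma gens_map:
  assumes "set a \<subseteq> gens n"
  shows "set (map fst a) \<subseteq> {..<n}" "set (map snd a) \<subseteq> {..<n}"
proof -
  have "fst x < n \<and> snd x < n" if "x \<in> set a" for x
    using subsetD[OF assms that] by (auto simp: gens_def)
  then show "set (map fst a) \<subseteq> {..<n}" "set (map snd a) \<subseteq> {..<n}" by auto
qed

text \<open>Writes an orthogonality relation as one combination of \<open>Suc n\<close> monomials:
  the indices below \<open>n\<close> stand for the quadratic words, the index \<open>n\<close> for
  the empty word with its coefficient.\<close>

definition rel_coeff :: "nat \<Rightarrow> nat \<Rightarrow> nat \<Rightarrow> nat \<Rightarrow> complex" where
  "rel_coeff n i j k = (if k < n then 1 else if i = j then - 1 else 0)"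

lemma sum_rel_coeff:
  "(\<Sum>k<Suc n. rel_coeff n i j k * F (if k < n then g k else [])) = (\<Sum>k<n. F (g k)) - (if i = j then F [] else 0)"
proof -
  have "(\<Sum>k<n. rel_coeff n i j k * F (if k < n then g k else [])) = (\<Sum>k<n. F (g k))"
    by (intro sum.cong) (auto simp: rel_coeff_def)
  then show ?thesis by (simp add: rel_coeff_def)
qed

lemma sum_mono_words:
  fixes n :: nat
  assumes "inj_on g {..<n}"
  shows "(\<Sum>k<n. ncp_mono (g k) w) = (if \<exists>k<n. w = g k then 1 else 0)"
proof (cases "\<exists>k<n. w = g k")
  case True
  then obtain k where k: "k < n" "w = g k" by blast
  have "(\<Sum>l<n. ncp_mono (g l) w) = (\<Sum>l<n. if l = k then 1 else (0::complex))"
    using k assms by (intro sum.cong) (auto simp: ncp_mono_def inj_on_def)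
  also have "\<dots> = 1" using k by simp
  finally show ?thesis using True by simp
next
  case False
  then show ?thesis by (auto simp: ncp_mono_def intro!: sum.neutral)
qed

lemma rel_lc_eq:
  assumes "inj_on g {..<n}"
  shows "(\<lambda>w. \<Sum>k<Suc n. rel_coeff n i j k * ncp_mono (if k < n then g k else []) w) =
    (\<lambda>w. (if \<exists>k<n. w = g k then 1 else 0) - (if i = j \<and> w = [] then 1 else 0))"
proof
  fix w
  have "(\<Sum>k<Suc n. rel_coeff n i j k * ncp_mono (if k < n then g k else []) w) =
      (\<Sum>k<n. ncp_mono (g k) w) - (if i = j then ncp_mono [] w else 0)"
    by (rule sum_rel_coeff)
  also have "\<dots> = (if \<exists>k<n. w = g k then 1 else 0) - (if i = j \<and> w = [] then 1 else 0)"
    unfolding sum_mono_words[OF assms] by (simp add: ncp_mono_def)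
  finally show "(\<Sum>k<Suc n. rel_coeff n i j k * ncp_mono (if k < n then g k else []) w) =
    (if \<exists>k<n. w = g k then 1 else 0) - (if i = j \<and> w = [] then 1 else 0)" .
qed

lemma inj_rel_words: "inj_on (\<lambda>k. [(i,k),(j,k)]) S" "inj_on (\<lambda>k. [(k,i),(k,j)]) S"
  by (auto simp: inj_on_def)

lemma orth_rels_eq:
  "orth_rels n =
    {(\<lambda>w. \<Sum>k<Suc n. rel_coeff n i j k * ncp_mono (if k < n then [(i,k),(j,k)] else []) w) | i j. i < n \<and> j < n}
  \<union> {(\<lambda>w. \<Sum>k<Suc n. rel_coeff n i j k * ncp_mono (if k < n then [(k,i),(k,j)] else []) w) | i j. i < n \<and> j < n}"
  unfolding orth_rels_def rel_lc_eq[OF inj_rel_words(1)] rel_lc_eq[OF inj_rel_words(2)] ..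

lemma eval_sandwich:
  "ncp_eval h (ncp_mult (ncp_mult (ncp_mono a)
      (\<lambda>w. \<Sum>k<Suc n. rel_coeff n i j k * ncp_mono (if k < n then g k else []) w)) (ncp_mono b)) =
    (\<Sum>k<n. h (a @ g k @ b)) - (if i = j then h (a @ b) else 0)"
  unfolding ncp_sandwich_lc ncp_eval_lc[OF finite_lessThan]
  using sum_rel_coeff[of n i j "\<lambda>v. h (a @ v @ b)" g] by simp

lemma ideal_killed:
  assumes r1: "\<And>i j a b. i < n \<Longrightarrow> j < n \<Longrightarrow> set a \<subseteq> gens n \<Longrightarrow> set b \<subseteq> gens n \<Longrightarrow>
      (\<Sum>k<n. h (a @ [(i,k),(j,k)] @ b)) = (if i = j then h (a @ b) else 0)"
    and r2: "\<And>i j a b. i < n \<Longrightarrow> j < n \<Longrightarrow> set a \<subseteq> gens n \<Longrightarrow> set b \<subseteq> gens n \<Longrightarrow>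
      (\<Sum>k<n. h (a @ [(k,i),(k,j)] @ b)) = (if i = j then h (a @ b) else 0)"
    and p: "p \<in> orth_ideal n"
  shows "ncp_eval h p = 0"
proof -
  \<comment> \<open>Finiteness of the support is carried along because a sum over an infinite
    support defaults to 0, which would break additivity of \<open>ncp_eval\<close>.\<close>
  have "finite (ncp_supp p) \<and> ncp_eval h p = 0"
    using p
  proof (induction rule: orth_ideal.induct)
    case zero
    then show ?case by (simp add: ncp_supp_def ncp_eval_def)
  next
    case (gen r a b)
    have fin: "finite (ncp_supp (ncp_mult (ncp_mult (ncp_mono a)
        (\<lambda>w. \<Sum>k<Suc n. rel_coeff n i j k * ncp_mono (g k) w)) (ncp_mono b)))" for i j g
      unfolding ncp_sandwich_lc by (rule finite_supp_lc) simp
    consider i j where "i < n" "j < n"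
        "r = (\<lambda>w. \<Sum>k<Suc n. rel_coeff n i j k * ncp_mono (if k < n then [(i,k),(j,k)] else []) w)"
      | i j where "i < n" "j < n"
        "r = (\<lambda>w. \<Sum>k<Suc n. rel_coeff n i j k * ncp_mono (if k < n then [(k,i),(k,j)] else []) w)"
      using gen(1) unfolding orth_rels_eq by blast
    then show ?case
    proof cases
      case (1 i j)
      show ?thesis unfolding 1(3) eval_sandwich r1[OF 1(1,2) gen(2,3)] by (rule conjI[OF fin]) simp
    next
      case (2 i j)
      show ?thesis unfolding 2(3) eval_sandwich r2[OF 2(1,2) gen(2,3)] by (rule conjI[OF fin]) simp
    qed
  next
    case (add p q)
    let ?S = "ncp_supp p \<union> ncp_supp q"
    have sub: "ncp_supp (\<lambda>w. p w + q w) \<subseteq> ?S" by (auto simp: ncp_supp_def)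
    have fin: "finite ?S" using add by simp
    have "ncp_eval h (\<lambda>w. p w + q w) = (\<Sum>w\<in>?S. p w * h w) + (\<Sum>w\<in>?S. q w * h w)"
      unfolding ncp_eval_superset[OF fin sub] by (simp add: distrib_right sum.distrib)
    also have "\<dots> = ncp_eval h p + ncp_eval h q"
      using ncp_eval_superset[OF fin, of p h] ncp_eval_superset[OF fin, of q h] by simp
    finally show ?case using add finite_subset[OF sub fin] by simp
  next
    case (smul p c)
    have sub: "ncp_supp (\<lambda>w. c * p w) \<subseteq> ncp_supp p" by (auto simp: ncp_supp_def)
    have fin: "finite (ncp_supp p)" using smul by simp
    have "ncp_eval h (\<lambda>w. c * p w) = c * ncp_eval h p"
      unfolding ncp_eval_superset[OF fin sub] by (simp add: ncp_eval_def sum_distrib_left mult.assoc)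
    then show ?case using smul finite_subset[OF sub fin] by simp
  qed
  then show ?thesis by blast
qed

text \<open>The relations for the rows are \<open>nc_proj_cup\<close>; those for the columns follow
  by the symmetry of the projection.\<close>

lemma nc_proj_kills_ideal:
  assumes "p \<in> orth_ideal n"
  shows "ncp_eval (\<lambda>w. complex_of_real (nc_proj n (map fst w) (map snd w))) p = 0"
proof (rule ideal_killed[OF _ _ assms])
  fix i j and a b :: "(nat \<times> nat) list"
  assume ij: "i < n" "j < n" and ab: "set a \<subseteq> gens n" "set b \<subseteq> gens n"
  let ?K = "length a + length b"
  have f: "map fst a @ map fst b \<in> idx_lists n ?K" and g: "map snd a @ map snd b \<in> idx_lists n ?K"
    using gens_map[OF ab(1)] gens_map[OF ab(2)] by (auto simp: idx_lists_def)
  have "(\<Sum>k<n. nc_proj n (map fst a @ i # j # map fst b) (map snd a @ k # k # map snd b)) =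
      (if i = j then nc_proj n (map fst a @ map fst b) (map snd a @ map snd b) else 0)"
    by (rule nc_proj_cup[OF g f _ ij]) simp
  then show "(\<Sum>k<n. complex_of_real (nc_proj n (map fst (a @ [(i,k),(j,k)] @ b)) (map snd (a @ [(i,k),(j,k)] @ b)))) =
      (if i = j then complex_of_real (nc_proj n (map fst (a @ b)) (map snd (a @ b))) else 0)"
    by (simp flip: of_real_sum)
  have "(\<Sum>k<n. nc_proj n (map fst a @ k # k # map fst b) (map snd a @ i # j # map snd b)) =
      (\<Sum>k<n. nc_proj n (map snd a @ i # j # map snd b) (map fst a @ k # k # map fst b))"
    using f g ij by (intro sum.cong refl nc_proj_sym[of _ n "Suc (Suc ?K)"]) (auto simp: idx_lists_def)
  also have "\<dots> = (if i = j then nc_proj n (map snd a @ map snd b) (map fst a @ map fst b) else 0)"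
    by (rule nc_proj_cup[OF f g _ ij]) simp
  also have "\<dots> = (if i = j then nc_proj n (map fst a @ map fst b) (map snd a @ map snd b) else 0)"
    using nc_proj_sym[OF f g] by simp
  finally show "(\<Sum>k<n. complex_of_real (nc_proj n (map fst (a @ [(k,i),(k,j)] @ b)) (map snd (a @ [(k,i),(k,j)] @ b)))) =
      (if i = j then complex_of_real (nc_proj n (map fst (a @ b)) (map snd (a @ b))) else 0)"
    by (simp flip: of_real_sum)
qed

section \<open>Identification of the Haar state\<close>

text \<open>The pairings are fixed vectors of the tensor powers of the fundamental representation.
  An inserted pair produces the neighbours \<open>[(s,u),(s,v)]\<close>, whose sum over
  \<open>s\<close> is 1 or 0 according to \<open>u = v\<close> by the column relation; the remaining
  pairs are the induction hypothesis.\<close>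

lemma haar_fixes_pairings:
  assumes h: "h [] = 1" "\<And>p. p \<in> orth_ideal n \<Longrightarrow> ncp_eval h p = 0"
    and "ncv K A" "j \<in> idx_lists n K"
  shows "(\<Sum>x\<in>idx_lists n K. complex_of_real (ind A x) * h (zip x j)) = complex_of_real (ind A j)"
  using assms(3,4)
proof (induction arbitrary: j rule: ncv.induct)
  case ncv_Nil
  have "idx_lists n 0 = {[]}" by (auto simp: idx_lists_def)
  then show ?case using ncv_Nil h(1) by (simp add: ind_def)
next
  case (ncv_ins K A p)
  have "Suc (Suc p) \<le> length j" using ncv_ins by (simp add: idx_lists_def)
  then obtain a u v b where j: "j = a @ u # v # b" "length a = p" by (rule split_pair_at)
  have ab: "a @ b \<in> idx_lists n K" and uv: "u < n" "v < n"
    using ncv_ins.prems j by (auto simp: idx_lists_def)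
  have "(\<Sum>x\<in>idx_lists n (Suc (Suc K)). complex_of_real (ind (ins_pair p A) x) * h (zip x j)) =
    (\<Sum>y\<in>idx_lists n K. \<Sum>s<n. \<Sum>t<n. complex_of_real (ind (ins_pair p A) (take p y @ s # t # drop p y)) * h (zip (take p y @ s # t # drop p y) j))"
    by (rule sum_idx_lists_insert[OF ncv_ins.hyps(2)])
  also have "\<dots> = (\<Sum>y\<in>idx_lists n K. complex_of_real (ind A y) * (if u = v then h (zip y (a @ b)) else 0))"
  proof (intro sum.cong refl)
    fix y assume y: "y \<in> idx_lists n K"
    have len: "length (take p y) = p" using y ncv_ins.hyps by (simp add: idx_lists_def)
    let ?a = "zip (take p y) a" and ?b = "zip (drop p y) b"
    have "set (take p y) \<subseteq> {..<n}" "set (drop p y) \<subseteq> {..<n}"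
      using y order.trans[OF set_take_subset[of p y]] order.trans[OF set_drop_subset[of p y]]
      by (auto simp only: idx_lists_def mem_Collect_eq)
    moreover have "set a \<subseteq> {..<n}" "set b \<subseteq> {..<n}" using ab by (simp_all add: idx_lists_def)
    ultimately have gg: "set ?a \<subseteq> gens n" "set ?b \<subseteq> gens n" by (simp_all add: zip_gens)
    have "(\<Sum>s<n. h (?a @ [(s,u),(s,v)] @ ?b)) = (if u = v then h (?a @ ?b) else 0)"
    proof -
      have "(\<lambda>w. \<Sum>k<Suc n. rel_coeff n u v k * ncp_mono (if k < n then [(k,u),(k,v)] else []) w) \<in> orth_rels n"
        unfolding orth_rels_eq using uv by blast
      from h(2)[OF orth_ideal.gen[OF this gg]] show ?thesis unfolding eval_sandwich by simp
    qed
    moreover have "?a @ ?b = zip y (a @ b)"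
      using len j(2) by (metis append_take_drop_id zip_append)
    ultimately have S: "(\<Sum>s<n. h (?a @ [(s,u),(s,v)] @ ?b)) = (if u = v then h (zip y (a @ b)) else 0)" by simp
    have "(\<Sum>s<n. \<Sum>t<n. complex_of_real (ind (ins_pair p A) (take p y @ s # t # drop p y)) * h (zip (take p y @ s # t # drop p y) j))
      = (\<Sum>s<n. \<Sum>t<n. if t = s then complex_of_real (ind A y) * h (?a @ [(s,u),(s,v)] @ ?b) else 0)"
      using len j by (intro sum.cong refl) (simp add: ind_def ins_pair_iff)
    also have "\<dots> = complex_of_real (ind A y) * (\<Sum>s<n. h (?a @ [(s,u),(s,v)] @ ?b))"
      by (simp add: sum_distrib_left)
    finally show "(\<Sum>s<n. \<Sum>t<n. complex_of_real (ind (ins_pair p A) (take p y @ s # t # drop p y)) * h (zip (take p y @ s # t # drop p y) j))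
      = complex_of_real (ind A y) * (if u = v then h (zip y (a @ b)) else 0)" unfolding S .
  qed
  also have "\<dots> = (if u = v then complex_of_real (ind A (a @ b)) else 0)"
    using ncv_ins.IH[OF ab] by simp
  also have "\<dots> = complex_of_real (ind (ins_pair p A) j)"
    using j by (simp add: ind_def ins_pair_iff)
  finally show ?case .
qed

text \<open>Write \<open>P\<close> for the matrix \<open>nc_proj\<close>. Its functional kills the
  ideal, so evaluating it on the invariance relation of \<open>h\<close> gives
  \<open>h = P h\<close>. Expanding \<open>P\<close> in pairings, which \<open>h\<close> fixes,
  gives \<open>P h = P\<close>.\<close>

theorem haar_eq_proj:
  assumes H: "haar_Onplus n h" and i: "i \<in> idx_lists n K" and j: "j \<in> idx_lists n K"
  shows "h (zip i j) = complex_of_real (nc_proj n i j)"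
proof -
  let ?h' = "\<lambda>w. complex_of_real (nc_proj n (map fst w) (map snd w))"
  have h: "h [] = 1" "\<And>p. p \<in> orth_ideal n \<Longrightarrow> ncp_eval h p = 0" using H by (auto simp: haar_Onplus_def)
  let ?w = "zip i j"
  have len: "length i = K" "length j = K" using i j by (auto simp: idx_lists_def)
  have w: "set ?w \<subseteq> gens n" "map fst ?w = i" "map snd ?w = j" "length ?w = K"
    using i j len by (simp_all add: idx_lists_def zip_gens)
  let ?q = "\<lambda>v. (\<Sum>ks\<in>idx_lists n K. h (zip ks j) * ncp_mono (zip i ks) v) - h ?w * ncp_mono [] v"
  have q: "?q \<in> orth_ideal n" 
  proof -
    have "(\<lambda>v. (\<Sum>ks\<in>idx_lists n (length ?w). h (zip ks (map snd ?w)) * ncp_mono (zip (map fst ?w) ks) v)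
        - h ?w * ncp_mono [] v) \<in> orth_ideal n"
      using H w(1) unfolding haar_Onplus_def by blast
    then show ?thesis unfolding w(2-4) .
  qed
  \<comment> \<open>The index \<open>None\<close> carries the constant term, so that the relation
    becomes one combination of monomials.\<close>
  let ?F = "insert None (Some ` idx_lists n K)"
  let ?c = "\<lambda>x. case x of None \<Rightarrow> - h ?w | Some ks \<Rightarrow> h (zip ks j)"
  let ?g = "\<lambda>x. case x of None \<Rightarrow> [] | Some ks \<Rightarrow> zip i ks"
  have finF: "finite ?F" using finite_idx_lists by simp
  have sumF: "(\<Sum>x\<in>?F. f x) = f None + (\<Sum>ks\<in>idx_lists n K. f (Some ks))" for f :: "nat list option \<Rightarrow> complex"
    using finite_idx_lists by (simp add: sum.reindex)
  have "?q = (\<lambda>v. \<Sum>x\<in>?F. ?c x * ncp_mono (?g x) v)" unfolding sumF by (simp add: fun_eq_iff)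
  then have "0 = (\<Sum>x\<in>?F. ?c x * ?h' (?g x))"
    using nc_proj_kills_ideal[OF q] ncp_eval_lc[OF finF, of ?h' ?c ?g] by simp
  also have "\<dots> = - h ?w + (\<Sum>ks\<in>idx_lists n K. h (zip ks j) * complex_of_real (nc_proj n i ks))"
    unfolding sumF using len by (auto simp: nc_proj_Nil idx_lists_def intro!: sum.cong)
  finally have "h ?w = (\<Sum>ks\<in>idx_lists n K. h (zip ks j) * complex_of_real (nc_proj n i ks))" by simp
  also have "\<dots> = (\<Sum>ks\<in>idx_lists n K. \<Sum>A | ncv K A. complex_of_real (nc_proj_coeff n i A) * (complex_of_real (ind A ks) * h (zip ks j)))"
  proof (intro sum.cong refl)
    fix ks assume "ks \<in> idx_lists n K"
    from nc_proj_sym[OF i this]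
    show "h (zip ks j) * complex_of_real (nc_proj n i ks) = (\<Sum>A | ncv K A. complex_of_real (nc_proj_coeff n i A) * (complex_of_real (ind A ks) * h (zip ks j)))"
      unfolding nc_proj_def[of n ks i] len by (simp add: sum_distrib_left mult_ac)
  qed
  also have "\<dots> = (\<Sum>A | ncv K A. complex_of_real (nc_proj_coeff n i A) * (\<Sum>ks\<in>idx_lists n K. complex_of_real (ind A ks) * h (zip ks j)))"
    unfolding sum_distrib_left by (rule sum.swap)
  also have "\<dots> = (\<Sum>A | ncv K A. complex_of_real (nc_proj_coeff n i A * ind A j))"
    using haar_fixes_pairings[OF h _ j] by (intro sum.cong) auto
  also have "\<dots> = complex_of_real (nc_proj n j i)" by (simp add: nc_proj_def len)
  also have "\<dots> = complex_of_real (nc_proj n i j)" using nc_proj_sym[OF i j] by simp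
  finally show ?thesis .
qed

section \<open>Asymptotics of the Weingarten matrix\<close>

definition compat_lists :: "nat \<Rightarrow> (nat \<Rightarrow> nat) \<Rightarrow> nat list set" where
  "compat_lists K \<pi> = {y. length y = K \<and> (\<forall>x<K. y ! x = y ! \<pi> x)}"

text \<open>The order embedding that leaves out \<open>p\<close> and \<open>Suc p\<close>; it
  transports points across the insertion of a pair.\<close>

definition skip2 :: "nat \<Rightarrow> nat \<Rightarrow> nat" where
  "skip2 p y = (if y < p then y else y + 2)"

lemma skip2_less [simp]: "skip2 p x < skip2 p y \<longleftrightarrow> x < y"
  by (auto simp: skip2_def)

lemma skip2_eq [simp]: "skip2 p x = skip2 p y \<longleftrightarrow> x = y"
  by (auto simp: skip2_def)

lemma skip2_neq [simp]: "skip2 p y \<noteq> p" "skip2 p y \<noteq> Suc p" "p \<noteq> skip2 p y" "Suc p \<noteq> skip2 p y"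
  by (auto simp: skip2_def)

lemma skip2_bound: "p \<le> K \<Longrightarrow> skip2 p y < Suc (Suc K) \<longleftrightarrow> y < K"
  by (auto simp: skip2_def)

lemma skip2_cases:
  assumes "p \<le> K" "z < Suc (Suc K)"
  obtains "z = p" | "z = Suc p" | y where "y < K" "z = skip2 p y"
proof -
  consider "z = p" | "z = Suc p" | "z < p" | "z > Suc p" by linarith
  then show ?thesis
  proof cases
    case 3 then show ?thesis using assms by (intro that(3)[of z]) (auto simp: skip2_def)
  next
    case 4 then show ?thesis using assms by (intro that(3)[of "z - 2"]) (auto simp: skip2_def)
  qed (use that in auto)
qed

lemma nth_skip2:
  assumes "length a = p"
  shows "(a @ s # t # b) ! skip2 p y = (a @ b) ! y"
  using assms by (auto simp: skip2_def nth_append numeral_2_eq_2 Suc_diff_le)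

lemma compat_lists_insert:
  assumes "p \<le> K" "\<pi> p = Suc p" "\<pi> (Suc p) = p" "\<And>y. y < K \<Longrightarrow> \<pi> (skip2 p y) = skip2 p (\<pi>0 y)"
  shows "compat_lists (Suc (Suc K)) \<pi> = ins_pair p (compat_lists K \<pi>0)"
proof -
  have "x \<in> compat_lists (Suc (Suc K)) \<pi> \<longleftrightarrow> x \<in> ins_pair p (compat_lists K \<pi>0)" if len: "length x = Suc (Suc K)" for x
  proof -
    have "Suc (Suc p) \<le> length x" using assms(1) len by simp
    then obtain a s t b where x: "x = a @ s # t # b" "length a = p" by (rule split_pair_at)
    have xs: "x ! skip2 p y = (a @ b) ! y" for y unfolding x(1) by (rule nth_skip2[OF x(2)])
    have xp: "x ! p = s" "x ! Suc p = t" using x by (auto simp: nth_append)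
    have "(\<forall>z<Suc (Suc K). x ! z = x ! \<pi> z) \<longleftrightarrow> s = t \<and> (\<forall>y<K. (a @ b) ! y = (a @ b) ! \<pi>0 y)"
    proof
      assume *: "\<forall>z<Suc (Suc K). x ! z = x ! \<pi> z"
      have "s = t" using *[rule_format, of p] assms(1,2) xp by simp
      moreover have "(a @ b) ! y = (a @ b) ! \<pi>0 y" if "y < K" for y
        using *[rule_format, of "skip2 p y"] that assms(4)[OF that] skip2_bound[OF assms(1)]
        by (simp add: xs)
      ultimately show "s = t \<and> (\<forall>y<K. (a @ b) ! y = (a @ b) ! \<pi>0 y)" by blast
    next
      assume *: "s = t \<and> (\<forall>y<K. (a @ b) ! y = (a @ b) ! \<pi>0 y)"
      show "\<forall>z<Suc (Suc K). x ! z = x ! \<pi> z"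
      proof (intro allI impI)
        fix z assume z: "z < Suc (Suc K)"
        show "x ! z = x ! \<pi> z"
          using assms(1) z
        proof (cases rule: skip2_cases)
          case (3 y)
          then show ?thesis using * assms(4) by (simp add: xs)
        qed (use * assms(2,3) xp in simp_all)
      qed
    qed
    then show ?thesis using len x by (auto simp: compat_lists_def ins_pair_iff)
  qed
  moreover have "length x = Suc (Suc K)" if "x \<in> ins_pair p (compat_lists K \<pi>0)" for x
    using that by (auto simp: ins_pair_def compat_lists_def)
  ultimately show ?thesis by (auto simp: compat_lists_def)
qed

lemma ncp_insert:
  assumes "\<pi>0 \<in> ncp {..<K}" "p \<le> K"
  shows "\<exists>\<pi>\<in>ncp {..<Suc (Suc K)}. \<pi> p = Suc p \<and> \<pi> (Suc p) = p \<and> (\<forall>y<K. \<pi> (skip2 p y) = skip2 p (\<pi>0 y))"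
proof -
  define \<pi> where "\<pi> z = (if z = p then Suc p else if z = Suc p then p else
     if z < Suc (Suc K) then skip2 p (\<pi>0 (if z < p then z else z - 2)) else z)" for z
  have 1: "\<pi> p = Suc p" "\<pi> (Suc p) = p" by (auto simp: \<pi>_def)
  have 2: "\<pi> (skip2 p y) = skip2 p (\<pi>0 y)" if "y < K" for y
  proof -
    have "(if skip2 p y < p then skip2 p y else skip2 p y - 2) = y" by (simp add: skip2_def)
    then show ?thesis using that skip2_bound[OF assms(2), of y] by (simp add: \<pi>_def)
  qed
  have r0: "\<pi>0 y < K" "\<pi>0 y \<noteq> y" "\<pi>0 (\<pi>0 y) = y" if "y < K" for y
    using ncpD[OF assms(1)] that by (auto simp: lessThan_iff[symmetric] simp del: lessThan_iff)
  have "\<pi> \<in> ncp {..<Suc (Suc K)}"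
    unfolding ncp_def mem_Collect_eq
  proof (intro conjI allI impI ballI)
    fix z assume "z \<notin> {..<Suc (Suc K)}"
    then show "\<pi> z = z" using assms(2) by (auto simp: \<pi>_def)
  next
    fix z assume "z \<in> {..<Suc (Suc K)}"
    then have z: "z < Suc (Suc K)" by simp
    with assms(2) have "\<pi> z < Suc (Suc K) \<and> \<pi> z \<noteq> z \<and> \<pi> (\<pi> z) = z"
    proof (cases rule: skip2_cases)
      case (3 y)
      then show ?thesis using 2 r0 skip2_bound[OF assms(2)] by simp
    qed (use 1 assms(2) in simp_all)
    then show "\<pi> z \<in> {..<Suc (Suc K)}" "\<pi> z \<noteq> z" "\<pi> (\<pi> z) = z" by auto
  next
    fix a b assume "a \<in> {..<Suc (Suc K)}" "b \<in> {..<Suc (Suc K)}" and ab: "a < b \<and> b < \<pi> a"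
    then have a: "a < Suc (Suc K)" and b: "b < Suc (Suc K)" by auto
    from assms(2) a show "\<pi> b < \<pi> a"
    proof (cases rule: skip2_cases)
      case (3 y)
      from assms(2) b show ?thesis
      proof (cases rule: skip2_cases)
        case 1
        then show ?thesis using ab \<open>\<pi> p = Suc p\<close> 2[OF 3(1)] 3 by (auto simp: skip2_def split: if_splits)
      next
        case 2
        then show ?thesis using ab 1 by simp
      next
        case b3: (3 y')
        then have "\<pi>0 y' < \<pi>0 y" using ab 3 2 by (intro ncpD(5)[OF assms(1)]) auto
        then show ?thesis using 3 b3 2 by simp
      qed
    qed (use ab 1 in auto)
  qed
  then show ?thesis using 1 2 by blast
qed

text \<open>An arc of minimal length joins neighbours: otherwise noncrossing would put the arc from
  \<open>Suc p\<close> strictly inside it.\<close>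

lemma ncp_adjacent:
  assumes "\<pi> \<in> ncp {..<K}" "K > 0"
  obtains p where "Suc p < K" "\<pi> p = Suc p" "\<pi> (Suc p) = p"
proof -
  note D = ncpD[OF assms(1)]
  define S where "S = {x. x < K \<and> x < \<pi> x}"
  have "0 \<in> S" using D(3)[of 0] assms(2) by (auto simp: S_def)
  then obtain p where p: "p \<in> S" "\<And>q. q \<in> S \<Longrightarrow> \<pi> p - p \<le> \<pi> q - q"
    using ex_has_least_nat[of "\<lambda>x. x \<in> S" 0 "\<lambda>x. \<pi> x - x"] by blast
  have pK: "p < K" "p < \<pi> p" "\<pi> p < K" using p(1) D(2)[of p] by (auto simp: S_def)
  have "\<pi> p = Suc p"
  proof (rule ccontr)
    assume "\<pi> p \<noteq> Suc p"
    then have b: "Suc p < \<pi> p" using pK by simp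
    have lt: "\<pi> (Suc p) < \<pi> p" using b pK by (intro D(5)) auto
    have ne: "\<pi> (Suc p) \<noteq> Suc p" using D(3)[of "Suc p"] b pK by simp
    \<comment> \<open>As \<open>ncp\<close> bounds partners from above only, the condition is
      applied to the arc that would begin at \<open>\<pi> (Suc p)\<close> and contain
      \<open>p\<close>.\<close>
    have "\<not> \<pi> (Suc p) < p"
    proof
      assume l: "\<pi> (Suc p) < p"
      have "\<pi> p < \<pi> (\<pi> (Suc p))" using l pK by (intro D(5)) (auto simp: D(4))
      then show False using b by (simp add: D(4))
    qed
    moreover have "\<pi> (Suc p) \<noteq> p" using b D(4)[of "Suc p"] by auto
    ultimately have "Suc p \<in> S" using ne b pK by (auto simp: S_def)
    from p(2)[OF this] show False using lt b by simp
  qed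
  then show ?thesis using that[of p] pK D(4)[of p] by simp
qed

lemma ncp_remove:
  assumes "\<pi> \<in> ncp {..<Suc (Suc K)}" "p \<le> K" "\<pi> p = Suc p" "\<pi> (Suc p) = p"
  shows "\<exists>\<pi>0\<in>ncp {..<K}. \<forall>y<K. \<pi> (skip2 p y) = skip2 p (\<pi>0 y)"
proof -
  note D = ncpD[OF assms(1)]
  have "\<exists>y'<K. \<pi> (skip2 p y) = skip2 p y'" if y: "y < K" for y
  proof -
    have "\<pi> (skip2 p y) < Suc (Suc K)" using D(2)[of "skip2 p y"] y skip2_bound[OF assms(2)] by simp
    with assms(2) show ?thesis
    proof (cases rule: skip2_cases)
      case 1
      then have "\<pi> p = skip2 p y" using D(4) by metis
      then show ?thesis using assms(3) by simp
    next
      case 2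
      then have "\<pi> (Suc p) = skip2 p y" using D(4) by metis
      then show ?thesis using assms(4) by simp
    qed auto
  qed
  then obtain f where f: "\<And>y. y < K \<Longrightarrow> f y < K \<and> \<pi> (skip2 p y) = skip2 p (f y)" by metis
  define \<pi>0 where "\<pi>0 y = (if y < K then f y else y)" for y
  have 1: "\<pi>0 y < K" "\<pi> (skip2 p y) = skip2 p (\<pi>0 y)" if "y < K" for y using f that by (auto simp: \<pi>0_def)
  have "\<pi>0 \<in> ncp {..<K}"
    unfolding ncp_def mem_Collect_eq
  proof (intro conjI allI impI ballI)
    fix y assume "y \<in> {..<K}"
    then have y: "y < K" by simp
    show "\<pi>0 y \<in> {..<K}" using 1 y by simp
    show "\<pi>0 y \<noteq> y" using 1(2)[OF y] D(3)[of "skip2 p y"] skip2_bound[OF assms(2)] y by auto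
    show "\<pi>0 (\<pi>0 y) = y" using 1(2)[OF y] 1(2)[OF 1(1)[OF y]] D(4)[of "skip2 p y"] by simp
  next
    fix a b assume "a \<in> {..<K}" "b \<in> {..<K}" and ab: "a < b \<and> b < \<pi>0 a"
    then have "\<pi> (skip2 p b) < \<pi> (skip2 p a)"
      using 1 skip2_bound[OF assms(2)] by (intro D(5)) auto
    then show "\<pi>0 b < \<pi>0 a" using 1(2) \<open>a \<in> {..<K}\<close> \<open>b \<in> {..<K}\<close> by simp
  qed (simp add: \<pi>0_def)
  then show ?thesis using 1 by blast
qed

text \<open>Inserting a pair of neighbours preserves noncrossing, and conversely every nonempty
  noncrossing pairing has such a pair, which can be removed.\<close>

lemma ncv_eq_compat_lists: "{A. ncv K A} = compat_lists K ` ncp {..<K}"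
proof (intro equalityI subsetI)
  fix A assume "A \<in> {A. ncv K A}"
  then have "ncv K A" by simp
  then show "A \<in> compat_lists K ` ncp {..<K}"
  proof (induction rule: ncv.induct)
    case ncv_Nil
    have "(\<lambda>x. x) \<in> ncp {..<0}" by (simp add: ncp_def)
    moreover have "compat_lists 0 (\<lambda>x. x) = {[]}" by (auto simp: compat_lists_def)
    ultimately show ?case by blast
  next
    case (ncv_ins K A p)
    then obtain \<pi>0 where p0: "\<pi>0 \<in> ncp {..<K}" "A = compat_lists K \<pi>0" by blast
    then obtain \<pi> where p: "\<pi> \<in> ncp {..<Suc (Suc K)}" "\<pi> p = Suc p" "\<pi> (Suc p) = p"
        "\<forall>y<K. \<pi> (skip2 p y) = skip2 p (\<pi>0 y)"
      using ncp_insert[OF p0(1) ncv_ins.hyps(2)] by blast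
    have "compat_lists (Suc (Suc K)) \<pi> = ins_pair p A"
      unfolding p0(2) using p ncv_ins.hyps(2) by (intro compat_lists_insert) auto
    then show ?case using p(1) by blast
  qed
next
  fix A assume "A \<in> compat_lists K ` ncp {..<K}"
  then show "A \<in> {A. ncv K A}"
  proof (induction K arbitrary: A rule: less_induct)
    case (less K)
    then obtain \<pi> where \<pi>: "\<pi> \<in> ncp {..<K}" "A = compat_lists K \<pi>" by blast
    show ?case
    proof (cases "K = 0")
      case True
      then have "A = {[]}" using \<pi> by (auto simp: compat_lists_def)
      then show ?thesis using True ncv_Nil by simp
    next
      case False
      then obtain p where p: "Suc p < K" "\<pi> p = Suc p" "\<pi> (Suc p) = p" using ncp_adjacent[OF \<pi>(1)] by blast
      then obtain L where L: "K = Suc (Suc L)" "p \<le> L" by (metis Suc_le_lessD Suc_less_eq less_imp_Suc_add less_Suc_eq_le not0_implies_Suc not_less_eq less_zeroE Nat.lessE)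
      obtain \<pi>0 where p0: "\<pi>0 \<in> ncp {..<L}" "\<forall>y<L. \<pi> (skip2 p y) = skip2 p (\<pi>0 y)"
        using ncp_remove[OF \<pi>(1)[unfolded L(1)] L(2) p(2,3)] by blast
      have "A = ins_pair p (compat_lists L \<pi>0)"
        unfolding \<pi>(2) L(1) using p p0 L by (intro compat_lists_insert) auto
      moreover have "ncv L (compat_lists L \<pi>0)" using less.IH[of L] L p0 by auto
      ultimately show ?thesis using ncv_ins L by simp
    qed
  qed
qed

text \<open>The list with one letter on \<open>{x, \<pi> x}\<close> and another one elsewhere
  detects the partner of \<open>x\<close>.\<close>

lemma inj_compat_lists: "inj_on (compat_lists K) (ncp {..<K})"
proof (rule inj_onI, rule ext)
  fix \<pi> \<rho> x assume p: "\<pi> \<in> ncp {..<K}" and r: "\<rho> \<in> ncp {..<K}" and eq: "compat_lists K \<pi> = compat_lists K \<rho>"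
  show "\<pi> x = \<rho> x"
  proof (cases "x < K")
    case False
    then show ?thesis using ncpD(1)[OF p, of x] ncpD(1)[OF r, of x] by simp
  next
    case True
    define y where "y = map (\<lambda>z. if z = x \<or> z = \<pi> x then 1 else (0::nat)) [0..<K]"
    have yn: "y ! z = (if z = x \<or> z = \<pi> x then 1 else 0)" if "z < K" for z using that by (simp add: y_def)
    have "y \<in> compat_lists K \<pi>"
      unfolding compat_lists_def mem_Collect_eq
    proof (intro conjI allI impI)
      fix z assume z: "z < K"
      have "\<pi> z < K" using ncpD(2)[OF p, of z] z by simp
      moreover have "\<pi> z = x \<or> \<pi> z = \<pi> x \<longleftrightarrow> z = x \<or> z = \<pi> x" using ncpD(4)[OF p] by metis
      ultimately show "y ! z = y ! \<pi> z" using z yn by simp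
    qed (simp add: y_def)
    then have "y \<in> compat_lists K \<rho>" using eq by simp
    then have "y ! x = y ! \<rho> x" using True by (simp add: compat_lists_def)
    moreover have "\<rho> x < K" "\<rho> x \<noteq> x" using ncpD(2,3)[OF r, of x] True by auto
    ultimately have "(if \<rho> x = \<pi> x then 1 else (0::nat)) = 1" using yn[OF True] yn[of "\<rho> x"] by simp
    then show ?thesis by (cases "\<rho> x = \<pi> x") simp_all
  qed
qed


section \<open>Overlaps of pairings\<close>

definition fpf_involution :: "nat \<Rightarrow> (nat \<Rightarrow> nat) \<Rightarrow> bool" where
  "fpf_involution K \<alpha> \<longleftrightarrow> (\<forall>x<K. \<alpha> x < K \<and> \<alpha> x \<noteq> x \<and> \<alpha> (\<alpha> x) = x)"

lemma ncp_fpf: "\<pi> \<in> ncp {..<K} \<Longrightarrow> fpf_involution K \<pi>"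
  using ncpD[of \<pi> "{..<K}"] by (auto simp: fpf_involution_def)

definition reps :: "nat \<Rightarrow> (nat \<Rightarrow> nat) \<Rightarrow> nat set" where
  "reps K \<alpha> = {x. x < K \<and> x < \<alpha> x}"

definition rep :: "(nat \<Rightarrow> nat) \<Rightarrow> nat \<Rightarrow> nat" where
  "rep \<alpha> x = (if x < \<alpha> x then x else \<alpha> x)"

lemma rep_in_reps: "fpf_involution K \<alpha> \<Longrightarrow> x < K \<Longrightarrow> rep \<alpha> x \<in> reps K \<alpha>"
  by (auto simp: fpf_involution_def reps_def rep_def not_less_iff_gr_or_eq)

lemma nth_rep: "y \<in> compat_lists K \<alpha> \<Longrightarrow> x < K \<Longrightarrow> y ! rep \<alpha> x = y ! x"
  by (simp add: compat_lists_def rep_def)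

lemma card_reps:
  assumes "fpf_involution K \<alpha>" shows "K = 2 * card (reps K \<alpha>)"
proof -
  let ?R = "reps K \<alpha>"
  have fin: "finite ?R" by (simp add: reps_def)
  have "inj_on \<alpha> ?R"
  proof (rule inj_onI)
    fix x z assume "x \<in> ?R" "z \<in> ?R" "\<alpha> x = \<alpha> z"
    then show "x = z" using assms unfolding fpf_involution_def reps_def by (metis mem_Collect_eq)
  qed
  then have c: "card (\<alpha> ` ?R) = card ?R" by (rule card_image)
  have "{..<K} = ?R \<union> \<alpha> ` ?R"
  proof (intro equalityI subsetI)
    fix x assume "x \<in> {..<K}"
    then have x: "x < K" "\<alpha> x < K" "\<alpha> x \<noteq> x" "\<alpha> (\<alpha> x) = x" using assms by (auto simp: fpf_involution_def)
    show "x \<in> ?R \<union> \<alpha> ` ?R"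
    proof (cases "x < \<alpha> x")
      case False
      then have "\<alpha> x \<in> ?R" using x by (auto simp: reps_def)
      then show ?thesis using x(4) by (metis UnI2 imageI)
    qed (use x in \<open>simp add: reps_def\<close>)
  qed (use assms in \<open>auto simp: reps_def fpf_involution_def\<close>)
  moreover have "?R \<inter> \<alpha> ` ?R = {}"
  proof -
    have "\<alpha> x \<notin> ?R" if "x \<in> ?R" for x
    proof -
      have "x < K" "x < \<alpha> x" using that by (simp_all add: reps_def)
      moreover have "\<alpha> (\<alpha> x) = x" using assms \<open>x < K\<close> unfolding fpf_involution_def by blast
      ultimately show ?thesis by (simp add: reps_def)
    qed
    then show ?thesis by blast
  qed
  ultimately have "card {..<K} = card ?R + card (\<alpha> ` ?R)" using fin by (metis card_Un_disjoint finite_imageI)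
  then show ?thesis using c by simp
qed

text \<open>A compatible list is a free choice of one value for the smaller point of each
  pair.\<close>

lemma card_compat_self:
  assumes a: "fpf_involution K \<alpha>"
  shows "card (compat_lists K \<alpha> \<inter> idx_lists n K) = n ^ (K div 2)"
proof -
  let ?R = "reps K \<alpha>"
  have fin: "finite ?R" by (simp add: reps_def)
  have inR: "x < K" "x < \<alpha> x" if "x \<in> ?R" for x using that by (auto simp: reps_def)
  have "bij_betw (\<lambda>y. restrict (nth y) ?R) (compat_lists K \<alpha> \<inter> idx_lists n K) (?R \<rightarrow>\<^sub>E {..<n})"
  proof (rule bij_betw_byWitness[where f' = "\<lambda>f. map (\<lambda>x. f (rep \<alpha> x)) [0..<K]"])
    show "\<forall>y\<in>compat_lists K \<alpha> \<inter> idx_lists n K. map (\<lambda>x. restrict (nth y) ?R (rep \<alpha> x)) [0..<K] = y"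
    proof
      fix y assume y: "y \<in> compat_lists K \<alpha> \<inter> idx_lists n K"
      show "map (\<lambda>x. restrict (nth y) ?R (rep \<alpha> x)) [0..<K] = y"
        using y rep_in_reps[OF a] nth_rep[of y K \<alpha>]
        by (intro nth_equalityI) (auto simp: idx_lists_def)
    qed
    show "\<forall>f\<in>?R \<rightarrow>\<^sub>E {..<n}. restrict (nth (map (\<lambda>x. f (rep \<alpha> x)) [0..<K])) ?R = f"
    proof
      fix f assume f: "f \<in> ?R \<rightarrow>\<^sub>E {..<n}"
      show "restrict (nth (map (\<lambda>x. f (rep \<alpha> x)) [0..<K])) ?R = f"
      proof
        fix x
        show "restrict (nth (map (\<lambda>x. f (rep \<alpha> x)) [0..<K])) ?R x = f x"
          using inR[of x] f by (cases "x \<in> ?R") (auto simp: rep_def PiE_def extensional_def)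
      qed
    qed
    show "(\<lambda>y. restrict (nth y) ?R) ` (compat_lists K \<alpha> \<inter> idx_lists n K) \<subseteq> ?R \<rightarrow>\<^sub>E {..<n}"
    proof (rule image_subsetI)
      fix y assume y: "y \<in> compat_lists K \<alpha> \<inter> idx_lists n K"
      have "y ! x < n" if "x \<in> ?R" for x
      proof -
        have "y ! x \<in> set y" using inR[OF that] y by (simp add: idx_lists_def)
        then show ?thesis using y by (auto simp: idx_lists_def)
      qed
      then show "restrict (nth y) ?R \<in> ?R \<rightarrow>\<^sub>E {..<n}" by auto
    qed
    show "(\<lambda>f. map (\<lambda>x. f (rep \<alpha> x)) [0..<K]) ` (?R \<rightarrow>\<^sub>E {..<n}) \<subseteq> compat_lists K \<alpha> \<inter> idx_lists n K"
    proof (rule image_subsetI)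
      fix f assume f: "f \<in> ?R \<rightarrow>\<^sub>E {..<n}"
      have fr: "f (rep \<alpha> x) < n" if "x < K" for x using f rep_in_reps[OF a that] by auto
      have ra: "rep \<alpha> (\<alpha> x) = rep \<alpha> x" if "x < K" for x
        using a that by (auto simp: rep_def fpf_involution_def)
      have "map (\<lambda>x. f (rep \<alpha> x)) [0..<K] \<in> compat_lists K \<alpha>"
        using a ra by (auto simp: compat_lists_def fpf_involution_def)
      moreover have "map (\<lambda>x. f (rep \<alpha> x)) [0..<K] \<in> idx_lists n K" using fr by (auto simp: idx_lists_def)
      ultimately show "map (\<lambda>x. f (rep \<alpha> x)) [0..<K] \<in> compat_lists K \<alpha> \<inter> idx_lists n K" by simp
    qed
  qed
  from bij_betw_same_card[OF this] have "card (compat_lists K \<alpha> \<inter> idx_lists n K) = n ^ card ?R"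
    using fin by (simp add: card_PiE)
  also have "card ?R = K div 2" using card_reps[OF a] by simp
  finally show ?thesis .
qed

text \<open>Where the pairings disagree, \<open>\<beta>\<close> copies the value on the
  \<open>\<alpha>\<close>-pair of \<open>x\<close> from another \<open>\<alpha>\<close>-pair, so at
  least one of the \<open>K div 2\<close> free choices is lost.\<close>

lemma card_compat_other:
  assumes a: "fpf_involution K \<alpha>" and b: "fpf_involution K \<beta>" and x: "x < K" "\<alpha> x \<noteq> \<beta> x"
  shows "card (compat_lists K \<alpha> \<inter> compat_lists K \<beta> \<inter> idx_lists n K) \<le> n ^ (K div 2 - 1)"
proof -
  let ?R = "reps K \<alpha>" and ?r = "rep \<alpha> x"
  have fin: "finite ?R" by (simp add: reps_def)
  have bx: "\<beta> x < K" "\<beta> x \<noteq> x" using b x by (auto simp: fpf_involution_def)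
  have rr: "rep \<alpha> z = ?r \<Longrightarrow> z = x \<or> z = \<alpha> x" if "z < K" for z
    using a x(1) that unfolding rep_def fpf_involution_def by (metis (full_types))
  have inj: "inj_on (\<lambda>y. restrict (nth y) (?R - {?r})) (compat_lists K \<alpha> \<inter> compat_lists K \<beta> \<inter> idx_lists n K)"
  proof (rule inj_onI)
    fix y y' assume y: "y \<in> compat_lists K \<alpha> \<inter> compat_lists K \<beta> \<inter> idx_lists n K"
      and y': "y' \<in> compat_lists K \<alpha> \<inter> compat_lists K \<beta> \<inter> idx_lists n K"
      and eq: "restrict (nth y) (?R - {?r}) = restrict (nth y') (?R - {?r})"
    have far: "y ! z = y' ! z" if "z < K" "rep \<alpha> z \<noteq> ?r" for z
    proof -
      have "rep \<alpha> z \<in> ?R - {?r}" using rep_in_reps[OF a that(1)] that(2) by simp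
      then have "y ! rep \<alpha> z = y' ! rep \<alpha> z" using fun_cong[OF eq, of "rep \<alpha> z"] by simp
      then show ?thesis using nth_rep[of y K \<alpha> z] nth_rep[of y' K \<alpha> z] y y' that(1) by simp
    qed
    have "rep \<alpha> (\<beta> x) \<noteq> ?r" using rr[OF bx(1)] bx(2) x(2) by auto
    then have "y ! \<beta> x = y' ! \<beta> x" using far bx by simp
    moreover have cb: "y ! x = y ! \<beta> x" "y' ! x = y' ! \<beta> x" and ca: "y ! x = y ! \<alpha> x" "y' ! x = y' ! \<alpha> x"
      using y y' x(1) unfolding compat_lists_def by blast+
    ultimately have yx: "y ! x = y' ! x" by simp
    have "y ! z = y' ! z" if z: "z < K" for z
    proof (cases "rep \<alpha> z = ?r")
      case True
      then consider "z = x" | "z = \<alpha> x" using rr[OF z] by blast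
      then show ?thesis
      proof cases
        case 2
        then show ?thesis using yx ca by simp
      qed (use yx in simp)
    qed (use far z in simp)
    then show "y = y'" using y y' by (intro nth_equalityI) (auto simp: idx_lists_def)
  qed
  have "(\<lambda>y. restrict (nth y) (?R - {?r})) ` (compat_lists K \<alpha> \<inter> compat_lists K \<beta> \<inter> idx_lists n K) \<subseteq> (?R - {?r}) \<rightarrow>\<^sub>E {..<n}"
  proof (rule image_subsetI)
    fix y assume y: "y \<in> compat_lists K \<alpha> \<inter> compat_lists K \<beta> \<inter> idx_lists n K"
    have "y ! z < n" if "z \<in> ?R" for z
    proof -
      have "y ! z \<in> set y" using that y by (simp add: idx_lists_def reps_def)
      then show ?thesis using y by (auto simp: idx_lists_def)
    qed
    then show "restrict (nth y) (?R - {?r}) \<in> (?R - {?r}) \<rightarrow>\<^sub>E {..<n}" by auto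
  qed
  from card_inj_on_le[OF inj this] have "card (compat_lists K \<alpha> \<inter> compat_lists K \<beta> \<inter> idx_lists n K) \<le> n ^ card (?R - {?r})"
    using fin by (simp add: card_PiE finite_PiE)
  also have "card (?R - {?r}) = K div 2 - 1"
    using card_reps[OF a] rep_in_reps[OF a x(1)] fin by simp
  finally show ?thesis .
qed

text \<open>The two counts above, divided by the count for a single pairing; the lost choice is the
  factor \<open>1 / n\<close>.\<close>

lemma compat_overlap:
  assumes a: "fpf_involution K \<alpha>" and b: "fpf_involution K \<beta>" and n: "n > 0"
  shows "\<bar>(\<Sum>y\<in>idx_lists n K. ind (compat_lists K \<alpha>) y * ind (compat_lists K \<beta>) y) / real n ^ (K div 2)
    - (if \<forall>x<K. \<alpha> x = \<beta> x then 1 else 0)\<bar> \<le> 1 / real n"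
proof -
  have s: "(\<Sum>y\<in>idx_lists n K. ind (compat_lists K \<alpha>) y * ind (compat_lists K \<beta>) y) =
      real (card (compat_lists K \<alpha> \<inter> compat_lists K \<beta> \<inter> idx_lists n K))"
  proof -
    have "(\<Sum>y\<in>idx_lists n K. ind (compat_lists K \<alpha>) y * ind (compat_lists K \<beta>) y) =
       (\<Sum>y\<in>idx_lists n K. if y \<in> compat_lists K \<alpha> \<inter> compat_lists K \<beta> then 1 else 0)"
      by (intro sum.cong) (auto simp: ind_def)
    also have "\<dots> = (\<Sum>y\<in>idx_lists n K \<inter> (compat_lists K \<alpha> \<inter> compat_lists K \<beta>). 1)"
      by (rule sum.inter_restrict[symmetric, OF finite_idx_lists])
    finally show ?thesis by (simp add: Int_commute Int_left_commute)
  qed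
  show ?thesis
  proof (cases "\<forall>x<K. \<alpha> x = \<beta> x")
    case True
    then have "compat_lists K \<beta> = compat_lists K \<alpha>" by (auto simp: compat_lists_def)
    then show ?thesis using True card_compat_self[OF a, of n] n unfolding s by simp
  next
    case False
    then obtain x where x: "x < K" "\<alpha> x \<noteq> \<beta> x" by blast
    have "\<alpha> x < K \<and> \<alpha> x \<noteq> x" using a x(1) unfolding fpf_involution_def by blast
    then have "K \<ge> 2" using x(1) by linarith
    then have d: "K div 2 = Suc (K div 2 - 1)" by simp
    have "real (card (compat_lists K \<alpha> \<inter> compat_lists K \<beta> \<inter> idx_lists n K)) \<le> real n ^ (K div 2 - 1)"
      using card_compat_other[OF a b x, of n] by (metis of_nat_le_iff of_nat_power)
    then have "real (card (compat_lists K \<alpha> \<inter> compat_lists K \<beta> \<inter> idx_lists n K)) / real n ^ (K div 2) \<le> real n ^ (K div 2 - 1) / real n ^ (K div 2)"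
      by (intro divide_right_mono) auto
    also have "real n ^ (K div 2 - 1) / real n ^ (K div 2) = 1 / real n"
      using n by (subst (2) d) simp
    finally show ?thesis unfolding s if_not_P[OF False] by simp
  qed
qed

section \<open>Moments of traces as sums over rotated index lists\<close>

text \<open>If \<open>y\<close> lists the row indices of a block, this lists its column
  indices.\<close>

definition rot_block :: "bool \<Rightarrow> 'a list \<Rightarrow> 'a list" where
  "rot_block e y = (if e then rev (rotate1 (rev y)) else rotate1 y)"

fun rot_list :: "(nat \<times> bool) list \<Rightarrow> 'a list \<Rightarrow> 'a list" where
  "rot_list [] y = []"
| "rot_list ((k,e) # w) y = rot_block e (take k y) @ rot_list w (drop k y)"

lemma length_rot_block [simp]: "length (rot_block e y) = length y"
  by (simp add: rot_block_def)

lemma set_rot_block [simp]: "set (rot_block e y) = set y"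
  by (simp add: rot_block_def)

lemma nth_rot_block:
  assumes "x < length y"
  shows "rot_block e y ! x = y ! cyc 0 (length y) e x"
proof (cases e)
  case False
  then show ?thesis using assms by (simp add: rot_block_def nth_rotate1 cyc_def mod_Suc)
next
  case True
  let ?k = "length y"
  have "rev (rotate1 (rev y)) ! x = rev y ! (Suc (?k - Suc x) mod ?k)"
    using assms by (simp add: rev_nth nth_rotate1)
  also have "\<dots> = y ! (if x = 0 then ?k - 1 else x - 1)"
  proof (cases "x = 0")
    case True
    have "Suc (?k - Suc 0) = ?k" using assms by linarith
    then have "Suc (?k - Suc 0) mod ?k = 0" by simp
    then show ?thesis using True assms by (simp add: rev_nth)
  next
    case False
    then have "Suc (?k - Suc x) mod ?k = ?k - x" using assms by simp
    then show ?thesis using False assms by (simp add: rev_nth)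
  qed
  finally show ?thesis using True by (simp add: rot_block_def cyc_def)
qed

lemma cyc_shift: "c \<le> x \<Longrightarrow> x < c + k \<Longrightarrow> cyc c k e x = c + cyc 0 k e (x - c)"
  by (auto simp: cyc_def)

lemma nth_rot_list:
  "length y = c + wsz w \<Longrightarrow> x < wsz w \<Longrightarrow> rot_list w (drop c y) ! x = y ! brot c w (c + x)"
proof (induction w arbitrary: c x)
  case (Cons p w)
  obtain k e where p: "p = (k,e)" by fastforce
  have len: "length (take k (drop c y)) = k" using Cons.prems p by simp
  show ?case
  proof (cases "x < k")
    case True
    then have "rot_list (p # w) (drop c y) ! x = take k (drop c y) ! cyc 0 k e x"
      using len nth_rot_block[of x "take k (drop c y)" e] by (simp add: p nth_append)
    also have "\<dots> = y ! (c + cyc 0 k e x)"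
      using cyc_in[of x 0 k e] True Cons.prems p by simp
    also have "\<dots> = y ! brot c (p # w) (c + x)" using True cyc_shift[of c "c + x" k e] by (simp add: p)
    finally show ?thesis .
  next
    case False
    then have "rot_list (p # w) (drop c y) ! x = rot_list w (drop (c + k) y) ! (x - k)"
      using len by (simp add: p nth_append add.commute)
    also have "\<dots> = y ! brot (c + k) w (c + k + (x - k))"
      using Cons.prems False p by (intro Cons.IH) auto
    also have "\<dots> = y ! brot c (p # w) (c + x)" using False by (simp add: p)
    finally show ?thesis .
  qed
qed simp

lemma length_rot_list: "length y = wsz w \<Longrightarrow> length (rot_list w y) = wsz w"
  by (induction w y rule: rot_list.induct) simp_all

lemma set_rot_list: "set (rot_list w y) \<subseteq> set y"
proof (induction w y rule: rot_list.induct)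
  case (2 k e w y)
  then show ?case using set_take_subset[of k y] set_drop_subset[of k y] by auto
qed simp

lemma rot_list_idx: "y \<in> idx_lists n (wsz w) \<Longrightarrow> rot_list w y \<in> idx_lists n (wsz w)"
  using set_rot_list[of w y] by (auto simp: idx_lists_def length_rot_list)

lemma sum_idx_lists_append:
  "(\<Sum>x\<in>idx_lists n (k + l). F x) = (\<Sum>y\<in>idx_lists n k. \<Sum>z\<in>idx_lists n l. F (y @ z))"
proof -
  have "bij_betw (\<lambda>(y,z). y @ z) (idx_lists n k \<times> idx_lists n l) (idx_lists n (k + l))"
  proof (rule bij_betw_byWitness[where f' = "\<lambda>x. (take k x, drop k x)"])
    show "(\<lambda>x. (take k x, drop k x)) ` idx_lists n (k + l) \<subseteq> idx_lists n k \<times> idx_lists n l"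
    proof (rule image_subsetI)
      fix x assume x: "x \<in> idx_lists n (k + l)"
      then show "(take k x, drop k x) \<in> idx_lists n k \<times> idx_lists n l"
        using order.trans[OF set_take_subset[of k x]] order.trans[OF set_drop_subset[of k x]]
        by (simp add: idx_lists_def)
    qed
  qed (auto simp: idx_lists_def)
  from sum.reindex_bij_betw[OF this, of F, symmetric] show ?thesis
    by (simp add: sum.cartesian_product case_prod_beta)
qed

lemma tr_poly_lc: "tr_poly n k = (\<lambda>w. \<Sum>y\<in>idx_lists n k. 1 * ncp_mono (zip y (rot_block False y)) w)"
  by (simp add: tr_poly_def rot_block_def)

text \<open>The generators are self-adjoint, so the star only reverses words. Renaming
  \<open>y\<close> to \<open>rev y\<close> restores the row list \<open>y\<close> and reverses the
  direction of the rotation.\<close>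

lemma star_tr_poly_lc:
  "ncp_star (tr_poly n k) = (\<lambda>w. \<Sum>y\<in>idx_lists n k. 1 * ncp_mono (zip y (rot_block True y)) w)"
proof
  fix w :: "(nat \<times> nat) list"
  have "ncp_star (tr_poly n k) w = (\<Sum>y\<in>idx_lists n k. ncp_mono (zip y (rotate1 y)) (rev w))"
    by (simp add: ncp_star_def tr_poly_def ncp_mono_def if_distrib cong: if_cong)
  also have "\<dots> = (\<Sum>y\<in>idx_lists n k. ncp_mono (zip (rev y) (rot_block True (rev y))) w)"
  proof (intro sum.cong refl)
    fix y
    have "rev w = zip y (rotate1 y) \<longleftrightarrow> w = rev (zip y (rotate1 y))" by (metis rev_rev_ident)
    then show "ncp_mono (zip y (rotate1 y)) (rev w) = ncp_mono (zip (rev y) (rot_block True (rev y))) w"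
      by (simp add: ncp_mono_def rot_block_def zip_rev)
  qed
  also have "\<dots> = (\<Sum>y\<in>idx_lists n k. ncp_mono (zip y (rot_block True y)) w)"
    by (rule sum.reindex_bij_betw[where h = rev])
      (rule bij_betw_byWitness[where f' = rev], auto simp: idx_lists_def)
  finally show "ncp_star (tr_poly n k) w = (\<Sum>y\<in>idx_lists n k. 1 * ncp_mono (zip y (rot_block True y)) w)" by simp
qed

lemma tr_moment_lc:
  "tr_moment n ks = (\<lambda>w. \<Sum>y\<in>idx_lists n (wsz ks). 1 * ncp_mono (zip y (rot_list ks y)) w)"
proof (induction ks)
  case Nil
  have "idx_lists n 0 = {[]}" by (auto simp: idx_lists_def)
  then show ?case by simp
next
  case (Cons p ks)
  obtain k e where p: "p = (k,e)" by fastforce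
  have "(if e then ncp_star (tr_poly n k) else tr_poly n k) =
      (\<lambda>w. \<Sum>y\<in>idx_lists n k. 1 * ncp_mono (zip y (rot_block e y)) w)"
    using tr_poly_lc star_tr_poly_lc by (cases e) simp_all
  then have "tr_moment n (p # ks) = (\<lambda>w. \<Sum>y\<in>idx_lists n k. \<Sum>z\<in>idx_lists n (wsz ks).
      (1 * 1) * ncp_mono (zip y (rot_block e y) @ zip z (rot_list ks z)) w)"
    using ncp_mult_lc[of "\<lambda>_. 1" "\<lambda>y. zip y (rot_block e y)" "idx_lists n k" "\<lambda>_. 1" "\<lambda>z. zip z (rot_list ks z)" "idx_lists n (wsz ks)"]
    by (simp add: p Cons)
  also have "\<dots> = (\<lambda>w. \<Sum>x\<in>idx_lists n (k + wsz ks). 1 * ncp_mono (zip x (rot_list (p # ks) x)) w)"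
    unfolding sum_idx_lists_append by (intro ext sum.cong refl) (simp add: idx_lists_def p)
  finally show ?case by (simp add: p)
qed

definition flip :: "(nat \<times> bool) list \<Rightarrow> (nat \<times> bool) list" where
  "flip w = map (\<lambda>(k,e). (k, \<not> e)) w"

lemma flip_flip [simp]: "flip (flip w) = w"
  by (simp add: flip_def comp_def case_prod_beta)

lemma wsz_flip [simp]: "wsz (flip w) = wsz w" "wsz (take i (flip w)) = wsz (take i w)"
  by (simp_all add: flip_def wsz_def take_map comp_def case_prod_beta)

lemma brot_flip:
  assumes "x \<in> {c..<c + wsz w}"
  shows "brot c w (brot c (flip w) x) = x"
proof -
  obtain i where i: "i < length w" "x \<in> blk c w i" using blk_cover[OF assms] by blast
  have fl: "length (flip w) = length w" by (simp add: flip_def)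
  have nth: "flip w ! i = (fst (w ! i), \<not> snd (w ! i))" using i(1) by (simp add: flip_def case_prod_beta)
  have b: "blk c (flip w) i = blk c w i" by (simp add: blk_def nth)
  have rot: "brot c (flip w) x = cyc (c + wsz (take i w)) (fst (w ! i)) (\<not> snd (w ! i)) x"
    using brot_blk[of i "flip w" x c] i fl b nth by simp
  have "brot c (flip w) x \<in> blk c w i" using brot_blk_in[of i "flip w" x c] i fl b by simp
  then show ?thesis
    using brot_blk[OF i(1)] rot cyc_inverse i(2) unfolding blk_def by simp
qed

lemma brot_less: "x < wsz w \<Longrightarrow> brot 0 w x < wsz w"
  using brot_in[of x 0 w] by simp

text \<open>Conjugation of \<open>\<rho>\<close> by the block rotation: \<open>flip w\<close> turns
  every block the other way, so \<open>brot 0 (flip w)\<close> is the inverse of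
  \<open>brot 0 w\<close> below \<open>wsz w\<close>.\<close>

definition conj_rot :: "(nat \<times> bool) list \<Rightarrow> (nat \<Rightarrow> nat) \<Rightarrow> nat \<Rightarrow> nat" where
  "conj_rot w \<rho> x = brot 0 w (\<rho> (brot 0 (flip w) x))"

lemma brot_inverses:
  assumes "x < wsz w"
  shows "brot 0 w (brot 0 (flip w) x) = x" "brot 0 (flip w) (brot 0 w x) = x" "brot 0 (flip w) x < wsz w"
  using brot_flip[of x 0 w] brot_flip[of x 0 "flip w"] brot_less[of x "flip w"] assms by simp_all

lemma conj_rot_eq_iff:
  assumes "fpf_involution (wsz w) \<rho>"
  shows "(\<forall>x<wsz w. f x = g (conj_rot w \<rho> x)) \<longleftrightarrow> (\<forall>x<wsz w. f (brot 0 w x) = g (brot 0 w (\<rho> x)))"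
proof (intro iffI allI impI)
  fix x assume *: "\<forall>x<wsz w. f x = g (conj_rot w \<rho> x)" and x: "x < wsz w"
  show "f (brot 0 w x) = g (brot 0 w (\<rho> x))"
    using *[rule_format, OF brot_less[OF x]] brot_inverses[OF x] by (simp add: conj_rot_def)
next
  fix x assume *: "\<forall>x<wsz w. f (brot 0 w x) = g (brot 0 w (\<rho> x))" and x: "x < wsz w"
  show "f x = g (conj_rot w \<rho> x)"
    using *[rule_format, OF brot_inverses(3)[OF x]] brot_inverses[OF x] by (simp add: conj_rot_def)
qed

lemma fpf_conj_rot:
  assumes r: "fpf_involution (wsz w) \<rho>"
  shows "fpf_involution (wsz w) (conj_rot w \<rho>)"
  unfolding fpf_involution_def
proof (intro allI impI)
  fix x assume x: "x < wsz w"
  let ?z = "brot 0 (flip w) x"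
  have z: "?z < wsz w" by (rule brot_inverses(3)[OF x])
  have rz: "\<rho> ?z < wsz w" "\<rho> ?z \<noteq> ?z" "\<rho> (\<rho> ?z) = ?z" using r z by (auto simp: fpf_involution_def)
  have bk: "brot 0 (flip w) (conj_rot w \<rho> x) = \<rho> ?z"
    unfolding conj_rot_def by (rule brot_inverses(2)[OF rz(1)])
  have "conj_rot w \<rho> x < wsz w" unfolding conj_rot_def by (rule brot_less[OF rz(1)])
  moreover have "conj_rot w \<rho> x \<noteq> x" using bk rz(2) by auto
  moreover have "conj_rot w \<rho> (conj_rot w \<rho> x) = x"
    unfolding conj_rot_def[of w \<rho> "conj_rot w \<rho> x"] bk rz(3) by (rule brot_inverses(1)[OF x])
  ultimately show "conj_rot w \<rho> x < wsz w \<and> conj_rot w \<rho> x \<noteq> x \<and> conj_rot w \<rho> (conj_rot w \<rho> x) = x" by blast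
qed

text \<open>Moves the rotation from the column list to the pairing, so that a moment of traces
  becomes a combination of overlaps.\<close>

lemma compat_rot_list:
  assumes "length y = wsz w" and r: "fpf_involution (wsz w) \<rho>"
  shows "rot_list w y \<in> compat_lists (wsz w) \<rho> \<longleftrightarrow> y \<in> compat_lists (wsz w) (conj_rot w \<rho>)"
proof -
  have nth: "rot_list w y ! x = y ! brot 0 w x" if "x < wsz w" for x
    using nth_rot_list[of y 0 w x] that assms(1) by simp
  have "\<rho> x < wsz w" if "x < wsz w" for x using r that by (simp add: fpf_involution_def)
  then have "(\<forall>x<wsz w. rot_list w y ! x = rot_list w y ! \<rho> x) \<longleftrightarrow>
      (\<forall>x<wsz w. y ! brot 0 w x = y ! brot 0 w (\<rho> x))" by (simp add: nth)
  also have "\<dots> \<longleftrightarrow> (\<forall>x<wsz w. y ! x = y ! conj_rot w \<rho> x)"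
    using conj_rot_eq_iff[OF r, of "\<lambda>x. y ! x" "\<lambda>x. y ! x"] by simp
  finally show ?thesis using assms(1) length_rot_list[of y w] by (simp add: compat_lists_def)
qed

section \<open>Gram relation and limit of the Weingarten matrix\<close>

lemma nc_proj_expand:
  assumes "j \<in> idx_lists n K"
  shows "nc_proj n i j = (\<Sum>\<pi>\<in>ncp {..<K}. nc_proj_coeff n j (compat_lists K \<pi>) * ind (compat_lists K \<pi>) i)"
proof -
  have "length j = K" using assms by (simp add: idx_lists_def)
  then have "nc_proj n i j = (\<Sum>A\<in>compat_lists K ` ncp {..<K}. nc_proj_coeff n j A * ind A i)"
    unfolding nc_proj_def ncv_eq_compat_lists[symmetric] by simp
  then show ?thesis by (simp add: sum.reindex[OF inj_compat_lists])
qed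

text \<open>The Weingarten matrix of the noncrossing pairings.\<close>

definition wg :: "nat \<Rightarrow> nat \<Rightarrow> (nat \<Rightarrow> nat) \<Rightarrow> (nat \<Rightarrow> nat) \<Rightarrow> real" where
  "wg n K \<pi> \<rho> = (\<Sum>k\<in>idx_lists n K. nc_proj_coeff n k (compat_lists K \<pi>) * nc_proj_coeff n k (compat_lists K \<rho>))"

text \<open>The projection is written as a product of two copies of itself and both are expanded in
  pairings. Summing over the middle index \<open>k\<close> leaves coefficients that depend on
  neither \<open>i\<close> nor \<open>j\<close>.\<close>

lemma nc_proj_wg:
  assumes i: "i \<in> idx_lists n K" and j: "j \<in> idx_lists n K"
  shows "nc_proj n i j = (\<Sum>\<pi>\<in>ncp {..<K}. \<Sum>\<rho>\<in>ncp {..<K}.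
    wg n K \<pi> \<rho> * (ind (compat_lists K \<pi>) i * ind (compat_lists K \<rho>) j))"
proof -
  let ?c = "\<lambda>k \<pi>. nc_proj_coeff n k (compat_lists K \<pi>)" and ?v = "\<lambda>\<pi>. ind (compat_lists K \<pi>)"
  have "nc_proj n i j = (\<Sum>k\<in>idx_lists n K. nc_proj n k i * nc_proj n k j)" by (rule nc_proj_gram[OF i j])
  also have "\<dots> = (\<Sum>k\<in>idx_lists n K. nc_proj n i k * nc_proj n j k)"
    using nc_proj_sym[OF _ i] nc_proj_sym[OF _ j] by (intro sum.cong) auto
  also have "\<dots> = (\<Sum>k\<in>idx_lists n K. \<Sum>\<pi>\<in>ncp {..<K}. \<Sum>\<rho>\<in>ncp {..<K}. (?c k \<pi> * ?c k \<rho>) * (?v \<pi> i * ?v \<rho> j))"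
  proof (intro sum.cong refl)
    fix k assume k: "k \<in> idx_lists n K"
    show "nc_proj n i k * nc_proj n j k = (\<Sum>\<pi>\<in>ncp {..<K}. \<Sum>\<rho>\<in>ncp {..<K}. (?c k \<pi> * ?c k \<rho>) * (?v \<pi> i * ?v \<rho> j))"
      unfolding nc_proj_expand[OF k] sum_product by (intro sum.cong refl) (simp only: mult_ac)
  qed
  also have "\<dots> = (\<Sum>\<pi>\<in>ncp {..<K}. \<Sum>\<rho>\<in>ncp {..<K}. wg n K \<pi> \<rho> * (?v \<pi> i * ?v \<rho> j))"
    unfolding wg_def sum_distrib_right by (subst sum.swap, rule sum.cong[OF refl], rule sum.swap)
  finally show ?thesis .
qed

definition overlap :: "nat \<Rightarrow> nat \<Rightarrow> (nat \<Rightarrow> nat) \<Rightarrow> (nat \<Rightarrow> nat) \<Rightarrow> real" where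
  "overlap n K \<pi> \<rho> = (\<Sum>y\<in>idx_lists n K. ind (compat_lists K \<pi>) y * ind (compat_lists K \<rho>) y)"

text \<open>The projection fixes the pairings, so its matrix entry between \<open>\<alpha>\<close>
  and \<open>\<beta>\<close> is their overlap. In terms of the overlap matrix \<open>G\<close> this
  reads \<open>G W G = G\<close>, which makes sense for singular \<open>G\<close> too.\<close>

lemma wg_gram:
  assumes a: "\<alpha> \<in> ncp {..<K}" and b: "\<beta> \<in> ncp {..<K}"
  shows "(\<Sum>\<pi>\<in>ncp {..<K}. \<Sum>\<rho>\<in>ncp {..<K}. wg n K \<pi> \<rho> * (overlap n K \<pi> \<alpha> * overlap n K \<rho> \<beta>)) = overlap n K \<alpha> \<beta>"
proof -
  let ?v = "\<lambda>\<pi>. ind (compat_lists K \<pi>)" and ?I = "idx_lists n K"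
  have va: "ncv K (compat_lists K \<alpha>)" using ncv_eq_compat_lists[of K] a by blast
  have "overlap n K \<alpha> \<beta> = (\<Sum>j\<in>?I. (\<Sum>i\<in>?I. nc_proj n i j * ?v \<alpha> i) * ?v \<beta> j)"
    unfolding overlap_def using nc_proj_orth[OF _ va] by (intro sum.cong) auto
  also have "\<dots> = (\<Sum>j\<in>?I. \<Sum>i\<in>?I. \<Sum>\<pi>\<in>ncp {..<K}. \<Sum>\<rho>\<in>ncp {..<K}. wg n K \<pi> \<rho> * ((?v \<pi> i * ?v \<alpha> i) * (?v \<rho> j * ?v \<beta> j)))"
  proof (intro sum.cong refl)
    fix j assume j: "j \<in> ?I"
    have "(\<Sum>i\<in>?I. nc_proj n i j * ?v \<alpha> i) * ?v \<beta> j = (\<Sum>i\<in>?I. nc_proj n i j * ?v \<alpha> i * ?v \<beta> j)"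
      by (rule sum_distrib_right)
    also have "\<dots> = (\<Sum>i\<in>?I. \<Sum>\<pi>\<in>ncp {..<K}. \<Sum>\<rho>\<in>ncp {..<K}. wg n K \<pi> \<rho> * ((?v \<pi> i * ?v \<alpha> i) * (?v \<rho> j * ?v \<beta> j)))"
    proof (rule sum.cong[OF refl])
      fix i assume i: "i \<in> ?I"
      show "nc_proj n i j * ?v \<alpha> i * ?v \<beta> j = (\<Sum>\<pi>\<in>ncp {..<K}. \<Sum>\<rho>\<in>ncp {..<K}. wg n K \<pi> \<rho> * ((?v \<pi> i * ?v \<alpha> i) * (?v \<rho> j * ?v \<beta> j)))"
        unfolding nc_proj_wg[OF i j] sum_distrib_right by (intro sum.cong refl) (simp only: mult_ac)
    qed
    finally show "(\<Sum>i\<in>?I. nc_proj n i j * ?v \<alpha> i) * ?v \<beta> j = (\<Sum>i\<in>?I. \<Sum>\<pi>\<in>ncp {..<K}. \<Sum>\<rho>\<in>ncp {..<K}. wg n K \<pi> \<rho> * ((?v \<pi> i * ?v \<alpha> i) * (?v \<rho> j * ?v \<beta> j)))" .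
  qed
  also have "\<dots> = (\<Sum>j\<in>?I. \<Sum>\<pi>\<in>ncp {..<K}. \<Sum>\<rho>\<in>ncp {..<K}. \<Sum>i\<in>?I. wg n K \<pi> \<rho> * ((?v \<pi> i * ?v \<alpha> i) * (?v \<rho> j * ?v \<beta> j)))"
    by (rule sum.cong[OF refl], subst sum.swap, rule sum.cong[OF refl], rule sum.swap)
  also have "\<dots> = (\<Sum>\<pi>\<in>ncp {..<K}. \<Sum>\<rho>\<in>ncp {..<K}. \<Sum>j\<in>?I. \<Sum>i\<in>?I. wg n K \<pi> \<rho> * ((?v \<pi> i * ?v \<alpha> i) * (?v \<rho> j * ?v \<beta> j)))"
    by (subst sum.swap, rule sum.cong[OF refl], rule sum.swap)
  also have "\<dots> = (\<Sum>\<pi>\<in>ncp {..<K}. \<Sum>\<rho>\<in>ncp {..<K}. wg n K \<pi> \<rho> * (overlap n K \<pi> \<alpha> * overlap n K \<rho> \<beta>))"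
  proof (intro sum.cong refl)
    fix \<pi> \<rho>
    show "(\<Sum>j\<in>?I. \<Sum>i\<in>?I. wg n K \<pi> \<rho> * ((?v \<pi> i * ?v \<alpha> i) * (?v \<rho> j * ?v \<beta> j))) =
        wg n K \<pi> \<rho> * (overlap n K \<pi> \<alpha> * overlap n K \<rho> \<beta>)"
      (is "?L = _")
    proof -
      have "?L = (\<Sum>i\<in>?I. \<Sum>j\<in>?I. wg n K \<pi> \<rho> * ((?v \<pi> i * ?v \<alpha> i) * (?v \<rho> j * ?v \<beta> j)))"
        by (rule sum.swap)
      also have "\<dots> = wg n K \<pi> \<rho> * (\<Sum>i\<in>?I. \<Sum>j\<in>?I. (?v \<pi> i * ?v \<alpha> i) * (?v \<rho> j * ?v \<beta> j))"
        by (simp only: sum_distrib_left)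
      finally show ?thesis by (simp only: overlap_def sum_product)
    qed
  qed
  finally show ?thesis by simp
qed

lemma overlap_bound:
  assumes "\<pi> \<in> ncp {..<K}" "\<rho> \<in> ncp {..<K}" "n > 0"
  shows "\<bar>overlap n K \<pi> \<rho> / real n ^ (K div 2) - (if \<pi> = \<rho> then 1 else 0)\<bar> \<le> 1 / real n"
proof -
  have "(\<forall>x<K. \<pi> x = \<rho> x) \<longleftrightarrow> \<pi> = \<rho>"
  proof
    assume *: "\<forall>x<K. \<pi> x = \<rho> x"
    show "\<pi> = \<rho>"
    proof
      fix x show "\<pi> x = \<rho> x"
        using * ncpD(1)[OF assms(1), of x] ncpD(1)[OF assms(2), of x] by (cases "x < K") auto
    qed
  qed simp
  then show ?thesis
    using compat_overlap[OF ncp_fpf[OF assms(1)] ncp_fpf[OF assms(2)] assms(3)] unfolding overlap_def by simp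
qed

lemma LIMSEQ_of_inverse_bound:
  fixes f :: "nat \<Rightarrow> real"
  assumes "\<And>n. n > 0 \<Longrightarrow> \<bar>f n - l\<bar> \<le> 1 / real n"
  shows "f \<longlonglongrightarrow> l"
proof -
  have "(\<lambda>n. f n - l) \<longlonglongrightarrow> 0"
  proof (rule Lim_null_comparison)
    show "\<forall>\<^sub>F n in sequentially. norm (f n - l) \<le> 1 / real n"
      using eventually_gt_at_top[of 0] by eventually_elim (simp add: assms)
    show "(\<lambda>n. 1 / real n) \<longlonglongrightarrow> 0" by (rule lim_1_over_n)
  qed
  then show ?thesis by (simp add: LIM_zero_iff)
qed

text \<open>With \<open>N = n ^ (K div 2)\<close> and \<open>g\<close> the overlaps divided by
  \<open>N\<close>, the Gram relation says that \<open>N W\<close>, multiplied by \<open>g\<close>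
  on both sides, is \<open>g\<close>. As \<open>g\<close> is within \<open>1 / n\<close> of the
  identity, \<open>N W\<close> equals \<open>g\<close> up to \<open>3 / n\<close> times its own
  size, and \<open>perturbation_limit\<close> applies without inverting \<open>g\<close>.\<close>

lemma wg_limit:
  assumes a: "\<alpha> \<in> ncp {..<K}" and b: "\<beta> \<in> ncp {..<K}"
  shows "(\<lambda>n. wg n K \<alpha> \<beta> * real n ^ (K div 2)) \<longlonglongrightarrow> (if \<alpha> = \<beta> then 1 else 0)"
proof -
  let ?P = "ncp {..<K}"
  define N where "N n = real n ^ (K div 2)" for n :: nat
  define w where "w n p = wg n K (fst p) (snd p) * N n" for n p
  define g where "g n p = overlap n K (fst p) (snd p) / N n" for n p
  have fin: "finite (?P \<times> ?P)" using finite_ncp by simp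
  have gb: "\<bar>g n (\<pi>,\<rho>) - (if \<pi> = \<rho> then 1 else 0)\<bar> \<le> 1 / real n" if "\<pi> \<in> ?P" "\<rho> \<in> ?P" "n > 0" for \<pi> \<rho> n
    using overlap_bound[OF that] by (simp add: g_def N_def)
  have eq: "(\<Sum>p\<in>?P \<times> ?P. w n p * (g n (fst p, \<alpha>) * g n (snd p, \<beta>))) = g n (\<alpha>,\<beta>)"
    if "\<alpha> \<in> ?P" "\<beta> \<in> ?P" "n > 0" for \<alpha> \<beta> n
  proof -
    have N: "N n \<noteq> 0" using that by (simp add: N_def)
    have "(\<Sum>p\<in>?P \<times> ?P. w n p * (g n (fst p, \<alpha>) * g n (snd p, \<beta>))) =
        (\<Sum>\<pi>\<in>?P. \<Sum>\<rho>\<in>?P. w n (\<pi>,\<rho>) * (g n (\<pi>,\<alpha>) * g n (\<rho>,\<beta>)))"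
      by (simp add: sum.cartesian_product case_prod_beta)
    also have "\<dots> = (\<Sum>\<pi>\<in>?P. \<Sum>\<rho>\<in>?P. wg n K \<pi> \<rho> * (overlap n K \<pi> \<alpha> * overlap n K \<rho> \<beta>)) / N n"
      unfolding sum_divide_distrib using N by (intro sum.cong refl) (simp add: w_def g_def)
    finally show ?thesis unfolding wg_gram[OF that(1,2)] by (simp add: g_def)
  qed
  have "(\<lambda>n. w n (\<alpha>,\<beta>)) \<longlonglongrightarrow> (case (\<alpha>,\<beta>) of (\<alpha>,\<beta>) \<Rightarrow> if \<alpha> = \<beta> then 1 else 0)"
  proof (rule perturbation_limit[OF fin])
    show "(\<lambda>n. 3 * (1 / real n)) \<longlonglongrightarrow> 0"
      using tendsto_mult[OF tendsto_const lim_1_over_n, of 3] by simp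
    show "(\<lambda>n. g n p) \<longlonglongrightarrow> (case p of (\<alpha>,\<beta>) \<Rightarrow> if \<alpha> = \<beta> then 1 else 0)" if pin: "p \<in> ?P \<times> ?P" for p
    proof -
      obtain \<pi> \<rho> where p: "p = (\<pi>,\<rho>)" "\<pi> \<in> ?P" "\<rho> \<in> ?P" using pin by blast
      have "(\<lambda>n. g n (\<pi>,\<rho>)) \<longlonglongrightarrow> (if \<pi> = \<rho> then 1 else 0)"
        by (rule LIMSEQ_of_inverse_bound) (rule gb[OF p(2,3)])
      then show ?thesis by (simp add: p(1))
    qed
    show "(\<alpha>,\<beta>) \<in> ?P \<times> ?P" using a b by simp
    show "\<forall>\<^sub>F n in sequentially. \<forall>p\<in>?P \<times> ?P. \<bar>w n p - g n p\<bar> \<le> 3 * (1 / real n) * (\<Sum>q\<in>?P \<times> ?P. \<bar>w n q\<bar>)"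
      using eventually_gt_at_top[of 0]
    proof (eventually_elim, intro ballI)
      fix n p assume n: "n > (0::nat)" and p: "p \<in> ?P \<times> ?P"
      obtain \<alpha> \<beta> where pp: "p = (\<alpha>,\<beta>)" and ab: "\<alpha> \<in> ?P" "\<beta> \<in> ?P" using p by blast
      define \<delta> where "\<delta> \<pi> \<rho> = (if \<pi> = \<rho> then 1 else (0::real))" for \<pi> \<rho> :: "nat \<Rightarrow> nat"
      have "w n p = (\<Sum>q\<in>?P \<times> ?P. if q = p then w n q else 0)" using p fin by simp
      also have "\<dots> = (\<Sum>q\<in>?P \<times> ?P. w n q * (\<delta> (fst q) \<alpha> * \<delta> (snd q) \<beta>))"
        by (intro sum.cong) (auto simp: \<delta>_def pp)
      finally have "w n p - g n p = (\<Sum>q\<in>?P \<times> ?P. w n q * (\<delta> (fst q) \<alpha> * \<delta> (snd q) \<beta> - g n (fst q, \<alpha>) * g n (snd q, \<beta>)))"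
        unfolding pp eq[OF ab n, symmetric] by (simp add: sum_subtractf right_diff_distrib)
      also have "\<bar>\<dots>\<bar> \<le> (\<Sum>q\<in>?P \<times> ?P. \<bar>w n q\<bar> * (3 * (1 / real n)))"
      proof (intro order.trans[OF sum_abs] sum_mono)
        fix q assume q: "q \<in> ?P \<times> ?P"
        define u v where "u = g n (fst q, \<alpha>)" and "v = g n (snd q, \<beta>)"
        define d e where "d = \<delta> (fst q) \<alpha>" and "e = \<delta> (snd q) \<beta>"
        have u: "\<bar>u - d\<bar> \<le> 1 / real n" and v: "\<bar>v - e\<bar> \<le> 1 / real n"
          using gb[of "fst q" \<alpha> n] gb[of "snd q" \<beta> n] q ab n by (auto simp: u_def v_def d_def e_def \<delta>_def)
        have d: "\<bar>d\<bar> \<le> 1" "\<bar>e\<bar> \<le> 1" by (auto simp: d_def e_def \<delta>_def)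
        have n1: "1 / real n \<le> 1" using n by simp
        have v2: "\<bar>v\<bar> \<le> 2" using v d n1 by linarith
        \<comment> \<open>The factor \<open>v\<close> is bounded by 2, which doubles one of the two
          errors \<open>1 / n\<close>; hence the constant 3.\<close>
        have "\<bar>d * e - u * v\<bar> = \<bar>d * (e - v) + (d - u) * v\<bar>" by (simp add: algebra_simps)
        also have "\<dots> \<le> \<bar>d\<bar> * \<bar>e - v\<bar> + \<bar>d - u\<bar> * \<bar>v\<bar>" by (metis abs_mult abs_triangle_ineq)
        also have "\<dots> \<le> 1 * (1 / real n) + (1 / real n) * 2"
          using u v d v2 by (intro add_mono mult_mono) (auto simp: abs_minus_commute)
        finally have "\<bar>d * e - u * v\<bar> \<le> 3 * (1 / real n)" by simp
        then show "\<bar>w n q * (\<delta> (fst q) \<alpha> * \<delta> (snd q) \<beta> - g n (fst q, \<alpha>) * g n (snd q, \<beta>))\<bar> \<le> \<bar>w n q\<bar> * (3 * (1 / real n))"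
          unfolding abs_mult u_def v_def d_def e_def by (intro mult_left_mono) auto
      qed
      also have "\<dots> = 3 * (1 / real n) * (\<Sum>q\<in>?P \<times> ?P. \<bar>w n q\<bar>)"
        by (simp add: sum_distrib_left mult.commute)
      finally show "\<bar>w n p - g n p\<bar> \<le> 3 * (1 / real n) * (\<Sum>q\<in>?P \<times> ?P. \<bar>w n q\<bar>)" .
    qed
  qed
  then show ?thesis by (simp add: w_def N_def)
qed

text \<open>The power \<open>n ^ (K div 2)\<close> is taken from the overlaps and given to
  \<open>wg\<close>. Both factors of every summand then converge, to the indicators of
  \<open>\<pi> = \<rho>\<close> and of \<open>\<pi>\<close> agreeing with
  \<open>conj_rot ks \<rho>\<close>, and the sum becomes the cardinality computed in
  \<open>card_ncinv\<close>.\<close>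

theorem free_orth_trace_moments_limit:
  assumes H: "\<And>n. haar_Onplus n (h n)" and ks: "\<forall>p\<in>set ks. fst p \<ge> 1"
  shows "(\<lambda>n. ncp_eval (h n) (tr_moment n ks)) \<longlonglongrightarrow> of_nat (nc_mom ks)"
proof -
  define K where "K = wsz ks"
  let ?P = "ncp {..<K}" and ?v = "\<lambda>\<pi>. ind (compat_lists K \<pi>)"
  define c where "c n \<pi> \<rho> = (\<Sum>y\<in>idx_lists n K. ?v \<pi> y * ?v (conj_rot ks \<rho>) y) / real n ^ (K div 2)" for n \<pi> \<rho>
  have eval: "ncp_eval (h n) (tr_moment n ks) =
      complex_of_real (\<Sum>\<pi>\<in>?P. \<Sum>\<rho>\<in>?P. (wg n K \<pi> \<rho> * real n ^ (K div 2)) * c n \<pi> \<rho>)" if n: "n > 0" for n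
  proof -
    have "ncp_eval (h n) (tr_moment n ks) = (\<Sum>y\<in>idx_lists n K. 1 * h n (zip y (rot_list ks y)))"
      unfolding tr_moment_lc K_def by (rule ncp_eval_lc[OF finite_idx_lists])
    also have "\<dots> = (\<Sum>y\<in>idx_lists n K. complex_of_real (nc_proj n y (rot_list ks y)))"
      using haar_eq_proj[OF H] rot_list_idx[of _ n ks] by (intro sum.cong) (auto simp: K_def)
    also have "\<dots> = complex_of_real (\<Sum>y\<in>idx_lists n K. nc_proj n y (rot_list ks y))" by simp
    also have "(\<Sum>y\<in>idx_lists n K. nc_proj n y (rot_list ks y)) =
        (\<Sum>y\<in>idx_lists n K. \<Sum>\<pi>\<in>?P. \<Sum>\<rho>\<in>?P. wg n K \<pi> \<rho> * (?v \<pi> y * ?v (conj_rot ks \<rho>) y))"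
    proof (rule sum.cong[OF refl])
      fix y assume y: "y \<in> idx_lists n K"
      then have ry: "rot_list ks y \<in> idx_lists n K" and len: "length y = wsz ks"
        using rot_list_idx[of y n ks] by (auto simp: K_def idx_lists_def)
      show "nc_proj n y (rot_list ks y) = (\<Sum>\<pi>\<in>?P. \<Sum>\<rho>\<in>?P. wg n K \<pi> \<rho> * (?v \<pi> y * ?v (conj_rot ks \<rho>) y))"
        unfolding nc_proj_wg[OF y ry]
      proof (intro sum.cong refl)
        fix \<pi> \<rho> assume "\<rho> \<in> ?P"
        then have "?v \<rho> (rot_list ks y) = ?v (conj_rot ks \<rho>) y"
          using compat_rot_list[OF len, of \<rho>] ncp_fpf by (simp add: ind_def K_def)
        then show "wg n K \<pi> \<rho> * (?v \<pi> y * ?v \<rho> (rot_list ks y)) = wg n K \<pi> \<rho> * (?v \<pi> y * ?v (conj_rot ks \<rho>) y)" by simp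
      qed
    qed
    also have "\<dots> = (\<Sum>\<pi>\<in>?P. \<Sum>\<rho>\<in>?P. \<Sum>y\<in>idx_lists n K. wg n K \<pi> \<rho> * (?v \<pi> y * ?v (conj_rot ks \<rho>) y))"
      by (subst sum.swap, rule sum.cong[OF refl], rule sum.swap)
    also have "\<dots> = (\<Sum>\<pi>\<in>?P. \<Sum>\<rho>\<in>?P. (wg n K \<pi> \<rho> * real n ^ (K div 2)) * c n \<pi> \<rho>)"
      using n by (intro sum.cong refl) (simp add: c_def sum_distrib_left[symmetric])
    finally show ?thesis .
  qed
  have clim: "(\<lambda>n. c n \<pi> \<rho>) \<longlonglongrightarrow> (if \<forall>x<K. \<pi> x = conj_rot ks \<rho> x then 1 else 0)" if "\<pi> \<in> ?P" "\<rho> \<in> ?P" for \<pi> \<rho>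
  proof (rule LIMSEQ_of_inverse_bound)
    fix n :: nat assume "n > 0"
    have "fpf_involution K (conj_rot ks \<rho>)"
      unfolding K_def using ncp_fpf[OF that(2)] by (intro fpf_conj_rot) (simp add: K_def)
    from compat_overlap[OF ncp_fpf[OF that(1)] this \<open>n > 0\<close>]
    show "\<bar>c n \<pi> \<rho> - (if \<forall>x<K. \<pi> x = conj_rot ks \<rho> x then 1 else 0)\<bar> \<le> 1 / real n" unfolding c_def .
  qed
  have "(\<lambda>n. \<Sum>\<pi>\<in>?P. \<Sum>\<rho>\<in>?P. (wg n K \<pi> \<rho> * real n ^ (K div 2)) * c n \<pi> \<rho>) \<longlonglongrightarrow>
      (\<Sum>\<pi>\<in>?P. \<Sum>\<rho>\<in>?P. (if \<pi> = \<rho> then 1 else 0) * (if \<forall>x<K. \<pi> x = conj_rot ks \<rho> x then 1 else 0))"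
    by (intro tendsto_sum tendsto_mult wg_limit clim)
  also have "(\<Sum>\<pi>\<in>?P. \<Sum>\<rho>\<in>?P. (if \<pi> = \<rho> then 1 else 0) * (if \<forall>x<K. \<pi> x = conj_rot ks \<rho> x then 1 else 0)) = real (nc_mom ks)"
  proof -
    have fin: "finite ?P" using finite_ncp by simp
    have "(\<Sum>\<pi>\<in>?P. \<Sum>\<rho>\<in>?P. (if \<pi> = \<rho> then 1 else 0) * (if \<forall>x<K. \<pi> x = conj_rot ks \<rho> x then 1 else (0::real))) =
        (\<Sum>\<pi>\<in>?P. \<Sum>\<rho>\<in>?P. if \<rho> = \<pi> then (if \<forall>x<K. \<pi> x = conj_rot ks \<pi> x then 1 else 0) else 0)"
      by (intro sum.cong refl) auto
    also have "\<dots> = (\<Sum>\<pi>\<in>?P. if \<forall>x<K. \<pi> x = conj_rot ks \<pi> x then 1 else 0)"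
      using fin by (intro sum.cong refl) simp
    also have "\<dots> = (\<Sum>\<pi>\<in>?P. if \<pi> \<in> ncinv {0..<0 + wsz ks} (brot 0 ks) then 1 else 0)"
    proof (intro sum.cong refl)
      fix \<pi> assume p: "\<pi> \<in> ?P"
      have "(\<forall>x<K. \<pi> x = conj_rot ks \<pi> x) \<longleftrightarrow> (\<forall>x<K. \<pi> (brot 0 ks x) = brot 0 ks (\<pi> x))"
        using conj_rot_eq_iff[of ks \<pi> \<pi> "\<lambda>x. x"] ncp_fpf[OF p] by (simp add: K_def)
      also have "\<dots> \<longleftrightarrow> \<pi> \<in> ncinv {0..<0 + wsz ks} (brot 0 ks)"
        using p by (auto simp: ncinv_def K_def atLeast0LessThan)
      finally show "(if \<forall>x<K. \<pi> x = conj_rot ks \<pi> x then 1 else (0::real)) = (if \<pi> \<in> ncinv {0..<0 + wsz ks} (brot 0 ks) then 1 else 0)"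
        by simp
    qed
    also have "\<dots> = (\<Sum>\<pi>\<in>?P \<inter> ncinv {0..<0 + wsz ks} (brot 0 ks). 1)"
      by (rule sum.inter_restrict[symmetric, OF fin])
    also have "?P \<inter> ncinv {0..<0 + wsz ks} (brot 0 ks) = ncinv {0..<0 + wsz ks} (brot 0 ks)"
      by (auto simp: ncinv_def K_def atLeast0LessThan)
    finally show ?thesis using card_ncinv[OF ks, of 0] by simp
  qed
  finally have "(\<lambda>n. complex_of_real (\<Sum>\<pi>\<in>?P. \<Sum>\<rho>\<in>?P. (wg n K \<pi> \<rho> * real n ^ (K div 2)) * c n \<pi> \<rho>)) \<longlonglongrightarrow> complex_of_real (real (nc_mom ks))"
    by (rule tendsto_of_real)
  then have "(\<lambda>n. ncp_eval (h n) (tr_moment n ks)) \<longlonglongrightarrow> complex_of_real (real (nc_mom ks))"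
    by (rule Lim_transform_eventually)
      (use eventually_gt_at_top[of 0] in \<open>eventually_elim, simp only: eval\<close>)
  then show ?thesis by simp
qed

theorem theorem4p1:
  fixes \<mu> :: "nat \<Rightarrow> rmat measure"
    and h :: "nat \<Rightarrow> (nat \<times> nat) list \<Rightarrow> complex"
  assumes haar_O: "\<forall>n. haar_On n (\<mu> n)"
    and haar_Oplus: "\<forall>n. haar_Onplus n (h n)"
  shows
    "(\<forall>(M :: 'w measure) (X :: nat \<Rightarrow> 'w \<Rightarrow> real).
        prob_space M
      \<and> prob_space.indep_vars M (\<lambda>_. borel) X {1..}
      \<and> (\<forall>k\<ge>1. distributed M lborel (X k)
                 (normal_density (if even k then 1 else 0) (sqrt (real k))))
      \<longrightarrow> (\<forall>ks :: nat list. (\<forall>k\<in>set ks. k \<ge> 1) \<longrightarrow>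
            (\<lambda>n. \<integral>u. (\<Prod>k\<leftarrow>ks. tr_pow n k u) \<partial>\<mu> n)
              \<longlonglongrightarrow> (\<integral>\<omega>. (\<Prod>k\<leftarrow>ks. X k \<omega>) \<partial>M)))
   \<and> (\<forall>(sm :: complex \<Rightarrow> 'a::ring_1 \<Rightarrow> 'a) st \<phi> (x :: nat \<Rightarrow> 'a).
        star_prob_space sm st \<phi>
      \<and> star_free sm st \<phi> {1..} x
      \<and> semicircular sm st \<phi> 0 1 (x 1)
      \<and> semicircular sm st \<phi> 1 1 (x 2)
      \<and> (\<forall>k\<ge>3. circular sm st \<phi> (x k))
      \<longrightarrow> (\<forall>ks :: (nat \<times> bool) list. (\<forall>(k,e)\<in>set ks. k \<ge> 1) \<longrightarrow>
            (\<lambda>n. ncp_eval (h n) (tr_moment n ks))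
              \<longlonglongrightarrow> \<phi> (prod_list (map (\<lambda>(k,e). if e then st (x k) else x k) ks))))"
proof (intro conjI allI impI)
  fix M :: "'w measure" and X :: "nat \<Rightarrow> 'w \<Rightarrow> real" and ks :: "nat list"
  assume X: "prob_space M \<and> prob_space.indep_vars M (\<lambda>_. borel) X {1..}
      \<and> (\<forall>k\<ge>1. distributed M lborel (X k) (normal_density (if even k then 1 else 0) (sqrt (real k))))"
    and ks: "\<forall>k\<in>set ks. k \<ge> 1"
  have "(\<lambda>n. tr_mom \<mu> n ks) \<longlonglongrightarrow> (\<integral>\<omega>. (\<Prod>k\<leftarrow>ks. X k \<omega>) \<partial>M)"
    using X ks haar_O by (intro orth_trace_moments_limit) blast+
  then show "(\<lambda>n. \<integral>u. (\<Prod>k\<leftarrow>ks. tr_pow n k u) \<partial>\<mu> n) \<longlonglongrightarrow> (\<integral>\<omega>. (\<Prod>k\<leftarrow>ks. X k \<omega>) \<partial>M)"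
    by (simp add: tr_mom_def tr_prod_def)
next
  fix sm :: "complex \<Rightarrow> 'a \<Rightarrow> 'a" and st \<phi> and x :: "nat \<Rightarrow> 'a" and ks :: "(nat \<times> bool) list"
  assume x: "star_prob_space sm st \<phi> \<and> star_free sm st \<phi> {1..} x
      \<and> semicircular sm st \<phi> 0 1 (x 1) \<and> semicircular sm st \<phi> 1 1 (x 2)
      \<and> (\<forall>k\<ge>3. circular sm st \<phi> (x k))"
    and ks: "\<forall>(k,e)\<in>set ks. k \<ge> 1"
  interpret star_ps sm st \<phi> using x by unfold_locales blast
  have "\<phi> (prod_list (map (\<lambda>(k,e). if e then st (x k) else x k) ks)) = of_nat (nc_mom ks)"
    using x ks by (intro free_family_moments) blast+
  moreover have "(\<lambda>n. ncp_eval (h n) (tr_moment n ks)) \<longlonglongrightarrow> of_nat (nc_mom ks)"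
    using haar_Oplus ks by (intro free_orth_trace_moments_limit) auto
  ultimately show "(\<lambda>n. ncp_eval (h n) (tr_moment n ks))
      \<longlonglongrightarrow> \<phi> (prod_list (map (\<lambda>(k,e). if e then st (x k) else x k) ks))" by simp
qed

end
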